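(* Let $N\ge1$. For all $u\in W^{1,2}(\mathbb{R}^N)$ with $\|xu\|_2<\infty$, $$\delta_1(u)\ \ge\ \inf_{c\in\mathbb{R},\,\alpha>0}\left\|u-ce^{-\alpha|x|^2}\right\|_2^2$$ and $$\delta_1(u)\ \ge\ \frac12\inf_{c\in\mathbb{R},\,\alpha>0}\left\{\left\|u-ce^{-\alpha|x|^2}\right\|_2^2:\ \|u\|_2=\left\|ce^{-\alpha|x|^2}\right\|_2\right\}.$$ These inequalities are sharp, and in each of them equality is attained by nontrivial functions.
   Context: All functions are real-valued, $\|\cdot\|_2$ is the $L^2(\mathbb{R}^N)$ norm, and $$\delta_1(u):=\left(\int_{\mathbb{R}^N}|\nabla u|^2dx\right)^{\frac12}\left(\int_{\mathbb{R}^N}|x|^2|u|^2dx\right)^{\frac12}-\frac N2\int_{\mathbb{R}^N}|u|^2dx.$$ "Sharp" means that the constants ($1$ and $\frac12$ respectively) multiplying the infima cannot be replaced by larger ones; "nontrivial" means that equality holds for some $u$ for which the two sides are not both zero. *)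

theory Defs
  imports "HOL-Analysis.Analysis"
begin

primrec C_k :: "nat \<Rightarrow> ('a::euclidean_space \<Rightarrow> real) \<Rightarrow> bool" where
  "C_k 0 f \<longleftrightarrow> continuous_on UNIV f"
| "C_k (Suc k) f \<longleftrightarrow> (\<forall>x. f differentiable (at x)) \<and>
     (\<forall>b\<in>Basis. C_k k (\<lambda>x. frechet_derivative f (at x) b))"

definition test_functions :: "('a::euclidean_space \<Rightarrow> real) set" where
  "test_functions = {\<phi>. (\<forall>k. C_k k \<phi>) \<and> compact (closure {x. \<phi> x \<noteq> 0})}"

definition square_integrable :: "('a::euclidean_space \<Rightarrow> 'b::euclidean_space) \<Rightarrow> bool" where
  "square_integrable f \<longleftrightarrow>
     f \<in> borel_measurable lebesgue \<and> integrable lebesgue (\<lambda>x. (norm (f x))\<^sup>2)"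

definition L2_norm :: "('a::euclidean_space \<Rightarrow> 'b::euclidean_space) \<Rightarrow> real" where
  "L2_norm f = sqrt (\<integral>x. (norm (f x))\<^sup>2 \<partial>lebesgue)"

definition locally_integrable :: "('a::euclidean_space \<Rightarrow> 'b::euclidean_space) \<Rightarrow> bool" where
  "locally_integrable f \<longleftrightarrow> (\<forall>K. compact K \<longrightarrow> f absolutely_integrable_on K)"

definition has_weak_gradient ::
    "('a::euclidean_space \<Rightarrow> real) \<Rightarrow> ('a \<Rightarrow> 'a) \<Rightarrow> bool" where
  "has_weak_gradient u g \<longleftrightarrow> locally_integrable u \<and> locally_integrable g \<and>
     (\<forall>\<phi>\<in>test_functions. \<forall>b\<in>Basis.
        (\<integral>x. u x * frechet_derivative \<phi> (at x) b \<partial>lebesgue) =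
        - (\<integral>x. (g x \<bullet> b) * \<phi> x \<partial>lebesgue))"

text \<open>Weak gradients are unique up to null sets, so the choice below affects no integral.\<close>

definition weak_gradient :: "('a::euclidean_space \<Rightarrow> real) \<Rightarrow> 'a \<Rightarrow> 'a" where
  "weak_gradient u = (SOME g. has_weak_gradient u g)"

definition W12 :: "('a::euclidean_space \<Rightarrow> real) set" where
  "W12 = {u. square_integrable u \<and> (\<exists>g. has_weak_gradient u g \<and> square_integrable g)}"

definition W12_weighted :: "('a::euclidean_space \<Rightarrow> real) set" where
  "W12_weighted = {u \<in> W12. square_integrable (\<lambda>x. u x *\<^sub>R x)}"

definition delta1 :: "('a::euclidean_space \<Rightarrow> real) \<Rightarrow> real" where
  "delta1 u =
     sqrt (\<integral>x. (norm (weak_gradient u x))\<^sup>2 \<partial>lebesgue) *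
     sqrt (\<integral>x. (norm x)\<^sup>2 * (u x)\<^sup>2 \<partial>lebesgue)
     - real DIM('a) / 2 * (\<integral>x. (u x)\<^sup>2 \<partial>lebesgue)"

definition gaussian :: "real \<Rightarrow> real \<Rightarrow> 'a::euclidean_space \<Rightarrow> real" where
  "gaussian c \<alpha> x = c * exp (- \<alpha> * (norm x)\<^sup>2)"

text \<open>Both infima are over nonempty sets of nonnegative reals, so \<^const>\<open>Inf\<close> on the reals is
  the genuine infimum.\<close>

definition gaussian_inf :: "('a::euclidean_space \<Rightarrow> real) \<Rightarrow> real" where
  "gaussian_inf u =
     Inf {(L2_norm (\<lambda>x. u x - gaussian c \<alpha> x))\<^sup>2 | c \<alpha>. \<alpha> > 0}"

definition gaussian_inf_same_norm :: "('a::euclidean_space \<Rightarrow> real) \<Rightarrow> real" where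
  "gaussian_inf_same_norm u =
     Inf {(L2_norm (\<lambda>x. u x - gaussian c \<alpha> x))\<^sup>2 | c \<alpha>.
            \<alpha> > 0 \<and> L2_norm u = L2_norm (gaussian c \<alpha> :: 'a \<Rightarrow> real)}"

end

theory Submission
  imports Defs "HOL-Probability.Distributions"
begin

text \<open>For \<open>l > 0\<close> the Hermite functions of frequency \<open>l\<close> form an orthonormal basis \<open>h\<^sub>k\<close> of
  \<open>L\<^sup>2\<close>, indexed by multi-indices \<open>k\<close>. Multiplication by \<open>x \<bullet> b\<close> and differentiation in direction
  \<open>b\<close> act on them as sum and difference of the same two ladder operators, so Bessel's inequality for
  \<open>xu\<close> and \<open>\<nabla>u\<close> together with the parallelogram law and Parseval's identity for \<open>u\<close> give
  \<open>\<parallel>\<nabla>u\<parallel>\<^sup>2 / l\<^sup>2 + l\<^sup>2 \<parallel>xu\<parallel>\<^sup>2 \<ge> \<Sum>\<^sub>k (2 |k| + N) \<langle>u, h\<^sub>k\<rangle>\<^sup>2 \<ge> (N + 2) \<parallel>u\<parallel>\<^sup>2 - 2 \<langle>u, h\<^sub>0\<rangle>\<^sup>2\<close>.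
  Choosing \<open>l\<^sup>2 = \<parallel>\<nabla>u\<parallel> / \<parallel>xu\<parallel>\<close> bounds \<open>\<delta>\<^sub>1(u)\<close> below by \<open>\<parallel>u\<parallel>\<^sup>2 - \<langle>u, h\<^sub>0\<rangle>\<^sup>2\<close>, and \<open>h\<^sub>0\<close> is a
  Gaussian. The function \<open>x\<^sub>1 exp (-|x|\<^sup>2 / 2)\<close> gives equality in both inequalities, hence sharpness.
  Only \<open>u\<close> and its weak gradient are tested against Hermite functions; no product rule for weak
  derivatives is used.\<close>

section \<open>Smooth functions, bumps and test functions\<close>

text \<open>The numbers \<open>2 |k| + N\<close> are the energy levels of the harmonic oscillator.
  The gap of 2 between the lowest level N and the next one, halved, is the constant 1 of the first
  inequality. Since \<open>l\<close> is chosen after \<open>u\<close>, the Gaussian used depends on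
  \<open>u\<close>; the infimum over all widths permits this. Bessel suffices for the two energies,
  because dropping modes only lowers a lower bound. The mass of \<open>u\<close> itself must be
  captured entirely, so the completeness of the Hermite functions cannot be avoided on this route
  and takes most of the analytic work. For the second inequality let p be the coefficient of
  \<open>u\<close> at the ground state and U the squared norm of \<open>u\<close>. The projection of
  \<open>u\<close> has norm |p|, which is at most sqrt U; stretching it to norm sqrt U, with the
  sign of p, gives squared distance 2 sqrt U (sqrt U - |p|). This is at most 2 (U - p^2), whence the
  factor 1/2. Because \<open>weak_gradient\<close> is a choice, its norm can be computed from a
  concrete gradient only after uniqueness up to null sets is known.\<close>

definition smooth :: "('a::euclidean_space \<Rightarrow> real) \<Rightarrow> bool" where
  "smooth f \<longleftrightarrow> (\<forall>k. C_k k f)"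

abbreviation partial :: "('a::euclidean_space \<Rightarrow> real) \<Rightarrow> 'a \<Rightarrow> 'a \<Rightarrow> real" where
  "partial f b x \<equiv> frechet_derivative f (at x) b"

text \<open>\<open>C_k\<close> refers to \<open>frechet_derivative\<close>, a choice operator. By
  uniqueness of derivatives an explicit \<open>D\<close> may take its place, and the closure
  properties of \<open>C_k\<close> become inductions on the order through this rule.\<close>

lemma C_k_SucI:
  fixes f :: "'a::euclidean_space \<Rightarrow> real"
  assumes "\<And>x. (f has_derivative D x) (at x)" "\<And>b. b \<in> Basis \<Longrightarrow> C_k k (\<lambda>x. D x b)"
  shows "C_k (Suc k) f"
proof -
  have "frechet_derivative f (at x) = D x" for x
    using frechet_derivative_at[OF assms(1)[of x]] by simp
  then show ?thesis
    using assms by (auto simp: differentiable_def)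
qed

lemma C_k_continuous: "C_k k f \<Longrightarrow> continuous_on UNIV f"
proof (cases k)
  case (Suc n)
  moreover assume "C_k k f"
  ultimately show ?thesis
    by (auto intro!: continuous_at_imp_continuous_on differentiable_imp_continuous_within)
qed simp

lemma C_k_SucD: "C_k (Suc k) f \<Longrightarrow> C_k k f"
proof (induction k arbitrary: f)
  case 0
  then show ?case using C_k_continuous[OF 0] by simp
next
  case (Suc k)
  then show ?case by (metis C_k.simps(2))
qed

lemma C_k_Suc_has_derivative:
  "C_k (Suc k) f \<Longrightarrow> (f has_derivative frechet_derivative f (at x)) (at x)"
  by (simp add: frechet_derivative_works)

lemma C_k_const: "C_k k (\<lambda>x. c)"
proof (induction k arbitrary: c)
  case (Suc k)
  show ?case
    by (rule C_k_SucI[where D="\<lambda>x h. 0"]) (use Suc in auto)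
qed simp

lemma C_k_add: "C_k k f \<Longrightarrow> C_k k g \<Longrightarrow> C_k k (\<lambda>x. f x + g x)"
proof (induction k arbitrary: f g)
  case 0
  then show ?case by (auto intro: continuous_on_add)
next
  case (Suc k)
  show ?case
  proof (rule C_k_SucI)
    show "((\<lambda>x. f x + g x) has_derivative
        (\<lambda>h. frechet_derivative f (at x) h + frechet_derivative g (at x) h)) (at x)" for x
      by (intro derivative_intros C_k_Suc_has_derivative[OF Suc.prems(1)]
          C_k_Suc_has_derivative[OF Suc.prems(2)])
  qed (use Suc in auto)
qed

lemma C_k_mult: "C_k k f \<Longrightarrow> C_k k g \<Longrightarrow> C_k k (\<lambda>x. f x * g x)"
proof (induction k arbitrary: f g)
  case 0
  then show ?case by (auto intro: continuous_on_mult)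
next
  case (Suc k)
  show ?case
  proof (rule C_k_SucI)
    show "((\<lambda>x. f x * g x) has_derivative
        (\<lambda>h. f x * frechet_derivative g (at x) h + frechet_derivative f (at x) h * g x)) (at x)" for x
      by (intro derivative_intros C_k_Suc_has_derivative[OF Suc.prems(1)]
          C_k_Suc_has_derivative[OF Suc.prems(2)])
  qed (use Suc C_k_SucD[OF Suc.prems(1)] C_k_SucD[OF Suc.prems(2)] in \<open>auto intro!: C_k_add\<close>)
qed

text \<open>The chain rule replaces \<open>\<psi> n\<close> by \<open>\<psi> (Suc n)\<close>, so the
  outer function comes as the whole sequence of its successive derivatives and the induction on
  \<open>k\<close> leaves \<open>n\<close> free.\<close>

lemma C_k_compose_real:
  assumes "\<And>n t. (\<psi> n has_real_derivative \<psi> (Suc n) t) (at t)"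
  shows "C_k k q \<Longrightarrow> C_k k (\<lambda>x. \<psi> n (q x))"
proof (induction k arbitrary: n)
  case 0
  have "continuous_on UNIV (\<psi> n)"
    by (rule DERIV_continuous_on[OF has_field_derivative_at_within[OF assms]])
  with 0 show ?case
    using continuous_on_compose2[of UNIV "\<psi> n" UNIV q] by simp
next
  case (Suc k)
  show ?case
  proof (rule C_k_SucI)
    show "((\<lambda>x. \<psi> n (q x)) has_derivative (\<lambda>h. \<psi> (Suc n) (q x) * frechet_derivative q (at x) h)) (at x)"
      for x
      using has_derivative_compose[OF C_k_Suc_has_derivative[OF Suc.prems, of x],
          of "\<psi> n" "\<lambda>h. \<psi> (Suc n) (q x) * h"] assms[of n "q x"]
      by (simp add: has_field_derivative_def)
  qed (use Suc C_k_SucD[OF Suc.prems] in \<open>auto intro!: C_k_mult simp del: C_k.simps(2) simp: C_k.simps(2)[of k q]\<close>)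
qed

lemma C_k_inner: "C_k k (\<lambda>x. x \<bullet> b)"
proof (induction k)
  case (Suc k)
  show ?case
    by (rule C_k_SucI[where D="\<lambda>x h. h \<bullet> b"]) (auto intro!: derivative_eq_intros C_k_const)
qed (auto intro!: continuous_intros)

lemma C_k_sum: "(\<And>i. i \<in> A \<Longrightarrow> C_k k (f i)) \<Longrightarrow> C_k k (\<lambda>x. \<Sum>i\<in>A. f i x)"
  by (induction A rule: infinite_finite_induct) (auto intro: C_k_const C_k_add)

lemma smooth_mult: "smooth f \<Longrightarrow> smooth g \<Longrightarrow> smooth (\<lambda>x. f x * g x)"
  by (simp add: smooth_def C_k_mult)

lemma smooth_dist_square: "smooth (\<lambda>x. (norm (x - a))\<^sup>2)"
proof -
  have "(norm (x - a))\<^sup>2 = (\<Sum>b\<in>Basis. (x \<bullet> b + - (a \<bullet> b)) * (x \<bullet> b + - (a \<bullet> b)))" for x :: 'a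
    using euclidean_inner[of "x - a" "x - a"]
    by (simp add: power2_norm_eq_inner inner_diff_left[of x a "_::'a", symmetric])
  then show ?thesis
    unfolding smooth_def by (auto intro!: C_k_sum C_k_mult C_k_add C_k_inner C_k_const simp only:)
qed

lemma smooth_continuous: "smooth f \<Longrightarrow> continuous_on UNIV f"
  using C_k_continuous smooth_def by blast

lemma smooth_has_derivative:
  "smooth f \<Longrightarrow> (f has_derivative frechet_derivative f (at x)) (at x)"
  using C_k_Suc_has_derivative smooth_def by blast

lemma smooth_partial: "smooth f \<Longrightarrow> b \<in> Basis \<Longrightarrow> smooth (partial f b)"
  unfolding smooth_def by (metis C_k.simps(2))

lemma partial_eqI: "(f has_derivative D) (at x) \<Longrightarrow> partial f b x = D b"
  using frechet_derivative_at by metis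

lemma partial_mult:
  "smooth f \<Longrightarrow> smooth g \<Longrightarrow> partial (\<lambda>x. f x * g x) b x = f x * partial g b x + partial f b x * g x"
  by (rule partial_eqI) (intro derivative_intros smooth_has_derivative)

text \<open>The substitution s = 1/t turns this into the fact that the exponential outgrows every
  polynomial at infinity.\<close>

lemma poly_exp_inverse_tendsto_0:
  "((\<lambda>t. poly p (1 / t) * exp (- (1 / t))) \<longlongrightarrow> (0::real)) (at_right 0)"
proof -
  have "((\<lambda>s. poly p s / exp s) \<longlongrightarrow> (0::real)) at_top"
  proof -
    have "((\<lambda>s. \<Sum>i\<le>degree p. coeff p i * (s ^ i / exp s)) \<longlongrightarrow> (\<Sum>i\<le>degree p. coeff p i * (0::real))) at_top"
      by (intro tendsto_intros tendsto_power_div_exp_0)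
    then show ?thesis by (simp add: poly_altdef sum_divide_distrib)
  qed
  then have "((\<lambda>t. poly p (inverse t) / exp (inverse t)) \<longlongrightarrow> (0::real)) (at_right 0)"
    by (rule filterlim_compose[OF _ filterlim_inverse_at_top_right])
  then show ?thesis by (simp add: exp_minus field_simps)
qed

text \<open>Each derivative of \<open>exp (-1/t)\<close> is again a polynomial in \<open>1/t\<close> times \<open>exp (-1/t)\<close>.\<close>

definition flat :: "real poly \<Rightarrow> real \<Rightarrow> real" where
  "flat p t = (if t > 0 then poly p (1 / t) * exp (- (1 / t)) else 0)"

text \<open>With s = 1/t the derivative of P(s) exp(-s) in t is s^2 (P(s) - P'(s)) exp(-s), which
  explains the new polynomial. Only the point 0 needs a limit argument.\<close>

lemma flat_has_derivative:
  "(flat p has_real_derivative flat ([:0, 0, 1:] * (p - pderiv p)) t) (at t)"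
proof -
  consider "t > 0" | "t < 0" | "t = 0" by linarith
  then show ?thesis
  proof cases
    case 1
    have "((\<lambda>t. poly p (1 / t) * exp (- (1 / t))) has_real_derivative
        flat ([:0, 0, 1:] * (p - pderiv p)) t) (at t)"
      using 1 by (auto intro!: derivative_eq_intros DERIV_chain2[OF poly_DERIV]
          simp: flat_def field_simps power2_eq_square)
    then show ?thesis
      by (rule has_field_derivative_transform_within_open[of _ _ _ "{0<..}"]) (use 1 in \<open>auto simp: flat_def\<close>)
  next
    case 2
    have "((\<lambda>t. 0) has_real_derivative flat ([:0, 0, 1:] * (p - pderiv p)) t) (at t)"
      using 2 by (auto simp: flat_def)
    then show ?thesis
      by (rule has_field_derivative_transform_within_open[of _ _ _ "{..<0}"]) (use 2 in \<open>auto simp: flat_def\<close>)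
  next
    case 3
    \<comment> \<open>Dividing by \<open>h\<close> multiplies by 1/h, that is, replaces the
      polynomial \<open>p\<close> by \<open>pCons 0 p\<close>.\<close>
    have "((\<lambda>h. flat p h / h) \<longlongrightarrow> 0) (at_right 0)"
      by (rule Lim_transform_eventually[OF poly_exp_inverse_tendsto_0[of "pCons 0 p"]])
        (auto simp: flat_def eventually_at_filter)
    moreover have "((\<lambda>h. flat p h / h) \<longlongrightarrow> 0) (at_left 0)"
      by (rule tendsto_eventually) (auto simp: flat_def eventually_at_filter)
    ultimately have "((\<lambda>h. flat p h / h) \<longlongrightarrow> 0) (at 0)"
      by (simp add: filterlim_split_at_real)
    then show ?thesis
      using 3 by (simp add: DERIV_def flat_def)
  qed
qed

text \<open>The factor \<open>exp 1\<close> normalises the value at the centre to 1, since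
  \<open>flat 1 1\<close> is exp(-1). The squared norm keeps the inner function polynomial.\<close>

definition bump :: "'a::euclidean_space \<Rightarrow> real \<Rightarrow> 'a \<Rightarrow> real" where
  "bump a r x = exp 1 * flat 1 (1 - (norm (x - a))\<^sup>2 / r\<^sup>2)"

text \<open>Iterates of the polynomial map in \<open>flat_has_derivative\<close>, so that
  \<open>flat (flat_poly n)\<close> is the sequence of derivatives of \<open>flat 1\<close> which
  \<open>C_k_compose_real\<close> asks for.\<close>

primrec flat_poly :: "nat \<Rightarrow> real poly" where
  "flat_poly 0 = 1"
| "flat_poly (Suc n) = [:0, 0, 1:] * (flat_poly n - pderiv (flat_poly n))"

lemma flat_poly_deriv:
  "(flat (flat_poly n) has_real_derivative flat (flat_poly (Suc n)) t) (at t)"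
  using flat_has_derivative by simp

lemma smooth_bump: "smooth (bump a r)"
proof -
  have "C_k k (\<lambda>x. 1 + (- 1 / r\<^sup>2) * (norm (x - a))\<^sup>2)" for k
    by (intro C_k_add C_k_mult C_k_const smooth_dist_square[unfolded smooth_def, rule_format])
  from C_k_compose_real[of "\<lambda>n. flat (flat_poly n)", OF flat_poly_deriv this]
  have "C_k k (\<lambda>x. flat 1 (1 + (- 1 / r\<^sup>2) * (norm (x - a))\<^sup>2))" for k
    by (metis flat_poly.simps(1))
  then show ?thesis
    unfolding smooth_def bump_def[abs_def] by (auto intro!: C_k_mult C_k_const)
qed

lemma bump_pos_iff:
  assumes "r > 0"
  shows "bump a r x > 0 \<longleftrightarrow> x \<in> ball a r"
proof -
  have "bump a r x > 0 \<longleftrightarrow> (norm (x - a))\<^sup>2 / r\<^sup>2 < 1"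
    by (simp add: bump_def flat_def)
  also have "\<dots> \<longleftrightarrow> (norm (x - a))\<^sup>2 < r\<^sup>2"
    using assms by (simp add: divide_less_eq)
  also have "\<dots> \<longleftrightarrow> norm (x - a) < r"
    using assms by (metis less_eq_real_def norm_ge_zero power_less_imp_less_base power_strict_mono zero_less_numeral)
  finally show ?thesis by (simp add: dist_norm norm_minus_commute)
qed

lemma bump_nonneg: "0 \<le> bump a r x"
  by (simp add: bump_def flat_def)

lemma bump_le_1: "bump a r x \<le> 1"
proof (cases "(norm (x - a))\<^sup>2 / r\<^sup>2 < 1")
  case True
  then have "1 \<le> 1 / (1 - (norm (x - a))\<^sup>2 / r\<^sup>2)"
    by (subst le_divide_eq) auto
  then show ?thesis
    by (simp add: bump_def flat_def mult_exp_exp)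
qed (simp add: bump_def flat_def)

lemma bump_support: "r > 0 \<Longrightarrow> bump a r x \<noteq> 0 \<Longrightarrow> x \<in> ball a r"
  using bump_pos_iff bump_nonneg by (metis less_eq_real_def)

section \<open>Test functions and the integrals of their derivatives\<close>

lemma test_functions_iff:
  "\<phi> \<in> test_functions \<longleftrightarrow> smooth \<phi> \<and> (\<exists>R. \<forall>x. \<phi> x \<noteq> 0 \<longrightarrow> norm x \<le> R)"
  by (force simp: test_functions_def smooth_def compact_closure bounded_iff)

lemma bump_test: "r > 0 \<Longrightarrow> bump a r \<in> test_functions"
proof -
  assume r: "r > 0"
  have "norm x \<le> norm a + r" if "bump a r x \<noteq> 0" for x
    using bump_support[OF r that] norm_triangle_sub[of x a] by (auto simp: dist_norm norm_minus_commute)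
  then show ?thesis
    using smooth_bump by (auto simp: test_functions_iff)
qed

lemma smooth_mult_test: "smooth h \<Longrightarrow> \<phi> \<in> test_functions \<Longrightarrow> (\<lambda>x. h x * \<phi> x) \<in> test_functions"
  by (auto simp: test_functions_iff intro!: smooth_mult)

lemma test_partial:
  assumes "\<phi> \<in> test_functions" "b \<in> Basis"
  shows "partial \<phi> b \<in> test_functions"
proof -
  from assms obtain R where s: "smooth \<phi>" and R: "\<And>x. \<phi> x \<noteq> 0 \<Longrightarrow> norm x \<le> R"
    by (auto simp: test_functions_iff)
  have "partial \<phi> b x = 0" if "norm x > R" for x
  proof -
    have "\<phi> y = 0" if "y \<in> - cball 0 R" for y
      using R[of y] that by auto
    then have "(\<phi> has_derivative (\<lambda>h. 0)) (at x)"
      using that by (intro has_derivative_transform_within_open[OF has_derivative_const[of 0], of "- cball 0 R"])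
        (auto simp: open_Compl)
    then show ?thesis using partial_eqI by blast
  qed
  then have "\<forall>x. partial \<phi> b x \<noteq> 0 \<longrightarrow> norm x \<le> R" by (meson not_le)
  then show ?thesis
    using smooth_partial[OF s assms(2)] by (auto simp: test_functions_iff)
qed

lemma test_bounded:
  assumes "\<phi> \<in> test_functions"
  obtains C where "C \<ge> 0" "\<And>x. \<bar>\<phi> x\<bar> \<le> C"
proof -
  from assms obtain R where s: "smooth \<phi>" and R: "\<And>x. \<phi> x \<noteq> 0 \<Longrightarrow> norm x \<le> R"
    by (auto simp: test_functions_iff)
  have "bounded (\<phi> ` cball 0 R)"
    using smooth_continuous[OF s] by (intro compact_imp_bounded compact_continuous_image)
      (auto intro: continuous_on_subset)
  then obtain C where C: "\<And>x. norm x \<le> R \<Longrightarrow> \<bar>\<phi> x\<bar> \<le> C"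
    by (force simp: bounded_iff)
  have "\<bar>\<phi> x\<bar> \<le> \<bar>C\<bar>" for x
    using C[of x] R[of x] by (cases "\<phi> x = 0") auto
  then show thesis by (intro that[of "\<bar>C\<bar>"]) auto
qed

lemma borel_measurable_smooth [measurable_dest]: "smooth f \<Longrightarrow> f \<in> borel_measurable borel"
  using smooth_continuous borel_measurable_continuous_onI by blast

lemma test_smooth: "\<phi> \<in> test_functions \<Longrightarrow> smooth \<phi>"
  by (simp add: test_functions_iff)

lemma lborel_integral_translate:
  fixes f :: "'a::euclidean_space \<Rightarrow> real"
  assumes [measurable]: "f \<in> borel_measurable borel"
  shows "(\<integral>x. f (c + x) \<partial>lborel) = (\<integral>x. f x \<partial>lborel)"
    "integrable lborel (\<lambda>x. f (c + x)) \<longleftrightarrow> integrable lborel f"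
proof -
  show "(\<integral>x. f (c + x) \<partial>lborel) = (\<integral>x. f x \<partial>lborel)"
    by (subst (2) lborel_distr_plus[of c, symmetric], subst integral_distr) auto
  show "integrable lborel (\<lambda>x. f (c + x)) \<longleftrightarrow> integrable lborel f"
    by (subst (2) lborel_distr_plus[of c, symmetric], subst integrable_distr_eq) auto
qed

lemma integrable_cball:
  fixes f :: "'a::euclidean_space \<Rightarrow> real"
  assumes [measurable]: "f \<in> borel_measurable borel" and "\<And>x. \<bar>f x\<bar> \<le> C" "\<And>x. f x \<noteq> 0 \<Longrightarrow> norm x \<le> R"
  shows "integrable lborel f"
proof (rule Bochner_Integration.integrable_bound)
  have "emeasure lborel (cball (0::'a) R) < \<infinity>"
    by (rule emeasure_lborel_cball_finite)
  then show "integrable lborel (\<lambda>x. C * indicator (cball (0::'a) R) x)"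
    by (intro integrable_mult_right) auto
  show "AE x in lborel. norm (f x) \<le> norm (C * indicator (cball 0 R) x)"
    using assms(2,3) by (intro AE_I2) (auto simp: indicator_def split: if_splits intro: order_trans[OF _ abs_ge_self])
qed simp

lemma test_integrable: "\<phi> \<in> test_functions \<Longrightarrow> integrable lborel \<phi>"
proof -
  assume \<phi>: "\<phi> \<in> test_functions"
  obtain C where "\<And>x. \<bar>\<phi> x\<bar> \<le> C" by (rule test_bounded[OF \<phi>]) blast
  then show ?thesis
    using \<phi> integrable_cball[of \<phi> C] borel_measurable_smooth[of \<phi>] by (auto simp: test_functions_iff)
qed

text \<open>Difference quotients have integral \<open>0\<close> by translation invariance.\<close>

lemma test_integral_partial:
  assumes \<phi>: "\<phi> \<in> test_functions" and b: "b \<in> Basis"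
  shows "(\<integral>x. partial \<phi> b x \<partial>lborel) = 0"
proof -
  have [measurable]: "\<phi> \<in> borel_measurable borel" "partial \<phi> b \<in> borel_measurable borel"
    using \<phi> b by (auto simp: test_smooth borel_measurable_smooth smooth_partial)
  note D = smooth_has_derivative[OF test_smooth[OF \<phi>]]
  obtain L where L: "L \<ge> 0" "\<And>x. \<bar>partial \<phi> b x\<bar> \<le> L"
    by (rule test_bounded[OF test_partial[OF \<phi> b]]) blast
  obtain R where R: "\<And>x. \<phi> x \<noteq> 0 \<Longrightarrow> norm x \<le> R"
    using \<phi> by (auto simp: test_functions_iff)
  define q where "q n x = (\<phi> ((1 / real (Suc n)) *\<^sub>R b + x) - \<phi> x) * real (Suc n)" for n x
  have line: "((\<lambda>t. \<phi> (t *\<^sub>R b + x)) has_real_derivative partial \<phi> b (t *\<^sub>R b + x)) (at t)" for t x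
  proof -
    have "((\<lambda>t. t *\<^sub>R b + x) has_derivative (\<lambda>h. h *\<^sub>R b)) (at t)"
      by (auto intro!: derivative_eq_intros)
    from has_derivative_compose[OF this D]
    show ?thesis
      unfolding has_field_derivative_def
      by (simp add: linear_scale[OF has_derivative_linear[OF D]] mult.commute[of _ "partial \<phi> b _"])
  qed
  \<comment> \<open>The shift has length at most 1, hence the radius \<open>R + 1\<close>; with the
    mean value bound \<open>L\<close> one dominating function serves all \<open>n\<close>.\<close>
  have q_bound: "\<bar>q n x\<bar> \<le> L * indicator (cball 0 (R + 1)) x" for n x
  proof (cases "x \<in> cball 0 (R + 1)")
    case True
    have "\<bar>\<phi> ((1 / real (Suc n)) *\<^sub>R b + x) - \<phi> (0 *\<^sub>R b + x)\<bar> \<le> L * \<bar>1 / real (Suc n) - 0\<bar>"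
      using field_differentiable_bound[of UNIV "\<lambda>t. \<phi> (t *\<^sub>R b + x)" "\<lambda>t. partial \<phi> b (t *\<^sub>R b + x)" L
          "1 / real (Suc n)" 0] line L(2)
      by (auto intro: has_field_derivative_at_within simp: real_norm_def)
    then have "\<bar>q n x\<bar> \<le> L"
      unfolding q_def abs_mult by (simp add: le_divide_eq del: of_nat_Suc)
    with True show ?thesis by simp
  next
    case False
    have "norm x \<le> norm ((1 / real (Suc n)) *\<^sub>R b + x) + norm ((1 / real (Suc n)) *\<^sub>R b)"
      by (metis add_diff_cancel_left' norm_triangle_ineq4 add.commute)
    moreover have "norm ((1 / real (Suc n)) *\<^sub>R b) \<le> 1"
      using b by (simp add: divide_simps)
    ultimately have "\<not> norm ((1 / real (Suc n)) *\<^sub>R b + x) \<le> R" "\<not> norm x \<le> R"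
      using False unfolding mem_cball_0 by linarith+
    with R have "\<phi> ((1 / real (Suc n)) *\<^sub>R b + x) = 0" "\<phi> x = 0"
      by blast+
    with False show ?thesis by (simp add: q_def)
  qed
  have int0: "(\<integral>x. q n x \<partial>lborel) = 0" for n
  proof -
    have "integrable lborel \<phi>" by (rule test_integrable[OF \<phi>])
    then have "(\<integral>x. \<phi> ((1 / real (Suc n)) *\<^sub>R b + x) - \<phi> x \<partial>lborel) = 0"
      by (subst Bochner_Integration.integral_diff)
        (auto simp: lborel_integral_translate)
    then show ?thesis by (simp add: q_def)
  qed
  have lim: "(\<lambda>n. q n x) \<longlonglongrightarrow> partial \<phi> b x" for x
  proof -
    have "((\<lambda>h. (\<phi> (h *\<^sub>R b + x) - \<phi> x) / h) \<longlongrightarrow> partial \<phi> b x) (at 0)"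
      using line[of x 0] by (simp add: DERIV_def)
    moreover have "filterlim (\<lambda>n. 1 / real (Suc n)) (at 0) sequentially"
      unfolding filterlim_at using lim_1_over_n LIMSEQ_Suc[OF lim_1_over_n] by auto
    ultimately have "(\<lambda>n. (\<phi> ((1 / real (Suc n)) *\<^sub>R b + x) - \<phi> x) / (1 / real (Suc n))) \<longlonglongrightarrow> partial \<phi> b x"
      by (rule filterlim_compose)
    then show ?thesis by (simp add: q_def)
  qed
  have [measurable]: "q n \<in> borel_measurable borel" for n
    unfolding q_def by measurable
  have "(\<lambda>n. \<integral>x. q n x \<partial>lborel) \<longlonglongrightarrow> (\<integral>x. partial \<phi> b x \<partial>lborel)"
  proof (rule integral_dominated_convergence)
    have "emeasure lborel (cball (0::'a) (R + 1)) < \<infinity>"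
      by (rule emeasure_lborel_cball_finite)
    then show "integrable lborel (\<lambda>x. L * indicator (cball (0::'a) (R + 1)) x)"
      by (intro integrable_mult_right) auto
  qed (use lim q_bound in auto)
  then have "(\<lambda>n::nat. 0::real) \<longlonglongrightarrow> (\<integral>x. partial \<phi> b x \<partial>lborel)"
    by (simp add: int0)
  then show ?thesis by (simp add: LIMSEQ_const_iff)
qed

text \<open>The notions of the theorem are stated for \<open>lebesgue\<close>, the completed
  measure, whereas translations, reflections and product formulas are available for
  \<open>lborel\<close>. On Borel functions the two integrals agree.\<close>

lemma integrable_lebesgue_borel:
  fixes f :: "'a::euclidean_space \<Rightarrow> 'b::euclidean_space"
  shows "f \<in> borel_measurable borel \<Longrightarrow> integrable lebesgue f \<longleftrightarrow> integrable lborel f"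
  by (subst integrable_completion) auto

lemma integral_lebesgue_borel:
  fixes f :: "'a::euclidean_space \<Rightarrow> 'b::euclidean_space"
  shows "f \<in> borel_measurable borel \<Longrightarrow> integral\<^sup>L lebesgue f = integral\<^sup>L lborel f"
  by (subst integral_completion) auto

section \<open>Weak gradients are unique\<close>

text \<open>Weierstrass approximation turns multiplication by \<open>m\<close> into multiplication by the indicator
  of a superlevel set of \<open>m\<close>; the sets whose indicators act on \<open>K\<close> form a \<open>\<sigma>\<close>-algebra.\<close>

lemma functional_monotone_class:
  fixes K :: "('a::euclidean_space \<Rightarrow> real) set"
  assumes add: "\<And>f g. f \<in> K \<Longrightarrow> g \<in> K \<Longrightarrow> (\<lambda>x. f x + g x) \<in> K"
    and scale: "\<And>c f. f \<in> K \<Longrightarrow> (\<lambda>x. c * f x) \<in> K"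
    and lim: "\<And>F f C. (\<And>n::nat. F n \<in> K) \<Longrightarrow> (\<And>n x. \<bar>F n x\<bar> \<le> C) \<Longrightarrow> (\<And>x. (\<lambda>n. F n x) \<longlonglongrightarrow> f x) \<Longrightarrow> f \<in> K"
    and bdd: "\<And>f. f \<in> K \<Longrightarrow> \<exists>C. \<forall>x. \<bar>f x\<bar> \<le> C"
    and balls: "\<And>a r. r > 0 \<Longrightarrow> \<exists>m c. (\<forall>x. 0 \<le> m x \<and> m x \<le> 1) \<and> {x. c < m x} = ball a r \<and>
                 (\<forall>f\<in>K. (\<lambda>x. m x * f x) \<in> K)"
    and A: "A \<in> sets borel" and f: "f \<in> K"
  shows "(\<lambda>x. indicator A x * f x) \<in> K"
proof -
  define \<A> where "\<A> = {A. \<forall>f\<in>K. (\<lambda>x. indicator A x * f x) \<in> K}"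
  have ball: "ball a r \<in> \<A>" if r: "r > 0" for a :: 'a and r :: real
  proof -
    obtain m c where m: "\<And>x. 0 \<le> m x" "\<And>x. m x \<le> 1" and level: "{x. c < m x} = ball a r"
      and mult: "\<And>f. f \<in> K \<Longrightarrow> (\<lambda>x. m x * f x) \<in> K"
      using balls[OF r, of a] by auto
    have poly: "(\<lambda>x. q (m x) * f x) \<in> K" if "real_polynomial_function q" "f \<in> K" for q :: "real \<Rightarrow> real" and f
      using that
    proof (induction arbitrary: f)
      case (linear q)
      have "q t = q 1 * t" for t
        using linear_scale[OF bounded_linear.linear[OF linear(1)], of t 1] by (simp add: mult.commute)
      then have "(\<lambda>x. q (m x) * f x) = (\<lambda>x. q 1 * (m x * f x))"
        by (metis mult.assoc)
      then show ?case using scale mult linear(2) by simp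
    next
      case (add p q)
      then show ?case using assms(1)[of "\<lambda>x. p (m x) * f x" "\<lambda>x. q (m x) * f x"]
        by (simp add: distrib_right)
    next
      case (mult p q)
      then show ?case by (simp add: mult.assoc)
    qed (simp add: scale)
    have "(\<lambda>x. indicator (ball a r) x * f x) \<in> K" if f: "f \<in> K" for f
    proof -
      obtain C where C: "\<And>x. \<bar>f x\<bar> \<le> C" using bdd[OF f] by auto
      \<comment> \<open>A continuous ramp tending pointwise to the indicator of
        \<open>t > c\<close>. Polynomials approximate it uniformly on [0, 1], the range of
        \<open>m\<close>.\<close>
      define \<eta> where "\<eta> n t = min 1 (real n * max 0 (t - c))" for n t
      have "\<exists>q. real_polynomial_function q \<and> (\<forall>t\<in>{0..1}. \<bar>\<eta> n t - q t\<bar> < 1 / real (Suc n))" for n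
      proof -
        have "continuous_on {0..1} (\<eta> n)"
          unfolding \<eta>_def by (intro continuous_intros)
        from Stone_Weierstrass_real_polynomial_function[OF _ this, of "1 / real (Suc n)"]
        show ?thesis by (metis compact_Icc of_nat_0_less_iff zero_less_Suc zero_less_divide_1_iff)
      qed
      then obtain q where q: "\<And>n. real_polynomial_function (q n)"
        and approx: "\<And>n t. 0 \<le> t \<Longrightarrow> t \<le> 1 \<Longrightarrow> \<bar>\<eta> n t - q n t\<bar> < 1 / real (Suc n)"
        by (metis atLeastAtMost_iff)
      have \<eta>_lim: "(\<lambda>n. \<eta> n t) \<longlonglongrightarrow> (if c < t then 1 else 0)" for t
      proof (cases "c < t")
        case True
        obtain N :: nat where N: "real N * (t - c) > 1"
          using True ex_less_of_nat_mult[of "t - c" 1] by auto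
        have "\<eta> n t = 1" if "n \<ge> N" for n
        proof -
          have "real N * (t - c) \<le> real n * (t - c)"
            using that True by (intro mult_right_mono) auto
          then have "1 < real n * (t - c)" using N by linarith
          then show ?thesis using True by (simp add: \<eta>_def)
        qed
        then show ?thesis
          using True by (intro tendsto_eventually eventually_sequentiallyI[of N]) auto
      qed (simp add: \<eta>_def)
      show ?thesis
      proof (rule lim[where F="\<lambda>n x. q n (m x) * f x"])
        show "(\<lambda>x. q n (m x) * f x) \<in> K" for n
          by (rule poly[OF q f])
        \<comment> \<open>The ramp and the approximation error are each at most 1, hence the factor
          2.\<close>
        show "\<bar>q n (m x) * f x\<bar> \<le> 2 * C" for n x
        proof -
          have "\<bar>\<eta> n (m x) - q n (m x)\<bar> < 1 / real (Suc n)" using approx m by blast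
          moreover have "1 / real (Suc n) \<le> 1" by simp
          moreover have "0 \<le> \<eta> n (m x)" "\<eta> n (m x) \<le> 1" by (auto simp: \<eta>_def)
          ultimately have "\<bar>q n (m x)\<bar> \<le> 2" by linarith
          then show ?thesis unfolding abs_mult using C by (intro mult_mono) auto
        qed
        show "(\<lambda>n. q n (m x) * f x) \<longlonglongrightarrow> indicator (ball a r) x * f x" for x
        proof -
          have "(\<lambda>n. q n (m x) - \<eta> n (m x)) \<longlonglongrightarrow> 0"
          proof (rule Lim_null_comparison)
            show "\<forall>\<^sub>F n in sequentially. norm (q n (m x) - \<eta> n (m x)) \<le> 1 / real (Suc n)"
              using approx m by (intro always_eventually) (simp add: abs_minus_commute less_imp_le)
          qed (rule LIMSEQ_Suc[OF lim_1_over_n])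
          from tendsto_add[OF this \<eta>_lim[of "m x"]] have "(\<lambda>n. q n (m x)) \<longlonglongrightarrow> (if c < m x then 1 else 0)"
            by simp
          moreover have "(if c < m x then 1 else 0) = (indicator (ball a r) x :: real)"
            unfolding level[symmetric] by simp
          ultimately show ?thesis by (intro tendsto_intros) simp
        qed
      qed
    qed
    then show ?thesis by (simp add: \<A>_def)
  qed
  \<comment> \<open>Inclusion-exclusion; the intersection term comes from applying the two
    indicators one after the other.\<close>
  have union2: "(\<lambda>x. indicator (S \<union> T) x * f x) \<in> K" if "S \<in> \<A>" "T \<in> \<A>" "f \<in> K" for S T f
  proof -
    have "(\<lambda>x. indicator S x * f x + (indicator T x * f x + (-1) * (indicator S x * (indicator T x * f x)))) \<in> K"
      using that by (intro add scale) (auto simp: \<A>_def)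
    also have "(\<lambda>x. indicator S x * f x + (indicator T x * f x + (-1) * (indicator S x * (indicator T x * f x)))) =
        (\<lambda>x. indicator (S \<union> T) x * f x)"
      by (auto simp: indicator_def fun_eq_iff)
    finally show ?thesis .
  qed
  have zero: "(\<lambda>x. 0) \<in> K"
    using scale[OF f, of 0] by simp
  have union: "(\<Union>i. B i) \<in> \<A>" if B: "\<And>i::nat. B i \<in> \<A>" for B
  proof -
    have fin: "(\<Union>i<n. B i) \<in> \<A>" for n
    proof (induction n)
      case 0
      then show ?case by (simp add: \<A>_def zero)
    next
      case (Suc n)
      then show ?case using union2[OF B Suc] by (simp add: \<A>_def lessThan_Suc)
    qed
    have "(\<lambda>x. indicator (\<Union>i. B i) x * f x) \<in> K" if f: "f \<in> K" for f
    proof -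
      obtain C where C: "\<And>x. \<bar>f x\<bar> \<le> C" using bdd[OF f] by auto
      show ?thesis
      proof (rule lim[where F="\<lambda>n x. indicator (\<Union>i<n. B i) x * f x" and C=C])
        show "(\<lambda>x. indicator (\<Union>i<n. B i) x * f x) \<in> K" for n
          using fin[of n] f by (auto simp: \<A>_def)
        show "\<bar>indicator (\<Union>i<n. B i) x * f x\<bar> \<le> C" for n x
          using C[of x] by (auto simp: indicator_def)
        show "(\<lambda>n. indicator (\<Union>i<n. B i) x * f x) \<longlonglongrightarrow> indicator (\<Union>i. B i) x * f x" for x
          by (intro tendsto_intros LIMSEQ_indicator_UN)
      qed
    qed
    then show ?thesis by (simp add: \<A>_def)
  qed
  have opens: "U \<in> \<A>" if "open U" for U
  proof (cases "U = {}")
    case True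
    then show ?thesis by (simp add: \<A>_def zero)
  next
    case False
    define \<F> where "\<F> = {ball a r | a r. r > 0 \<and> ball a r \<subseteq> U}"
    have U: "\<Union>\<F> = U"
      using that by (auto simp: \<F>_def open_contains_ball) (metis centre_in_ball)
    \<comment> \<open>Lindelof reduces the cover of an open set by balls to a countable one, as the
      closure under countable unions requires.\<close>
    obtain \<G> where \<G>: "\<G> \<subseteq> \<F>" "countable \<G>" "\<Union>\<G> = \<Union>\<F>"
      using Lindelof[of \<F>] by (auto simp: \<F>_def)
    then have "\<G> \<noteq> {}" using False U by auto
    then have "U = (\<Union>i. from_nat_into \<G> i)"
      using \<G> U by (metis range_from_nat_into)
    moreover have "from_nat_into \<G> i \<in> \<A>" for i
      using from_nat_into[OF \<open>\<G> \<noteq> {}\<close>, of i] \<G>(1) ball by (auto simp: \<F>_def)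
    ultimately show ?thesis using union by metis
  qed
  have "B \<in> \<A>" if "B \<in> sigma_sets UNIV {S. open S}" for B
    using that
  proof (induction rule: sigma_sets.induct)
    case Empty
    then show ?case by (simp add: \<A>_def zero)
  next
    case (Compl S)
    have "(\<lambda>x. indicator (UNIV - S) x * f x) \<in> K" if f: "f \<in> K" for f
    proof -
      have "(\<lambda>x. f x + (-1) * (indicator S x * f x)) \<in> K"
        using f Compl by (intro add scale) (auto simp: \<A>_def)
      also have "(\<lambda>x. f x + (-1) * (indicator S x * f x)) = (\<lambda>x. indicator (UNIV - S) x * f x)"
        by (auto simp: indicator_def fun_eq_iff)
      finally show ?thesis .
    qed
    then show ?case by (simp add: \<A>_def)
  next
    case (Basic S)
    then show ?case using opens by simp
  next
    case (Union S)
    then show ?case by (intro union)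
  qed
  moreover have "A \<in> sigma_sets UNIV {S. open S}"
    using A by (simp add: borel_def)
  ultimately show ?thesis using f by (auto simp: \<A>_def)
qed

lemma borel_times_lebesgue_measurable:
  fixes f g :: "'a::euclidean_space \<Rightarrow> real"
  assumes "f \<in> borel_measurable borel" "g \<in> borel_measurable lebesgue"
  shows "(\<lambda>x. f x * g x) \<in> borel_measurable lebesgue"
  by (intro borel_measurable_times measurable_completion assms(2)) (simp add: assms(1))

text \<open>The fundamental lemma of the calculus of variations. A bump times a test function is a
  test function, so the bounded Borel multipliers \<open>\<psi>\<close> for which all integrals of
  \<open>\<psi> F \<phi>\<close> vanish form a class stable under bumps, whose positivity sets are
  balls. By the monotone class lemma the class contains every Borel indicator.\<close>

lemma AE_zero_if_test_integrals_zero: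
  fixes F :: "'a::euclidean_space \<Rightarrow> real"
  assumes F: "\<And>\<phi>. \<phi> \<in> test_functions \<Longrightarrow> integrable lebesgue (\<lambda>x. F x * \<phi> x)"
    and zero: "\<And>\<phi>. \<phi> \<in> test_functions \<Longrightarrow> (\<integral>x. F x * \<phi> x \<partial>lebesgue) = 0"
  shows "AE x in lebesgue. F x = 0"
proof -
  define K :: "('a \<Rightarrow> real) set" where "K = {\<psi> \<in> borel_measurable borel. (\<exists>C. \<forall>x. \<bar>\<psi> x\<bar> \<le> C) \<and>
      (\<forall>\<phi>\<in>test_functions. (\<integral>x. \<psi> x * (F x * \<phi> x) \<partial>lebesgue) = 0)}"
  have K_int: "integrable lebesgue (\<lambda>x. \<psi> x * (F x * \<phi> x))" if \<psi>: "\<psi> \<in> K" and "\<phi> \<in> test_functions" for \<psi> \<phi>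
  proof -
    obtain C where C: "\<And>x. \<bar>\<psi> x\<bar> \<le> C" and [measurable]: "\<psi> \<in> borel_measurable borel"
      using \<psi> by (auto simp: K_def)
    note I = F[OF that(2)]
    show ?thesis
    proof (rule Bochner_Integration.integrable_bound[OF integrable_mult_right[OF I, of C]])
      show "(\<lambda>x. \<psi> x * (F x * \<phi> x)) \<in> borel_measurable lebesgue"
        by (intro borel_times_lebesgue_measurable borel_measurable_integrable[OF I]) simp
      show "AE x in lebesgue. norm (\<psi> x * (F x * \<phi> x)) \<le> norm (C * (F x * \<phi> x))"
        using C order_trans[OF C abs_ge_self] by (intro AE_I2) (simp add: abs_mult mult_right_mono)
    qed
  qed
  have one: "(\<lambda>x. 1) \<in> K"
    using zero by (auto simp: K_def)
  have ind: "(\<lambda>x. indicator A x * 1) \<in> K" if "A \<in> sets borel" for A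
  proof (rule functional_monotone_class[OF _ _ _ _ _ that one])
    show "(\<lambda>x. f x + g x) \<in> K" if "f \<in> K" "g \<in> K" for f g
    proof -
      obtain C1 C2 where "\<And>x. \<bar>f x\<bar> \<le> C1" "\<And>x. \<bar>g x\<bar> \<le> C2"
        using \<open>f \<in> K\<close> \<open>g \<in> K\<close> by (auto simp: K_def)
      then have "\<bar>f x + g x\<bar> \<le> C1 + C2" for x
        by (meson abs_triangle_ineq add_mono order_trans)
      then show ?thesis
        using that K_int[OF that(1)] K_int[OF that(2)]
        by (auto simp: K_def distrib_right Bochner_Integration.integral_add)
    qed
    show "(\<lambda>x. c * f x) \<in> K" if "f \<in> K" for c f
    proof -
      obtain C where "\<And>x. \<bar>f x\<bar> \<le> C"
        using \<open>f \<in> K\<close> by (auto simp: K_def)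
      then have "\<bar>c * f x\<bar> \<le> \<bar>c\<bar> * C" for x
        by (simp add: abs_mult mult_left_mono)
      then show ?thesis
        using that by (auto simp: K_def mult.assoc)
    qed
    show "f \<in> K" if Fn: "\<And>n::nat. G n \<in> K" and C: "\<And>n x. \<bar>G n x\<bar> \<le> C"
      and lim: "\<And>x. (\<lambda>n. G n x) \<longlonglongrightarrow> f x" for G f C
    proof -
      have [measurable]: "G n \<in> borel_measurable borel" for n using Fn by (simp add: K_def)
      have [measurable]: "f \<in> borel_measurable borel"
        by (rule borel_measurable_LIMSEQ_real[OF lim]) simp
      have fC: "\<bar>f x\<bar> \<le> C" for x
        by (rule LIMSEQ_le_const2[OF tendsto_rabs[OF lim]]) (use C in auto)
      have "(\<integral>x. f x * (F x * \<phi> x) \<partial>lebesgue) = 0" if \<phi>: "\<phi> \<in> test_functions" for \<phi>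
      proof -
        note I = F[OF \<phi>]
        have "(\<lambda>n. \<integral>x. G n x * (F x * \<phi> x) \<partial>lebesgue) \<longlonglongrightarrow> (\<integral>x. f x * (F x * \<phi> x) \<partial>lebesgue)"
        proof (rule integral_dominated_convergence)
          show "integrable lebesgue (\<lambda>x. C * \<bar>F x * \<phi> x\<bar>)"
            using I by (intro integrable_mult_right integrable_abs)
          show "AE x in lebesgue. norm (G n x * (F x * \<phi> x)) \<le> C * \<bar>F x * \<phi> x\<bar>" for n
            using C by (intro AE_I2) (simp add: abs_mult mult_right_mono)
          show "AE x in lebesgue. (\<lambda>n. G n x * (F x * \<phi> x)) \<longlonglongrightarrow> f x * (F x * \<phi> x)"
            by (intro AE_I2 tendsto_intros lim)
        qed (rule borel_times_lebesgue_measurable[OF _ borel_measurable_integrable[OF I]]; measurable)+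
        moreover have "(\<integral>x. G n x * (F x * \<phi> x) \<partial>lebesgue) = 0" for n
          using Fn[of n] \<phi> by (simp add: K_def)
        ultimately show ?thesis by (simp add: LIMSEQ_const_iff)
      qed
      then show ?thesis using fC by (auto simp: K_def)
    qed
    show "\<exists>C. \<forall>x. \<bar>f x\<bar> \<le> C" if "f \<in> K" for f
      using that by (simp add: K_def)
    show "\<exists>m c. (\<forall>x. 0 \<le> m x \<and> m x \<le> 1) \<and> {x. c < m x} = ball a r \<and> (\<forall>f\<in>K. (\<lambda>x. m x * f x) \<in> K)"
      if r: "r > 0" for a r
    proof (intro exI conjI allI ballI)
      show "0 \<le> bump a r x" "bump a r x \<le> 1" for x
        by (rule bump_nonneg bump_le_1)+
      show "{x. 0 < bump a r x} = ball a r"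
        by (intro set_eqI) (simp only: mem_Collect_eq bump_pos_iff[OF r])
      fix f assume f: "f \<in> K"
      then obtain C where C: "\<And>x. \<bar>f x\<bar> \<le> C" by (auto simp: K_def)
      have "\<bar>bump a r x * f x\<bar> \<le> 1 * C" for x
        unfolding abs_mult by (intro mult_mono) (use C bump_nonneg[of a r x] bump_le_1[of a r x] in auto)
      moreover have "(\<integral>x. bump a r x * f x * (F x * \<phi> x) \<partial>lebesgue) = 0" if \<phi>: "\<phi> \<in> test_functions" for \<phi>
      proof -
        have "\<forall>\<phi>\<in>test_functions. (\<integral>x. f x * (F x * \<phi> x) \<partial>lebesgue) = 0"
          using f by (simp add: K_def)
        from bspec[OF this smooth_mult_test[OF smooth_bump \<phi>, of a r]] show ?thesis by (simp add: mult_ac)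
      qed
      ultimately show "(\<lambda>x. bump a r x * f x) \<in> K"
        using f borel_measurable_smooth[OF smooth_bump[of a r]] by (auto simp: K_def)
    qed
  qed
  have "AE x in lebesgue. x \<in> ball 0 (real (Suc n)) \<longrightarrow> F x = 0" for n
  proof -
    \<comment> \<open>Positive exactly on the ball, so \<open>F x * \<phi> x = 0\<close> forces
      \<open>F x = 0\<close> there; these balls exhaust the space.\<close>
    define \<phi> :: "'a \<Rightarrow> real" where "\<phi> = bump 0 (real (Suc n))"
    have \<phi>: "\<phi> \<in> test_functions" unfolding \<phi>_def by (rule bump_test) simp
    \<comment> \<open>Uniqueness of densities is applied on \<open>lborel\<close>, hence the passage
      to a Borel representative of the product.\<close>
    obtain G where G [measurable]: "G \<in> borel_measurable lborel" and FG: "AE x in lborel. F x * \<phi> x = G x"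
      using completion_ex_borel_measurable_real[OF borel_measurable_integrable[OF F[OF \<phi>]]] by blast
    have FG': "AE x in lebesgue. F x * \<phi> x = G x"
      using FG by (rule AE_completion)
    have GI: "integrable lborel G"
    proof -
      have "integrable lebesgue G"
        by (rule integrable_cong_AE_imp[OF F[OF \<phi>]]) (use FG' in \<open>auto intro: measurable_completion\<close>)
      then show ?thesis by (simp add: integrable_completion)
    qed
    have "AE x in lborel. G x = 0"
    proof (rule density_unique_real[OF GI])
      show "set_lebesgue_integral lborel A G = set_lebesgue_integral lborel A (\<lambda>x. 0)"
        if A: "A \<in> sets lborel" for A
      proof -
        have A': "A \<in> sets borel" using A by simp
        then have [measurable]: "A \<in> sets lborel" by simp
        have "(\<integral>x. indicator A x * G x \<partial>lebesgue) = (\<integral>x. indicator A x * 1 * (F x * \<phi> x) \<partial>lebesgue)"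
        proof (rule integral_cong_AE)
          show "AE x in lebesgue. indicator A x * G x = indicator A x * 1 * (F x * \<phi> x)"
            using FG' by eventually_elim simp
          show "(\<lambda>x. indicator A x * G x) \<in> borel_measurable lebesgue"
            by (rule measurable_completion) measurable
          show "(\<lambda>x. indicator A x * 1 * (F x * \<phi> x)) \<in> borel_measurable lebesgue"
            using K_int[OF ind[OF A'] \<phi>] by (rule borel_measurable_integrable)
        qed
        also have "\<dots> = 0"
          using ind[OF A'] \<phi> unfolding K_def by blast
        finally show ?thesis
          by (simp add: set_lebesgue_integral_def integral_completion)
      qed
    qed simp
    then have "AE x in lebesgue. G x = 0" by (rule AE_completion)
    with FG' show ?thesis
    proof eventually_elim
      case (elim x)
      have "\<phi> x > 0" if "x \<in> ball 0 (real (Suc n))"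
        using that unfolding \<phi>_def by (subst bump_pos_iff) auto
      then show ?case using elim by auto
    qed
  qed
  then have "AE x in lebesgue. \<forall>n. x \<in> ball 0 (real (Suc n)) \<longrightarrow> F x = 0"
    by (subst AE_all_countable) blast
  then show ?thesis
  proof eventually_elim
    case (elim x)
    obtain n :: nat where "norm x < real n" using reals_Archimedean2 by blast
    then have "x \<in> ball 0 (real (Suc n))" by simp
    with elim show ?case by blast
  qed
qed

lemma locally_integrable_mult_test:
  fixes g :: "'a::euclidean_space \<Rightarrow> 'b::euclidean_space"
  assumes g: "locally_integrable g" and \<phi>: "\<phi> \<in> test_functions"
  shows "integrable lebesgue (\<lambda>x. (g x \<bullet> b) * \<phi> x)"
proof -
  obtain R where R: "\<And>x. \<phi> x \<noteq> 0 \<Longrightarrow> norm x \<le> R"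
    using \<phi> by (auto simp: test_functions_iff)
  obtain C where C: "\<And>x. \<bar>\<phi> x\<bar> \<le> C" by (rule test_bounded[OF \<phi>]) blast
  have "integrable lebesgue (\<lambda>x. indicator (cball 0 R) x *\<^sub>R g x)"
    using g unfolding locally_integrable_def set_integrable_def by auto
  then have I: "integrable lebesgue (\<lambda>x. (indicator (cball 0 R) x *\<^sub>R g x) \<bullet> b)"
    by (rule integrable_inner_left[rotated])
  have eq: "(g x \<bullet> b) * \<phi> x = ((indicator (cball 0 R) x *\<^sub>R g x) \<bullet> b) * \<phi> x" for x
    using R[of x] by (cases "\<phi> x = 0") auto
  show ?thesis
    unfolding eq
  proof (rule Bochner_Integration.integrable_bound[OF integrable_mult_right[OF I, of C]])
    show "(\<lambda>x. ((indicator (cball 0 R) x *\<^sub>R g x) \<bullet> b) * \<phi> x) \<in> borel_measurable lebesgue"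
      by (intro borel_measurable_times borel_measurable_integrable[OF I] measurable_completion)
        (simp add: borel_measurable_smooth test_smooth \<phi>)
    show "AE x in lebesgue. norm (((indicator (cball 0 R) x *\<^sub>R g x) \<bullet> b) * \<phi> x) \<le>
        norm (C * ((indicator (cball 0 R) x *\<^sub>R g x) \<bullet> b))"
      using order_trans[OF C abs_ge_self]
      by (intro AE_I2) (simp only: real_norm_def abs_mult mult.commute[of "\<bar>C\<bar>"] mult_left_mono abs_ge_zero)
  qed
qed

lemma weak_gradient_unique:
  assumes "has_weak_gradient u g" "has_weak_gradient u h"
  shows "AE x in lebesgue. g x = h x"
proof -
  have "AE x in lebesgue. (g x - h x) \<bullet> b = 0" if b: "b \<in> Basis" for b
  proof (rule AE_zero_if_test_integrals_zero)
    fix \<phi> :: "'a \<Rightarrow> real" assume \<phi>: "\<phi> \<in> test_functions"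
    have I: "integrable lebesgue (\<lambda>x. (g x \<bullet> b) * \<phi> x)" "integrable lebesgue (\<lambda>x. (h x \<bullet> b) * \<phi> x)"
      using assms \<phi> by (auto simp: has_weak_gradient_def intro: locally_integrable_mult_test)
    then show "integrable lebesgue (\<lambda>x. (g x - h x) \<bullet> b * \<phi> x)"
      by (simp add: inner_diff_left left_diff_distrib)
    have "(\<integral>x. u x * partial \<phi> b x \<partial>lebesgue) = - (\<integral>x. (g x \<bullet> b) * \<phi> x \<partial>lebesgue)"
      and "(\<integral>x. u x * partial \<phi> b x \<partial>lebesgue) = - (\<integral>x. (h x \<bullet> b) * \<phi> x \<partial>lebesgue)"
      using assms \<phi> b unfolding has_weak_gradient_def by blast+
    then show "(\<integral>x. (g x - h x) \<bullet> b * \<phi> x \<partial>lebesgue) = 0"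
      using I by (simp add: inner_diff_left left_diff_distrib)
  qed
  then have "AE x in lebesgue. \<forall>b\<in>Basis. (g x - h x) \<bullet> b = 0"
    by (intro AE_finite_allI) auto
  then show ?thesis
  proof eventually_elim
    case (elim x)
    then show ?case by (intro euclidean_eqI[of "g x"]) (simp add: inner_diff_left)
  qed
qed

text \<open>Makes \<open>delta1\<close> computable from any concrete gradient. The chosen gradient
  is measurable because it agrees almost everywhere with \<open>g\<close> and Lebesgue measure is
  complete.\<close>

lemma integral_weak_gradient:
  assumes "has_weak_gradient u g" "square_integrable g"
  shows "(\<integral>x. (norm (weak_gradient u x))\<^sup>2 \<partial>lebesgue) = (\<integral>x. (norm (g x))\<^sup>2 \<partial>lebesgue)"
proof -
  have w: "has_weak_gradient u (weak_gradient u)"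
    unfolding weak_gradient_def by (rule someI[of "has_weak_gradient u", OF assms(1)])
  have ae: "AE x in lebesgue. g x = weak_gradient u x"
    using weak_gradient_unique[OF assms(1) w] .
  have "g \<in> borel_measurable lebesgue" using assms(2) by (simp add: square_integrable_def)
  moreover have "weak_gradient u \<in> borel_measurable lebesgue"
    using borel_measurable_AE[OF _ ae] assms(2) by (simp add: square_integrable_def)
  ultimately show ?thesis
    by (intro integral_cong_AE) (use ae in \<open>auto elim: eventually_mono\<close>)
qed

section \<open>Square-integrable functions and integration by parts\<close>

lemma square_integrable_real_iff:
  "square_integrable (f :: 'a::euclidean_space \<Rightarrow> real) \<longleftrightarrow>
     f \<in> borel_measurable lebesgue \<and> integrable lebesgue (\<lambda>x. (f x)\<^sup>2)"
  by (simp add: square_integrable_def)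

lemma square_integrable_bound:
  fixes f g :: "'a::euclidean_space \<Rightarrow> real"
  assumes "f \<in> borel_measurable lebesgue" "square_integrable g" "AE x in lebesgue. \<bar>f x\<bar> \<le> \<bar>g x\<bar>"
  shows "square_integrable f"
proof -
  have "integrable lebesgue (\<lambda>x. (f x)\<^sup>2)"
  proof (rule Bochner_Integration.integrable_bound)
    show "integrable lebesgue (\<lambda>x. (g x)\<^sup>2)"
      using assms(2) by (simp add: square_integrable_real_iff)
    show "(\<lambda>x. (f x)\<^sup>2) \<in> borel_measurable lebesgue"
      using assms(1) by simp
    show "AE x in lebesgue. norm ((f x)\<^sup>2) \<le> norm ((g x)\<^sup>2)"
      using assms(3) by eventually_elim (simp only: real_norm_def abs_power2 abs_le_square_iff)
  qed
  with assms(1) show ?thesis by (simp add: square_integrable_real_iff)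
qed

lemma square_integrable_mult:
  fixes f g :: "'a::euclidean_space \<Rightarrow> real"
  assumes f: "square_integrable f" and g: "square_integrable g"
  shows "integrable lebesgue (\<lambda>x. f x * g x)"
proof (rule Bochner_Integration.integrable_bound)
  show "integrable lebesgue (\<lambda>x. (f x)\<^sup>2 + (g x)\<^sup>2)"
    using f g by (auto simp: square_integrable_real_iff)
  show "(\<lambda>x. f x * g x) \<in> borel_measurable lebesgue"
    using f g by (auto simp: square_integrable_real_iff)
  have "\<bar>f x * g x\<bar> \<le> (f x)\<^sup>2 + (g x)\<^sup>2" for x
  proof -
    have "2 * (\<bar>f x\<bar> * \<bar>g x\<bar>) \<le> (f x)\<^sup>2 + (g x)\<^sup>2"
      using sum_squares_bound[of "\<bar>f x\<bar>" "\<bar>g x\<bar>"] by (simp add: mult.assoc)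
    moreover have "0 \<le> \<bar>f x\<bar> * \<bar>g x\<bar>" by simp
    ultimately show ?thesis unfolding abs_mult by linarith
  qed
  then show "AE x in lebesgue. norm (f x * g x) \<le> norm ((f x)\<^sup>2 + (g x)\<^sup>2)"
    by (intro AE_I2) simp
qed

lemma square_integrable_scale:
  fixes f :: "'a::euclidean_space \<Rightarrow> real"
  shows "square_integrable f \<Longrightarrow> square_integrable (\<lambda>x. c * f x)"
  by (auto simp: square_integrable_real_iff power_mult_distrib)

lemma square_integrable_add:
  fixes f g :: "'a::euclidean_space \<Rightarrow> real"
  assumes f: "square_integrable f" and g: "square_integrable g"
  shows "square_integrable (\<lambda>x. f x + g x)"
  using f g square_integrable_mult[OF f g]
  by (auto simp: square_integrable_real_iff power2_sum mult.assoc)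

lemma square_integrable_diff:
  fixes f g :: "'a::euclidean_space \<Rightarrow> real"
  assumes f: "square_integrable f" and g: "square_integrable g"
  shows "square_integrable (\<lambda>x. f x - g x)"
  using square_integrable_add[OF f square_integrable_scale[OF g, of "-1"]] by simp

lemma square_integrable_zero: "square_integrable (\<lambda>x. 0 :: real)"
  by (simp add: square_integrable_real_iff)

lemma square_integrable_inner:
  fixes g :: "'a::euclidean_space \<Rightarrow> 'b::euclidean_space"
  assumes g: "square_integrable g" and b: "b \<in> Basis"
  shows "square_integrable (\<lambda>x. g x \<bullet> b)"
proof -
  have "integrable lebesgue (\<lambda>x. (g x \<bullet> b)\<^sup>2)"
  proof (rule Bochner_Integration.integrable_bound)
    show "integrable lebesgue (\<lambda>x. (norm (g x))\<^sup>2)" and "(\<lambda>x. (g x \<bullet> b)\<^sup>2) \<in> borel_measurable lebesgue"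
      using g by (auto simp: square_integrable_def)
    show "AE x in lebesgue. norm ((g x \<bullet> b)\<^sup>2) \<le> norm ((norm (g x))\<^sup>2)"
      using Basis_le_norm[OF b] power_mono[of "\<bar>_\<bar>" _ 2] by (intro AE_I2) (simp add: power2_le_iff_abs_le)
  qed
  then show ?thesis
    using g by (auto simp: square_integrable_def)
qed

lemma norm_square_sum: "(norm (x::'a::euclidean_space))\<^sup>2 = (\<Sum>b\<in>Basis. (x \<bullet> b)\<^sup>2)"
  unfolding power2_norm_eq_inner power2_eq_square[of "_ \<bullet> _"] by (rule euclidean_inner)

lemma integral_norm_square:
  fixes g :: "'a::euclidean_space \<Rightarrow> 'b::euclidean_space"
  assumes g: "square_integrable g"
  shows "(\<integral>x. (norm (g x))\<^sup>2 \<partial>lebesgue) = (\<Sum>b\<in>Basis. \<integral>x. (g x \<bullet> b)\<^sup>2 \<partial>lebesgue)"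
  using square_integrable_inner[OF g]
  by (simp add: norm_square_sum Bochner_Integration.integral_sum square_integrable_real_iff)

text \<open>One \<open>L\<close> serves all radii: inside the ball the inner derivative is at most
  2/r in absolute value, outside it the derivative of \<open>flat 1\<close> vanishes. The decay in r
  removes the cut-off term in the integration by parts below.\<close>

lemma bump_partial_bound:
  "\<exists>L. \<forall>r>0. \<forall>x. \<forall>b\<in>Basis. \<bar>partial (bump (0::'a::euclidean_space) r) b x\<bar> \<le> L / r"
proof -
  let ?\<psi> = "flat (flat_poly (Suc 0))"
  have "continuous_on {0..1} ?\<psi>"
    by (rule DERIV_continuous_on[OF has_field_derivative_at_within[OF flat_poly_deriv]])
  then have "bounded (?\<psi> ` {0..1})"
    by (intro compact_imp_bounded compact_continuous_image) auto
  then obtain M where M: "\<And>t. 0 \<le> t \<Longrightarrow> t \<le> 1 \<Longrightarrow> \<bar>?\<psi> t\<bar> \<le> M"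
    by (force simp: bounded_iff)
  have "\<bar>partial (bump (0::'a) r) b x\<bar> \<le> (exp 1 * M * 2) / r" if r: "r > 0" and b: "b \<in> Basis" for r x b
  proof -
    let ?t = "1 - (norm x)\<^sup>2 / r\<^sup>2"
    have "(bump (0::'a) r has_derivative
        (\<lambda>h. exp 1 * (?\<psi> ?t * (- (2 * (x \<bullet> h) / r\<^sup>2))))) (at x)"
    proof -
      have "((\<lambda>x::'a. 1 - (norm x)\<^sup>2 / r\<^sup>2) has_derivative (\<lambda>h. - (2 * (x \<bullet> h) / r\<^sup>2))) (at x)"
      proof -
        have "((\<lambda>x::'a. 1 - (x \<bullet> x) * (1 / r\<^sup>2)) has_derivative (\<lambda>h. - ((x \<bullet> h + h \<bullet> x) * (1 / r\<^sup>2)))) (at x)"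
          by (rule derivative_eq_intros refl | simp)+
        then show ?thesis by (simp add: power2_norm_eq_inner inner_commute)
      qed
      from has_derivative_compose[OF this, of "flat 1" "\<lambda>h. ?\<psi> ?t * h"]
      have "((\<lambda>x. flat 1 (1 - (norm x)\<^sup>2 / r\<^sup>2)) has_derivative (\<lambda>h. ?\<psi> ?t * (- (2 * (x \<bullet> h) / r\<^sup>2)))) (at x)"
        using flat_poly_deriv[of 0] by (simp add: has_field_derivative_def)
      then show ?thesis
        unfolding bump_def[abs_def] by (intro has_derivative_mult_right) simp
    qed
    then have D: "partial (bump 0 r) b x = exp 1 * (?\<psi> ?t * (- (2 * (x \<bullet> b) / r\<^sup>2)))"
      by (rule partial_eqI)
    show ?thesis
    proof (cases "norm x \<le> r")
      case True
      have "(norm x)\<^sup>2 / r\<^sup>2 \<le> 1"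
        using True r by (simp add: power_mono)
      then have \<psi>: "\<bar>?\<psi> ?t\<bar> \<le> M"
        by (intro M) auto
      have "\<bar>x \<bullet> b\<bar> \<le> r" using Basis_le_norm[OF b, of x] True by linarith
      then have "\<bar>2 * (x \<bullet> b) / r\<^sup>2\<bar> \<le> 2 / r"
        using r by (simp add: abs_mult divide_simps power2_eq_square)
      then have "\<bar>?\<psi> ?t\<bar> * \<bar>2 * (x \<bullet> b) / r\<^sup>2\<bar> \<le> M * (2 / r)"
        using \<psi> by (intro mult_mono) (auto intro: order_trans[OF abs_ge_zero])
      then have "exp 1 * (\<bar>?\<psi> ?t\<bar> * \<bar>2 * (x \<bullet> b) / r\<^sup>2\<bar>) \<le> exp 1 * (M * (2 / r))"
        by (intro mult_left_mono) auto
      then show ?thesis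
        unfolding D by (simp add: abs_mult)
    next
      case False
      then have "(norm x)\<^sup>2 / r\<^sup>2 \<ge> 1"
        using r by (simp add: power_mono)
      then have "?\<psi> ?t = 0"
        unfolding flat_def by (intro if_not_P) linarith
      moreover have "M \<ge> 0" using M[of 0] by linarith
      ultimately show ?thesis
        unfolding D using r by simp
    qed
  qed
  then show ?thesis by blast
qed

lemma bump_mult_le: "\<bar>y * bump a r x\<bar> \<le> \<bar>y\<bar>"
  using mult_left_mono[OF bump_le_1[of a r x] abs_ge_zero[of y]]
  by (simp add: abs_mult bump_nonneg)

lemma bump_tendsto_1: "(\<lambda>n. bump 0 (real (Suc n)) x) \<longlonglongrightarrow> 1"
proof -
  have "(\<lambda>n. 1 - (norm x)\<^sup>2 * (1 / real (Suc n))\<^sup>2) \<longlonglongrightarrow> 1 - (norm x)\<^sup>2 * 0\<^sup>2"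
    by (intro tendsto_intros LIMSEQ_Suc[OF lim_1_over_n])
  moreover have "isCont (flat 1) 1"
    using flat_has_derivative DERIV_isCont by blast
  ultimately have "(\<lambda>n. flat 1 (1 - (norm x)\<^sup>2 * (1 / real (Suc n))\<^sup>2)) \<longlonglongrightarrow> flat 1 1"
    by (intro isCont_tendsto_compose[of 1 "flat 1"]) auto
  then have "(\<lambda>n. exp 1 * flat 1 (1 - (norm x)\<^sup>2 * (1 / real (Suc n))\<^sup>2)) \<longlonglongrightarrow> exp 1 * flat 1 1"
    by (intro tendsto_intros)
  then show ?thesis
    by (simp add: bump_def flat_def power_divide mult_exp_exp del: of_nat_Suc)
qed

text \<open>The definition of a weak gradient admits compactly supported tests only. Here
  \<open>h\<close> is cut off by bumps of growing radius and dominated convergence gives the limit.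
  The product rule is applied to the smooth pair of \<open>h\<close> and the bump, never to
  \<open>u\<close>.\<close>

lemma weak_gradient_by_parts:
  fixes u h :: "'a::euclidean_space \<Rightarrow> real"
  assumes g: "has_weak_gradient u g" and u2: "square_integrable u" and g2: "square_integrable g"
    and h: "smooth h" and h2: "square_integrable h" and dh2: "square_integrable (partial h b)"
    and b: "b \<in> Basis"
  shows "(\<integral>x. u x * partial h b x \<partial>lebesgue) = - (\<integral>x. (g x \<bullet> b) * h x \<partial>lebesgue)"
proof -
  obtain L where L: "\<And>r x. r > 0 \<Longrightarrow> \<bar>partial (bump (0::'a) r) b x\<bar> \<le> L / r"
    using bump_partial_bound b by blast
  have L0: "L \<ge> 0" using L[of 1 0] by linarith
  have gb2: "square_integrable (\<lambda>x. g x \<bullet> b)" using square_integrable_inner[OF g2 b] .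
  let ?\<chi> = "\<lambda>n. bump (0::'a) (real (Suc n))"
  have um [measurable]: "u \<in> borel_measurable lebesgue" "(\<lambda>x. g x \<bullet> b) \<in> borel_measurable lebesgue"
    using u2 gb2 by (auto simp: square_integrable_real_iff)
  have hm: "f \<in> borel_measurable lebesgue" if "smooth f" for f :: "'a \<Rightarrow> real"
    using borel_measurable_smooth[OF that] by (intro measurable_completion) simp
  have [measurable]: "h \<in> borel_measurable lebesgue" "partial h b \<in> borel_measurable lebesgue"
     "?\<chi> n \<in> borel_measurable lebesgue" "partial (?\<chi> n) b \<in> borel_measurable lebesgue" for n
    using h smooth_partial[OF _ b] smooth_bump by (auto intro!: hm)
  have d: "partial (\<lambda>x. h x * ?\<chi> n x) b x = h x * partial (?\<chi> n) b x + partial h b x * ?\<chi> n x" for n x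
    by (rule partial_mult[OF h smooth_bump])
  have lim1: "(\<lambda>n. \<integral>x. u x * partial (\<lambda>x. h x * ?\<chi> n x) b x \<partial>lebesgue) \<longlonglongrightarrow> (\<integral>x. u x * partial h b x \<partial>lebesgue)"
  proof (rule integral_dominated_convergence)
    show "integrable lebesgue (\<lambda>x. L * \<bar>u x * h x\<bar> + \<bar>u x * partial h b x\<bar>)"
      using square_integrable_mult[OF u2 h2] square_integrable_mult[OF u2 dh2] by auto
    show "AE x in lebesgue. norm (u x * partial (\<lambda>x. h x * ?\<chi> n x) b x) \<le> L * \<bar>u x * h x\<bar> + \<bar>u x * partial h b x\<bar>" for n
    proof (rule AE_I2)
      fix x
      have "L / real (Suc n) \<le> L"
        using L0 divide_left_mono[of 1 "real (Suc n)" L] by simp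
      then have 1: "\<bar>partial (?\<chi> n) b x\<bar> \<le> L"
        using L[of "real (Suc n)" x] by simp
      have "\<bar>h x * partial (?\<chi> n) b x + partial h b x * ?\<chi> n x\<bar> \<le> \<bar>h x\<bar> * L + \<bar>partial h b x\<bar> * 1"
        using mult_left_mono[OF 1 abs_ge_zero[of "h x"]] bump_mult_le[of "partial h b x" 0 "real (Suc n)" x]
          abs_triangle_ineq[of "h x * partial (?\<chi> n) b x" "partial h b x * ?\<chi> n x"]
        unfolding abs_mult by linarith
      from mult_left_mono[OF this abs_ge_zero[of "u x"]]
      show "norm (u x * partial (\<lambda>x. h x * ?\<chi> n x) b x) \<le> L * \<bar>u x * h x\<bar> + \<bar>u x * partial h b x\<bar>"
        unfolding d real_norm_def abs_mult[of "u x"] by (simp add: algebra_simps)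
    qed
    show "AE x in lebesgue. (\<lambda>n. u x * partial (\<lambda>x. h x * ?\<chi> n x) b x) \<longlonglongrightarrow> u x * partial h b x"
    proof (rule AE_I2)
      fix x
      have "(\<lambda>n. partial (?\<chi> n) b x) \<longlonglongrightarrow> 0"
      proof (rule Lim_null_comparison)
        show "\<forall>\<^sub>F n in sequentially. norm (partial (?\<chi> n) b x) \<le> L * (1 / real (Suc n))"
          using L by (intro always_eventually) (simp del: of_nat_Suc)
        show "(\<lambda>n. L * (1 / real (Suc n))) \<longlonglongrightarrow> 0"
          by (intro tendsto_mult_right_zero LIMSEQ_Suc[OF lim_1_over_n])
      qed
      then have "(\<lambda>n. u x * (h x * partial (?\<chi> n) b x + partial h b x * ?\<chi> n x)) \<longlonglongrightarrow> u x * (h x * 0 + partial h b x * 1)"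
        by (intro tendsto_intros bump_tendsto_1)
      then show "(\<lambda>n. u x * partial (\<lambda>x. h x * ?\<chi> n x) b x) \<longlonglongrightarrow> u x * partial h b x"
        unfolding d by simp
    qed
  qed (auto simp: d simp del: of_nat_Suc)
  have lim2: "(\<lambda>n. \<integral>x. (g x \<bullet> b) * (h x * ?\<chi> n x) \<partial>lebesgue) \<longlonglongrightarrow> (\<integral>x. (g x \<bullet> b) * h x \<partial>lebesgue)"
  proof (rule integral_dominated_convergence)
    show "integrable lebesgue (\<lambda>x. \<bar>(g x \<bullet> b) * h x\<bar>)"
      using square_integrable_mult[OF gb2 h2] by auto
    show "AE x in lebesgue. norm ((g x \<bullet> b) * (h x * ?\<chi> n x)) \<le> \<bar>(g x \<bullet> b) * h x\<bar>" for n
      using bump_mult_le[of "(g _ \<bullet> b) * h _"] by (intro AE_I2) (simp add: mult.assoc)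
    show "AE x in lebesgue. (\<lambda>n. (g x \<bullet> b) * (h x * ?\<chi> n x)) \<longlonglongrightarrow> (g x \<bullet> b) * h x"
    proof (rule AE_I2)
      fix x
      have "(\<lambda>n. (g x \<bullet> b) * (h x * ?\<chi> n x)) \<longlonglongrightarrow> (g x \<bullet> b) * (h x * 1)"
        by (intro tendsto_intros bump_tendsto_1)
      then show "(\<lambda>n. (g x \<bullet> b) * (h x * ?\<chi> n x)) \<longlonglongrightarrow> (g x \<bullet> b) * h x" by simp
    qed
  qed (auto simp del: of_nat_Suc)
  have eq: "(\<integral>x. u x * partial (\<lambda>x. h x * ?\<chi> n x) b x \<partial>lebesgue) =
      - (\<integral>x. (g x \<bullet> b) * (h x * ?\<chi> n x) \<partial>lebesgue)" for n
  proof -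
    have "(\<lambda>x. h x * ?\<chi> n x) \<in> test_functions"
      by (rule smooth_mult_test[OF h bump_test]) simp
    then show ?thesis using g b unfolding has_weak_gradient_def by blast
  qed
  show ?thesis
    by (rule LIMSEQ_unique[OF lim1[unfolded eq] tendsto_minus[OF lim2]])
qed

lemma continuous_locally_integrable:
  fixes f :: "'a::euclidean_space \<Rightarrow> 'b::euclidean_space"
  assumes "continuous_on UNIV f"
  shows "locally_integrable f"
  unfolding locally_integrable_def set_integrable_def
proof (intro allI impI)
  fix K :: "'a set" assume "compact K"
  then have I: "integrable lborel (\<lambda>x. indicator K x *\<^sub>R f x)"
    using assms by (intro borel_integrable_compact) (auto intro: continuous_on_subset)
  then show "integrable lebesgue (\<lambda>x. indicator K x *\<^sub>R f x)"
    using integrable_completion[OF borel_measurable_integrable[OF I]] by simp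
qed

text \<open>The product of \<open>h\<close> with a test function is again a test function, so its
  partial derivatives have integral 0; the classical product rule splits that integral into the two
  sides.\<close>

lemma smooth_has_weak_gradient:
  assumes h: "smooth h"
  shows "has_weak_gradient h (\<lambda>x. \<Sum>b\<in>Basis. partial h b x *\<^sub>R b)"
  unfolding has_weak_gradient_def
proof (intro conjI ballI)
  show "locally_integrable h"
    by (intro continuous_locally_integrable smooth_continuous h)
  show "locally_integrable (\<lambda>x. \<Sum>b\<in>Basis. partial h b x *\<^sub>R b)"
    by (intro continuous_locally_integrable continuous_intros smooth_continuous smooth_partial h)
  fix \<phi> :: "'a \<Rightarrow> real" and b :: 'a assume \<phi>: "\<phi> \<in> test_functions" and b: "b \<in> Basis"
  have inn: "(\<Sum>b\<in>Basis. partial h b x *\<^sub>R b) \<bullet> b = partial h b x" for x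
    using b by (simp add: inner_sum_left_Basis)
  have m: "smooth \<phi>" "smooth (partial \<phi> b)" "smooth (partial h b)"
    using \<phi> b h by (auto intro: test_smooth smooth_partial)
  have I: "integrable lborel (\<lambda>x. h x * partial \<phi> b x)" "integrable lborel (\<lambda>x. partial h b x * \<phi> x)"
    using \<phi> b m h by (auto intro!: test_integrable smooth_mult_test test_partial)
  have "0 = (\<integral>x. partial (\<lambda>x. h x * \<phi> x) b x \<partial>lborel)"
    using test_integral_partial[OF smooth_mult_test[OF h \<phi>] b] by simp
  also have "\<dots> = (\<integral>x. h x * partial \<phi> b x \<partial>lborel) + (\<integral>x. partial h b x * \<phi> x \<partial>lborel)"
    unfolding partial_mult[OF h m(1)] by (rule Bochner_Integration.integral_add[OF I])
  finally show "(\<integral>x. h x * partial \<phi> b x \<partial>lebesgue) =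
      - (\<integral>x. (\<Sum>b\<in>Basis. partial h b x *\<^sub>R b) \<bullet> b * \<phi> x \<partial>lebesgue)"
    unfolding inn using m h
    by (simp add: integral_lebesgue_borel borel_measurable_smooth smooth_mult)
qed

section \<open>Integrability of Gaussians\<close>

lemma integrable_exp_square:
  assumes s: "s > 0"
  shows "integrable lborel (\<lambda>t::real. exp (- s * t\<^sup>2))"
proof -
  \<comment> \<open>The standard deviation for which the normal density has exponent
    \<open>- s * t\<^sup>2\<close>.\<close>
  define \<sigma> where "\<sigma> = sqrt (1 / (2 * s))"
  have \<sigma>: "\<sigma> > 0" and \<sigma>2: "2 * \<sigma>\<^sup>2 = 1 / s"
    using s by (simp_all add: \<sigma>_def)
  have "sqrt (2 * pi * \<sigma>\<^sup>2) * normal_density 0 \<sigma> t = exp (- s * t\<^sup>2)" for t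
  proof -
    have "\<sigma> \<noteq> 0" using \<sigma> by simp
    moreover have "- t\<^sup>2 / (2 * \<sigma>\<^sup>2) = - s * t\<^sup>2" unfolding \<sigma>2 by simp
    ultimately show ?thesis by (simp add: normal_density_def)
  qed
  moreover have "integrable lborel (\<lambda>t. sqrt (2 * pi * \<sigma>\<^sup>2) * normal_density 0 \<sigma> t)"
    using \<sigma> by (intro integrable_mult_right integrable_normal_density)
  ultimately show ?thesis by simp
qed

lemma integrable_exp_norm_square:
  assumes s: "s > 0"
  shows "integrable lebesgue (\<lambda>x::'a::euclidean_space. exp (- s * (norm x)\<^sup>2))"
proof -
  have "(\<integral>\<^sup>+x. ennreal (exp (- s * (norm (x::'a))\<^sup>2)) \<partial>lborel) =
      (\<integral>\<^sup>+x. (\<Prod>b\<in>Basis. ennreal (exp (- s * ((x::'a) \<bullet> b)\<^sup>2))) \<partial>lborel)"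
    by (simp add: norm_square_sum exp_sum[symmetric] sum_distrib_left prod_ennreal sum_negf)
  also have "\<dots> = (\<Prod>b\<in>(Basis::'a set). \<integral>\<^sup>+t. ennreal (exp (- s * t\<^sup>2)) \<partial>lborel)"
    by (subst nn_integral_lborel_prod) auto
  also have "\<dots> < \<infinity>"
    using integrable_exp_square[OF s] by (simp add: nn_integral_eq_integral ennreal_power)
  finally have "integrable lborel (\<lambda>x::'a. exp (- s * (norm x)\<^sup>2))"
    by (intro integrableI_bounded) auto
  then show ?thesis by (subst integrable_lebesgue_borel) auto
qed

lemma gaussian_bound_square_integrable:
  fixes f :: "'a::euclidean_space \<Rightarrow> real"
  assumes "f \<in> borel_measurable borel" "s > 0" "\<And>x. \<bar>f x\<bar> \<le> C * exp (- s * (norm x)\<^sup>2)"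
  shows "square_integrable f"
proof (rule square_integrable_bound)
  show "f \<in> borel_measurable lebesgue"
    using assms(1) by (intro measurable_completion) simp
  have "integrable lebesgue (\<lambda>x::'a. C\<^sup>2 * exp (- (2 * s) * (norm x)\<^sup>2))"
    using assms(2) by (intro integrable_mult_right integrable_exp_norm_square) auto
  moreover have "(exp (- s * t))\<^sup>2 = exp (- (2 * s) * t)" for t :: real
    by (simp add: power2_eq_square mult_exp_exp)
  ultimately show "square_integrable (\<lambda>x::'a. C * exp (- s * (norm x)\<^sup>2))"
    unfolding square_integrable_real_iff power_mult_distrib
    by (intro conjI measurable_completion) auto
  show "AE x in lebesgue. \<bar>f x\<bar> \<le> \<bar>C * exp (- s * (norm x)\<^sup>2)\<bar>"
    using order_trans[OF assms(3) abs_ge_self] by (intro AE_I2)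
qed

section \<open>Hermite functions\<close>

text \<open>The matrix entry of the ladder operators between levels m - 1 and m. It vanishes at 0,
  which removes every term in which a natural-number subtraction \<open>m - 1\<close>
  truncates.\<close>

definition hcoef :: "nat \<Rightarrow> real" where
  "hcoef m = sqrt (real m / 2)"

lemma hcoef_0: "hcoef 0 = 0"
  by (simp add: hcoef_def)

lemma hcoef_Suc_pos: "hcoef (Suc m) > 0"
  by (simp add: hcoef_def)

lemma hcoef_square: "hcoef m * hcoef m = real m / 2"
  by (simp add: hcoef_def)

text \<open>The recurrence is normalised so that all these functions have the same \<open>L\<^sup>2\<close> norm; that
  norm is divided out in the definition of \<open>hermite\<close> below.\<close>

fun hermite1 :: "real \<Rightarrow> nat \<Rightarrow> real \<Rightarrow> real" where
  "hermite1 l 0 t = exp (- (l\<^sup>2 / 2) * t\<^sup>2)"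
| "hermite1 l (Suc m) t =
     (l * t * hermite1 l m t - (if m = 0 then 0 else hcoef m * hermite1 l (m - 1) t)) / hcoef (Suc m)"

declare hermite1.simps(2) [simp del]

text \<open>The defining recurrence solved for the product and made uniform in \<open>m\<close>: at
  \<open>m = 0\<close> the spurious term carries the factor \<open>hcoef 0 = 0\<close>.\<close>

lemma hermite1_mult:
  "l * t * hermite1 l m t = hcoef (Suc m) * hermite1 l (Suc m) t + hcoef m * hermite1 l (m - 1) t"
  using hcoef_Suc_pos[of m] by (simp add: hermite1.simps(2) hcoef_0)

text \<open>Differentiating the recurrence calls on the two preceding functions, hence the strong
  induction. It closes because twice \<open>(hcoef (Suc n))\<^sup>2\<close> exceeds twice
  \<open>(hcoef n)\<^sup>2\<close> by exactly 1, the commutation relation of the ladder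
  operators.\<close>

lemma hermite1_deriv:
  "(hermite1 l m has_real_derivative
     l * (hcoef m * hermite1 l (m - 1) t - hcoef (Suc m) * hermite1 l (Suc m) t)) (at t)"
proof (induction m arbitrary: t rule: less_induct)
  case (less m)
  show ?case
  proof (cases m)
    case 0
    have "((\<lambda>t. exp (- (l\<^sup>2 / 2) * t\<^sup>2)) has_real_derivative - (l * (l * t * exp (- (l\<^sup>2 / 2) * t\<^sup>2)))) (at t)"
      by (auto intro!: derivative_eq_intros simp: power2_eq_square)
    then show ?thesis
      using hermite1_mult[of l t 0] 0 by (simp add: hcoef_0)
  next
    case (Suc n)
    let ?h = "\<lambda>i. hermite1 l i t" and ?c = hcoef
    let ?d = "\<lambda>i. l * (?c i * ?h (i - 1) - ?c (Suc i) * ?h (Suc i))"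
    have pos: "?c (Suc n) \<noteq> 0" using hcoef_Suc_pos[of n] by simp
    have D: "(hermite1 l n has_real_derivative ?d n) (at t)"
      using less.IH[of n t] Suc by simp
    have D': "((\<lambda>t. if n = 0 then 0 else ?c n * hermite1 l (n - 1) t) has_real_derivative ?c n * ?d (n - 1)) (at t)"
    proof (cases "n = 0")
      case False
      then have "(hermite1 l (n - 1) has_real_derivative ?d (n - 1)) (at t)"
        using less.IH[of "n - 1" t] Suc by simp
      with False show ?thesis by (auto intro: DERIV_cmult)
    qed (simp add: hcoef_0)
    have "((\<lambda>t. l * t * hermite1 l n t - (if n = 0 then 0 else ?c n * hermite1 l (n - 1) t)) has_real_derivative
        l * 1 * ?h n + ?d n * (l * t) - ?c n * ?d (n - 1)) (at t)"
      by (intro DERIV_diff DERIV_mult DERIV_cmult DERIV_ident D D')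
    from DERIV_cdivide[OF this, of "?c (Suc n)"]
    have D1: "(hermite1 l (Suc n) has_real_derivative
        (l * 1 * ?h n + ?d n * (l * t) - ?c n * ?d (n - 1)) / ?c (Suc n)) (at t)"
      by (simp only: hermite1.simps(2)[abs_def, symmetric])
    have eq: "l * 1 * ?h n + ?d n * (l * t) - ?c n * ?d (n - 1) = ?c (Suc n) * ?d (Suc n)"
    proof -
      \<comment> \<open>The extra factor \<open>?c n\<close> makes the identity trivial at
        \<open>n = 0\<close>, where \<open>n - 1\<close> truncates.\<close>
      have a: "l * t * ?h (n - 1) * ?c n = (?c n * ?h n + ?c (n - 1) * ?h (n - 1 - 1)) * ?c n"
        using hermite1_mult[of l t "n - 1"] by (cases n) (simp_all add: hcoef_0)
      have b: "l * t * ?h (Suc n) = ?c (Suc (Suc n)) * ?h (Suc (Suc n)) + ?c (Suc n) * ?h n"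
        using hermite1_mult[of l t "Suc n"] by simp
      have e: "?c n * ?d (n - 1) = l * (?c n * ?c (n - 1) * ?h (n - 1 - 1) - ?c n * ?c n * ?h n)"
        by (cases n) (simp_all add: hcoef_0 algebra_simps)
      have f: "l * t * ?d n = l * (l * t * ?h (n - 1) * ?c n - ?c (Suc n) * (l * t * ?h (Suc n)))"
        by (simp add: algebra_simps)
      have g: "1 + 2 * (?c n * ?c n) = 2 * (?c (Suc n) * ?c (Suc n))"
        by (simp add: hcoef_square)
      have "l * 1 * ?h n + ?d n * (l * t) - ?c n * ?d (n - 1) =
          l * ?h n + l * t * ?d n - ?c n * ?d (n - 1)" by simp
      also have "\<dots> = l * ((1 + 2 * (?c n * ?c n)) * ?h n
            - ?c (Suc n) * (?c (Suc (Suc n)) * ?h (Suc (Suc n)) + ?c (Suc n) * ?h n))"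
        unfolding f a b e by (simp add: algebra_simps)
      also have "\<dots> = ?c (Suc n) * ?d (Suc n)"
        unfolding g by (simp add: algebra_simps)
      finally show ?thesis .
    qed
    show ?thesis
      using D1[unfolded eq] pos Suc by simp
  qed
qed

text \<open>Any loss in the exponent pays for a factor |t|, because |t| is at most 1 + t^2 and exp(e
  t^2) at least 1 + e t^2. The exponents may have any sign; the case \<open>s' = 0\<close> later
  bounds linear functions.\<close>

lemma abs_mult_exp_le:
  assumes "(s::real) < s'"
  obtains C where "\<And>t. \<bar>t\<bar> * exp (- s' * t\<^sup>2) \<le> C * exp (- s * t\<^sup>2)"
proof -
  define e where "e = s' - s"
  have e: "e > 0" using assms by (simp add: e_def)
  have "\<bar>t\<bar> * exp (- s' * t\<^sup>2) \<le> (1 + 1 / e) * exp (- s * t\<^sup>2)" for t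
  proof -
    have "\<bar>t\<bar> \<le> 1 + t\<^sup>2"
      using sum_squares_bound[of 1 "\<bar>t\<bar>"] by simp
    also have "\<dots> \<le> (1 + 1 / e) * (1 + e * t\<^sup>2)"
      using e by (simp add: algebra_simps)
    also have "\<dots> \<le> (1 + 1 / e) * exp (e * t\<^sup>2)"
      using e exp_ge_add_one_self[of "e * t\<^sup>2"] by (intro mult_left_mono) auto
    finally have "\<bar>t\<bar> * exp (- s' * t\<^sup>2) \<le> (1 + 1 / e) * exp (e * t\<^sup>2) * exp (- s' * t\<^sup>2)"
      by (rule mult_right_mono) simp
    also have "\<dots> = (1 + 1 / e) * exp (- s * t\<^sup>2)"
      by (simp add: e_def mult_exp_exp mult.assoc algebra_simps flip: exp_add)
    finally show ?thesis .
  qed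
  then show thesis by (rule that)
qed

text \<open>Each use of the recurrence brings a factor t and spends a little of the exponent.
  Stating the bound for every \<open>s\<close> below l^2/2 leaves room for the intermediate
  \<open>s'\<close>.\<close>

lemma hermite1_bound:
  assumes "s < l\<^sup>2 / 2"
  shows "\<exists>C\<ge>0. \<forall>t. \<bar>hermite1 l m t\<bar> \<le> C * exp (- s * t\<^sup>2)"
  using assms
proof (induction m arbitrary: s rule: less_induct)
  case (less m)
  show ?case
  proof (cases m)
    case 0
    have "exp (- (l\<^sup>2 / 2) * t\<^sup>2) \<le> 1 * exp (- s * t\<^sup>2)" for t
      using less.prems mult_right_mono[of s "l\<^sup>2 / 2" "t\<^sup>2"] by simp
    then show ?thesis using 0 by (intro exI[of _ 1]) simp
  next
    case (Suc n)
    obtain s' where s': "s < s'" "s' < l\<^sup>2 / 2"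
      using dense[OF less.prems] by blast
    obtain C1 where C1: "\<And>t. \<bar>t\<bar> * exp (- s' * t\<^sup>2) \<le> C1 * exp (- s * t\<^sup>2)"
      using abs_mult_exp_le[OF s'(1)] by blast
    obtain C2 where C2: "C2 \<ge> 0" "\<And>t. \<bar>hermite1 l n t\<bar> \<le> C2 * exp (- s' * t\<^sup>2)"
      using less.IH[of n s'] s' Suc by auto
    have "n - 1 < m" using Suc by simp
    from less.IH[OF this less.prems]
    obtain C3 where C3: "C3 \<ge> 0" "\<And>t. \<bar>hermite1 l (n - 1) t\<bar> \<le> C3 * exp (- s * t\<^sup>2)"
      by blast
    define C where "C = (\<bar>l\<bar> * C2 * C1 + \<bar>hcoef n\<bar> * C3) / hcoef (Suc n)"
    have bd: "\<bar>hermite1 l (Suc n) t\<bar> \<le> C * exp (- s * t\<^sup>2)" for t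
    proof -
      have "\<bar>l * t * hermite1 l n t\<bar> \<le> \<bar>l\<bar> * C2 * (C1 * exp (- s * t\<^sup>2))"
      proof -
        have "\<bar>l * t * hermite1 l n t\<bar> \<le> \<bar>l\<bar> * \<bar>t\<bar> * (C2 * exp (- s' * t\<^sup>2))"
          unfolding abs_mult by (intro mult_left_mono C2) auto
        also have "\<dots> = \<bar>l\<bar> * C2 * (\<bar>t\<bar> * exp (- s' * t\<^sup>2))" by simp
        also have "\<dots> \<le> \<bar>l\<bar> * C2 * (C1 * exp (- s * t\<^sup>2))"
          using C2(1) by (intro mult_left_mono C1) auto
        finally show ?thesis .
      qed
      moreover have "\<bar>if n = 0 then 0 else hcoef n * hermite1 l (n - 1) t\<bar> \<le> \<bar>hcoef n\<bar> * (C3 * exp (- s * t\<^sup>2))"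
        using C3(2)[of t] by (auto simp: abs_mult hcoef_0 intro!: mult_left_mono)
      ultimately have "\<bar>l * t * hermite1 l n t - (if n = 0 then 0 else hcoef n * hermite1 l (n - 1) t)\<bar> \<le>
          (\<bar>l\<bar> * C2 * C1 + \<bar>hcoef n\<bar> * C3) * exp (- s * t\<^sup>2)"
        unfolding distrib_right mult.assoc by linarith
      then show ?thesis
        unfolding hermite1.simps(2) C_def using hcoef_Suc_pos[of n]
        by (simp add: divide_right_mono)
    qed
    have "C \<ge> 0"
      using order_trans[OF abs_ge_zero bd[of 0]] by simp
    with bd show ?thesis using Suc by blast
  qed
qed

text \<open>Indices are functions on the whole type, but \<open>hermite\<close> reads them on
  \<open>Basis\<close> only. Fixing the other values to 0 keeps one function from having several
  indices.\<close>

definition multi_index :: "('a::euclidean_space \<Rightarrow> nat) set" where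
  "multi_index = {k. \<forall>b. b \<notin> Basis \<longrightarrow> k b = 0}"

definition hermite :: "real \<Rightarrow> ('a::euclidean_space \<Rightarrow> nat) \<Rightarrow> 'a \<Rightarrow> real" where
  "hermite l k x = (1 / L2_norm (gaussian 1 (l\<^sup>2 / 2) :: 'a \<Rightarrow> real)) * (\<Prod>b\<in>Basis. hermite1 l (k b) (x \<bullet> b))"

abbreviation up :: "('a \<Rightarrow> nat) \<Rightarrow> 'a \<Rightarrow> 'a \<Rightarrow> nat" where
  "up k b \<equiv> k(b := Suc (k b))"

abbreviation down :: "('a \<Rightarrow> nat) \<Rightarrow> 'a \<Rightarrow> 'a \<Rightarrow> nat" where
  "down k b \<equiv> k(b := k b - 1)"

text \<open>Isolates coordinate \<open>b\<close> with its index left free, so that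
  \<open>up\<close>, \<open>down\<close> and \<open>k\<close> itself share the same cofactor and the
  one-dimensional identities transfer to the product.\<close>

lemma hermite_factor:
  fixes k :: "'a::euclidean_space \<Rightarrow> nat"
  assumes b: "b \<in> Basis"
  shows "hermite l (k(b := j)) x = hermite1 l j (x \<bullet> b) *
    ((1 / L2_norm (gaussian 1 (l\<^sup>2 / 2) :: 'a \<Rightarrow> real)) * (\<Prod>c\<in>Basis - {b}. hermite1 l (k c) (x \<bullet> c)))"
  unfolding hermite_def prod.remove[OF finite_Basis b] by simp

lemma hermite_mult:
  fixes x :: "'a::euclidean_space"
  assumes b: "b \<in> Basis"
  shows "l * (x \<bullet> b) * hermite l k x = hcoef (Suc (k b)) * hermite l (up k b) x + hcoef (k b) * hermite l (down k b) x"
proof -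
  let ?P = "(1 / L2_norm (gaussian 1 (l\<^sup>2 / 2) :: 'a \<Rightarrow> real)) * (\<Prod>c\<in>Basis - {b}. hermite1 l (k c) (x \<bullet> c))"
  have "hermite l k x = hermite1 l (k b) (x \<bullet> b) * ?P"
    using hermite_factor[OF b, of l k "k b" x] by simp
  then have "l * (x \<bullet> b) * hermite l k x = (l * (x \<bullet> b) * hermite1 l (k b) (x \<bullet> b)) * ?P"
    by simp
  then show ?thesis
    unfolding hermite1_mult hermite_factor[OF b] by (simp only: distrib_right mult.assoc)
qed

lemma hermite_has_derivative:
  "(hermite l k has_derivative (\<lambda>h. \<Sum>b\<in>Basis. (h \<bullet> b) *
     (l * (hcoef (k b) * hermite l (down k b) x - hcoef (Suc (k b)) * hermite l (up k b) x)))) (at x)"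
proof -
  let ?Z = "1 / L2_norm (gaussian 1 (l\<^sup>2 / 2) :: 'a \<Rightarrow> real)"
  let ?d = "\<lambda>b. l * (hcoef (k b) * hermite1 l (k b - 1) (x \<bullet> b) - hcoef (Suc (k b)) * hermite1 l (Suc (k b)) (x \<bullet> b))"
  have "((\<lambda>x. hermite1 l (k b) (x \<bullet> b)) has_derivative (\<lambda>h. ?d b * (h \<bullet> b))) (at x)" for b
    using has_derivative_compose[of "\<lambda>x. x \<bullet> b" "\<lambda>h. h \<bullet> b" x UNIV "hermite1 l (k b)" "\<lambda>h. ?d b * h"]
      hermite1_deriv[of l "k b" "x \<bullet> b"]
    by (simp add: has_field_derivative_def bounded_linear_imp_has_derivative bounded_linear_inner_left)
  then have "((\<lambda>x. \<Prod>b\<in>Basis. hermite1 l (k b) (x \<bullet> b)) has_derivative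
      (\<lambda>h. \<Sum>b\<in>Basis. ?d b * (h \<bullet> b) * (\<Prod>c\<in>Basis - {b}. hermite1 l (k c) (x \<bullet> c)))) (at x)"
    by (rule has_derivative_prod)
  then have "(hermite l k has_derivative
      (\<lambda>h. ?Z * (\<Sum>b\<in>Basis. ?d b * (h \<bullet> b) * (\<Prod>c\<in>Basis - {b}. hermite1 l (k c) (x \<bullet> c))))) (at x)"
    unfolding hermite_def[abs_def] by (rule has_derivative_mult_right)
  moreover have "?Z * (\<Sum>b\<in>Basis. ?d b * (h \<bullet> b) * (\<Prod>c\<in>Basis - {b}. hermite1 l (k c) (x \<bullet> c))) =
      (\<Sum>b\<in>Basis. (h \<bullet> b) * (l * (hcoef (k b) * hermite l (down k b) x - hcoef (Suc (k b)) * hermite l (up k b) x)))" for h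
    unfolding sum_distrib_left
    by (rule sum.cong[OF refl]) (simp add: hermite_factor algebra_simps)
  ultimately show ?thesis by simp
qed

lemma sum_inner_Basis:
  "b \<in> Basis \<Longrightarrow> (\<Sum>c\<in>Basis. (b \<bullet> c) * f c) = (f b :: real)"
  by (simp add: inner_Basis if_distrib[of "\<lambda>t. t * _"] cong: if_cong)

lemma partial_hermite:
  "b \<in> Basis \<Longrightarrow> partial (hermite l k) b x =
     l * (hcoef (k b) * hermite l (down k b) x - hcoef (Suc (k b)) * hermite l (up k b) x)"
  by (subst partial_eqI[OF hermite_has_derivative]) (rule sum_inner_Basis)

text \<open>The partial derivatives are combinations of Hermite functions again, so the induction on
  the order leaves \<open>k\<close> arbitrary.\<close>

lemma smooth_hermite: "smooth (hermite l k)"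
proof -
  have "C_k m (hermite l k)" for m
  proof (induction m arbitrary: k)
    case 0
    show ?case
      using has_derivative_continuous[OF hermite_has_derivative[of l k]]
      by (auto intro!: continuous_at_imp_continuous_on)
  next
    case (Suc m)
    show ?case
    proof (rule C_k_SucI[OF hermite_has_derivative])
      fix b :: 'a assume b: "b \<in> Basis"
      have "C_k m (\<lambda>x. l * (hcoef (k b) * hermite l (down k b) x + (- hcoef (Suc (k b))) * hermite l (up k b) x))"
        by (intro C_k_mult C_k_add C_k_const Suc.IH)
      then show "C_k m (\<lambda>x. \<Sum>c\<in>Basis. (b \<bullet> c) *
          (l * (hcoef (k c) * hermite l (down k c) x - hcoef (Suc (k c)) * hermite l (up k c) x)))"
        using b by (simp add: sum_inner_Basis)
    qed
  qed
  then show ?thesis by (simp add: smooth_def)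
qed

lemma hermite_bound:
  fixes k :: "'a::euclidean_space \<Rightarrow> nat"
  assumes l: "l > 0"
  shows "\<exists>C. \<forall>x. \<bar>hermite l k x\<bar> \<le> C * exp (- (l\<^sup>2 / 4) * (norm x)\<^sup>2)"
proof -
  have "l\<^sup>2 / 4 < l\<^sup>2 / 2" using l by simp
  from hermite1_bound[OF this]
  obtain C where C: "\<And>m t. \<bar>hermite1 l m t\<bar> \<le> C m * exp (- (l\<^sup>2 / 4) * t\<^sup>2)"
    by metis
  let ?Z = "1 / L2_norm (gaussian 1 (l\<^sup>2 / 2) :: 'a \<Rightarrow> real)"
  have "\<bar>hermite l k x\<bar> \<le> \<bar>?Z\<bar> * (\<Prod>b\<in>Basis. C (k b)) * exp (- (l\<^sup>2 / 4) * (norm x)\<^sup>2)" for x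
  proof -
    have "\<bar>hermite l k x\<bar> = \<bar>?Z\<bar> * (\<Prod>b\<in>Basis. \<bar>hermite1 l (k b) (x \<bullet> b)\<bar>)"
      by (simp add: hermite_def abs_mult abs_prod)
    also have "\<dots> \<le> \<bar>?Z\<bar> * (\<Prod>b\<in>Basis. C (k b) * exp (- (l\<^sup>2 / 4) * (x \<bullet> b)\<^sup>2))"
      by (intro mult_left_mono prod_mono) (use C in auto)
    also have "\<dots> = \<bar>?Z\<bar> * (\<Prod>b\<in>Basis. C (k b)) * exp (- (l\<^sup>2 / 4) * (norm x)\<^sup>2)"
      unfolding norm_square_sum sum_distrib_left by (simp add: prod.distrib exp_sum)
    finally show ?thesis .
  qed
  then show ?thesis by blast
qed

lemma borel_measurable_hermite [measurable]: "hermite l k \<in> borel_measurable borel"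
  by (rule borel_measurable_smooth[OF smooth_hermite])

lemma square_integrable_hermite: "l > 0 \<Longrightarrow> square_integrable (hermite l k)"
  using hermite_bound[of l k] gaussian_bound_square_integrable[OF borel_measurable_hermite, of "l\<^sup>2 / 4" l k]
  by auto

lemma square_integrable_partial_hermite:
  assumes "l > 0" "b \<in> Basis"
  shows "square_integrable (partial (hermite l k) b)"
proof -
  have "partial (hermite l k) b = (\<lambda>x. l * (hcoef (k b) * hermite l (down k b) x - hcoef (Suc (k b)) * hermite l (up k b) x))"
    using assms(2) by (auto simp: partial_hermite fun_eq_iff)
  then show ?thesis
    using assms(1) by (simp only:) (intro square_integrable_scale square_integrable_diff square_integrable_hermite)
qed

lemma square_integrable_mult_hermite:
  assumes "l > 0" "b \<in> Basis"
  shows "square_integrable (\<lambda>x. (x \<bullet> b) * hermite l k x)"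
proof -
  have "(x \<bullet> b) * hermite l k x = (1 / l) * (hcoef (Suc (k b)) * hermite l (up k b) x + hcoef (k b) * hermite l (down k b) x)" for x
    unfolding hermite_mult[OF assms(2), symmetric] using assms(1) by simp
  then show ?thesis
    using assms(1) by (simp only:) (intro square_integrable_scale square_integrable_add square_integrable_hermite)
qed

lemma square_integrable_vector:
  fixes f :: "'b::euclidean_space \<Rightarrow> 'a::euclidean_space \<Rightarrow> real"
  assumes f: "\<And>b. b \<in> Basis \<Longrightarrow> square_integrable (f b)"
  shows "square_integrable (\<lambda>x. \<Sum>b\<in>Basis. f b x *\<^sub>R b)"
proof -
  have "(norm (\<Sum>b\<in>Basis. f b x *\<^sub>R b))\<^sup>2 = (\<Sum>b\<in>Basis. (f b x)\<^sup>2)" for x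
    by (simp add: norm_square_sum inner_sum_left_Basis)
  then show ?thesis
    using f unfolding square_integrable_def by (auto intro!: borel_measurable_sum borel_measurable_scaleR)
qed

abbreviation grad_hermite :: "real \<Rightarrow> ('a::euclidean_space \<Rightarrow> nat) \<Rightarrow> 'a \<Rightarrow> 'a" where
  "grad_hermite l k x \<equiv> (\<Sum>b\<in>Basis. partial (hermite l k) b x *\<^sub>R b)"

lemma square_integrable_grad_hermite: "l > 0 \<Longrightarrow> square_integrable (grad_hermite l k)"
  by (intro square_integrable_vector square_integrable_partial_hermite)

section \<open>Hermite coefficients and orthonormality\<close>

lemma integral_linear_combination:
  fixes f g :: "'a \<Rightarrow> real"
  assumes "integrable M f" "integrable M g"
  shows "(\<integral>x. a * f x + b * g x \<partial>M) = a * (\<integral>x. f x \<partial>M) + b * (\<integral>x. g x \<partial>M)"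
    and "(\<integral>x. a * f x - b * g x \<partial>M) = a * (\<integral>x. f x \<partial>M) - b * (\<integral>x. g x \<partial>M)"
  using assms by simp_all

definition coeff :: "real \<Rightarrow> ('a::euclidean_space \<Rightarrow> real) \<Rightarrow> ('a \<Rightarrow> nat) \<Rightarrow> real" where
  "coeff l u k = (\<integral>x. u x * hermite l k x \<partial>lebesgue)"

lemma coeff_mult:
  assumes l: "l > 0" and b: "b \<in> Basis" and u: "square_integrable u"
    and xu: "square_integrable (\<lambda>x. (x \<bullet> b) * u x)"
  shows "l * coeff l (\<lambda>x. (x \<bullet> b) * u x) k = hcoef (Suc (k b)) * coeff l u (up k b) + hcoef (k b) * coeff l u (down k b)"
proof -
  note I = square_integrable_mult[OF u square_integrable_hermite[OF l]]
  have "l * coeff l (\<lambda>x. (x \<bullet> b) * u x) k = (\<integral>x. u x * (l * (x \<bullet> b) * hermite l k x) \<partial>lebesgue)"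
    unfolding coeff_def integral_mult_right_zero[symmetric] by (simp add: mult_ac)
  also have "\<dots> = (\<integral>x. hcoef (Suc (k b)) * (u x * hermite l (up k b) x) + hcoef (k b) * (u x * hermite l (down k b) x) \<partial>lebesgue)"
    unfolding hermite_mult[OF b] by (simp add: algebra_simps)
  also have "\<dots> = hcoef (Suc (k b)) * coeff l u (up k b) + hcoef (k b) * coeff l u (down k b)"
    unfolding coeff_def by (rule integral_linear_combination[OF I I])
  finally show ?thesis .
qed

text \<open>Integration by parts moves the derivative onto the Hermite function. Compared with
  \<open>coeff_mult\<close> only the sign of the \<open>down\<close> term changes, which is what the
  parallelogram law exploits later.\<close>

lemma coeff_gradient:
  assumes l: "l > 0" and b: "b \<in> Basis" and u: "square_integrable u"
    and g: "has_weak_gradient u g" "square_integrable g"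
  shows "coeff l (\<lambda>x. g x \<bullet> b) k = l * (hcoef (Suc (k b)) * coeff l u (up k b) - hcoef (k b) * coeff l u (down k b))"
proof -
  note I = square_integrable_mult[OF u square_integrable_hermite[OF l]]
  have "coeff l (\<lambda>x. g x \<bullet> b) k = - (\<integral>x. u x * partial (hermite l k) b x \<partial>lebesgue)"
    unfolding coeff_def using weak_gradient_by_parts[OF g(1) u g(2) smooth_hermite
      square_integrable_hermite[OF l] square_integrable_partial_hermite[OF l b] b, of k] by simp
  also have "\<dots> = - (\<integral>x. (l * hcoef (k b)) * (u x * hermite l (down k b) x) - (l * hcoef (Suc (k b))) * (u x * hermite l (up k b) x) \<partial>lebesgue)"
    unfolding partial_hermite[OF b] by (simp add: algebra_simps)
  also have "\<dots> = l * (hcoef (Suc (k b)) * coeff l u (up k b) - hcoef (k b) * coeff l u (down k b))"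
    unfolding coeff_def integral_linear_combination[OF I I] by (simp add: algebra_simps)
  finally show ?thesis .
qed

text \<open>Lowering is adjoint to raising. Multiplication by \<open>x \<bullet> b\<close> is
  symmetric and differentiation antisymmetric; each fact gives one identity among four inner
  products, and their difference is the claim.\<close>

lemma coeff_hermite_ladder:
  assumes l: "l > 0" and b: "b \<in> Basis"
  shows "hcoef (j b) * coeff l (hermite l k) (down j b) = hcoef (Suc (k b)) * coeff l (hermite l (up k b)) j"
proof -
  let ?p = "\<lambda>k j. coeff l (hermite l k) j"
  note I = square_integrable_mult[OF square_integrable_hermite[OF l] square_integrable_hermite[OF l]]
  have "hcoef (Suc (j b)) * ?p k (up j b) + hcoef (j b) * ?p k (down j b) =
      hcoef (Suc (k b)) * ?p (up k b) j + hcoef (k b) * ?p (down k b) j"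
  proof -
    have sym: "?p i i' = ?p i' i" for i i' by (simp add: coeff_def mult.commute)
    have "l * coeff l (\<lambda>x. (x \<bullet> b) * hermite l k x) j = l * coeff l (\<lambda>x. (x \<bullet> b) * hermite l j x) k"
      by (simp add: coeff_def mult_ac)
    then show ?thesis
      unfolding coeff_mult[OF l b square_integrable_hermite[OF l] square_integrable_mult_hermite[OF l b]]
      by (simp add: sym[of j])
  qed
  moreover have "l * (hcoef (Suc (j b)) * ?p k (up j b) - hcoef (j b) * ?p k (down j b)) =
      l * (hcoef (k b) * ?p (down k b) j - hcoef (Suc (k b)) * ?p (up k b) j)"
  proof -
    have "coeff l (\<lambda>x. grad_hermite l k x \<bullet> b) j =
        l * (hcoef (Suc (j b)) * ?p k (up j b) - hcoef (j b) * ?p k (down j b))"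
      by (rule coeff_gradient[OF l b square_integrable_hermite[OF l]
            smooth_has_weak_gradient[OF smooth_hermite] square_integrable_grad_hermite[OF l]])
    moreover have "coeff l (\<lambda>x. grad_hermite l k x \<bullet> b) j =
        (\<integral>x. (l * hcoef (k b)) * (hermite l (down k b) x * hermite l j x) - (l * hcoef (Suc (k b))) * (hermite l (up k b) x * hermite l j x) \<partial>lebesgue)"
    proof -
      have inn: "grad_hermite l k x \<bullet> b = partial (hermite l k) b x" for x
        using b by (simp only: inner_sum_left_Basis)
      show ?thesis
        unfolding coeff_def inn partial_hermite[OF b] by (simp add: algebra_simps)
    qed
    moreover have "\<dots> = l * (hcoef (k b) * ?p (down k b) j - hcoef (Suc (k b)) * ?p (up k b) j)"
      unfolding coeff_def integral_linear_combination[OF I I] by (simp add: algebra_simps)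
    ultimately show ?thesis by simp
  qed
  ultimately show ?thesis using l by simp
qed

lemma hermite_0: "hermite l (\<lambda>_. 0) = (gaussian (1 / L2_norm (gaussian 1 (l\<^sup>2 / 2) :: 'a \<Rightarrow> real)) (l\<^sup>2 / 2) :: 'a::euclidean_space \<Rightarrow> real)"
  by (simp add: hermite_def gaussian_def fun_eq_iff norm_square_sum sum_distrib_left exp_sum[symmetric] sum_negf)

lemma square_integrable_gaussian:
  assumes "\<alpha> > 0" shows "square_integrable (gaussian c \<alpha> :: 'a::euclidean_space \<Rightarrow> real)"
  by (rule gaussian_bound_square_integrable[OF _ assms, of _ "\<bar>c\<bar>"]) (auto simp: gaussian_def[abs_def] abs_mult)

lemma L2_norm_square:
  fixes f :: "'a::euclidean_space \<Rightarrow> real"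
  shows "(L2_norm f)\<^sup>2 = (\<integral>x. (f x)\<^sup>2 \<partial>lebesgue)"
  by (simp add: L2_norm_def)

lemma L2_norm_gaussian_pos:
  assumes "\<alpha> > 0" shows "L2_norm (gaussian 1 \<alpha> :: 'a::euclidean_space \<Rightarrow> real) > 0"
proof -
  let ?g = "gaussian 1 \<alpha> :: 'a \<Rightarrow> real"
  have I: "integrable lebesgue (\<lambda>x. (?g x)\<^sup>2)"
    using square_integrable_gaussian[OF assms, of 1, where 'a='a] by (simp add: square_integrable_real_iff)
  have "(\<integral>x. (?g x)\<^sup>2 \<partial>lebesgue) \<noteq> 0"
  proof
    assume "(\<integral>x. (?g x)\<^sup>2 \<partial>lebesgue) = 0"
    then have "AE x in lebesgue. (?g x)\<^sup>2 = 0"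
      using integral_nonneg_eq_0_iff_AE[OF I] by simp
    then have "AE x in (lebesgue :: 'a measure). False"
      by eventually_elim (simp add: gaussian_def)
    then show False by (simp add: eventually_False ae_filter_eq_bot_iff)
  qed
  moreover have "(\<integral>x. (?g x)\<^sup>2 \<partial>lebesgue) \<ge> 0" by simp
  ultimately have "(\<integral>x. (?g x)\<^sup>2 \<partial>lebesgue) > 0" by linarith
  then show ?thesis by (simp add: L2_norm_def)
qed

text \<open>Induction on |k|: the ladder identity lowers both indices in one coordinate, with equal
  factors when \<open>k = j\<close>. If the coordinate is 0 in just one of the indices, lowering
  annihilates the inner product. The remaining case is the normalised ground state.\<close>

lemma hermite_orthonormal:
  fixes k j :: "'a::euclidean_space \<Rightarrow> nat"
  assumes l: "l > 0" and k: "k \<in> multi_index" and j: "j \<in> multi_index"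
  shows "coeff l (hermite l k) j = (if k = j then 1 else 0)"
  using k j
proof (induction "\<Sum>b\<in>Basis. k b" arbitrary: k j rule: less_induct)
  case less
  have sym: "coeff l (hermite l k) j = coeff l (hermite l j) k" for k j :: "'a \<Rightarrow> nat"
    by (simp add: coeff_def mult.commute)
  have vanish: "coeff l (hermite l k) j = 0" if "b \<in> Basis" "k b \<noteq> 0" "j b = 0" for b and k j :: "'a \<Rightarrow> nat"
  proof -
    have "up (down k b) b = k" using that by auto
    then have "hcoef (k b) * coeff l (hermite l k) j = 0"
      using coeff_hermite_ladder[OF l that(1), of j "down k b"] that by (simp add: hcoef_0)
    moreover have "hcoef (k b) > 0" using hcoef_Suc_pos[of "k b - 1"] that by simp
    ultimately show ?thesis by simp
  qed
  show ?case
  proof (cases "\<exists>b\<in>Basis. k b \<noteq> 0")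
    case True
    then obtain b where b: "b \<in> Basis" "k b \<noteq> 0" by blast
    show ?thesis
    proof (cases "j b = 0")
      case True
      then show ?thesis using vanish[of b k j] True b by auto
    next
      case False
      have "(\<Sum>c\<in>Basis. down k b c) < (\<Sum>c\<in>Basis. k c)"
        using b by (intro sum_strict_mono_ex1) auto
      moreover have "down k b \<in> multi_index" "down j b \<in> multi_index"
        using less.prems b by (auto simp: multi_index_def)
      ultimately have "coeff l (hermite l (down k b)) (down j b) = (if down k b = down j b then 1 else 0)"
        using less.hyps by blast
      \<comment> \<open>Since \<open>down\<close> truncates at 0, it can be undone here only because
        \<open>k b\<close> and \<open>j b\<close> are both nonzero.\<close>
      moreover have "down k b = down j b \<longleftrightarrow> k = j"
      proof
        assume eq: "down k b = down j b"
        have kj: "k b = j b" using fun_cong[OF eq, of b] b False by simp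
        have "k = (down k b)(b := k b)" by simp
        also have "\<dots> = (down j b)(b := k b)" by (rule arg_cong[OF eq])
        also have "\<dots> = j" by (simp add: kj)
        finally show "k = j" .
      qed simp
      moreover have "hcoef (j b) * coeff l (hermite l (down k b)) (down j b) = hcoef (k b) * coeff l (hermite l k) j"
      proof -
        have "up (down k b) b = k" "Suc (down k b b) = k b" using b by auto
        then show ?thesis using coeff_hermite_ladder[OF l b(1), of j "down k b"] by simp
      qed
      moreover have "hcoef (k b) > 0" using hcoef_Suc_pos[of "k b - 1"] b by simp
      ultimately show ?thesis by auto
    qed
  next
    case False
    then have k0: "k = (\<lambda>_. 0)" using less.prems by (auto simp: multi_index_def)
    show ?thesis
    proof (cases "\<exists>b\<in>Basis. j b \<noteq> 0")
      case True
      then obtain b where b: "b \<in> Basis" "j b \<noteq> 0" by blast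
      then have "coeff l (hermite l j) k = 0" by (intro vanish) (auto simp: k0)
      then show ?thesis using b k0 sym[of k j] by auto
    next
      case False
      then have j0: "j = (\<lambda>_. 0)" using less.prems by (auto simp: multi_index_def)
      let ?g = "gaussian 1 (l\<^sup>2 / 2) :: 'a \<Rightarrow> real"
      have "coeff l (hermite l k) j = (\<integral>x. (1 / L2_norm ?g)\<^sup>2 * (?g x)\<^sup>2 \<partial>lebesgue)"
        unfolding coeff_def k0 j0 hermite_0 by (simp add: gaussian_def power2_eq_square mult_ac)
      also have "\<dots> = (1 / L2_norm ?g)\<^sup>2 * (L2_norm ?g)\<^sup>2"
        by (simp add: L2_norm_square)
      also have "\<dots> = 1"
        using L2_norm_gaussian_pos[of "l\<^sup>2 / 2", where 'a='a] l by (simp add: power_divide)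
      finally show ?thesis using k0 j0 by simp
    qed
  qed
qed

section \<open>Density of the Hermite functions\<close>

text \<open>The linear span, given by its closure rules so that stability under multiplication
  operators follows by rule induction; \<open>hspan_representation\<close> recovers finite
  sums.\<close>

inductive hspan :: "real \<Rightarrow> ('a::euclidean_space \<Rightarrow> real) \<Rightarrow> bool" for l where
  hermite: "k \<in> multi_index \<Longrightarrow> hspan l (hermite l k)"
| add: "hspan l \<psi> \<Longrightarrow> hspan l \<xi> \<Longrightarrow> hspan l (\<lambda>x. \<psi> x + \<xi> x)"
| scale: "hspan l \<psi> \<Longrightarrow> hspan l (\<lambda>x. c * \<psi> x)"

lemma hspan_sum:
  assumes "\<And>i. i \<in> A \<Longrightarrow> hspan l (f i)"
  shows "hspan l (\<lambda>x. \<Sum>i\<in>A. f i x)"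
proof -
  have "hspan l (\<lambda>x. 0 * hermite l (\<lambda>_. 0) x)"
    by (intro hspan.scale hspan.hermite) (simp add: multi_index_def)
  then have zero: "hspan l (\<lambda>x. 0)" by simp
  show ?thesis using assms
    by (induction A rule: infinite_finite_induct) (auto intro: zero hspan.add)
qed

lemma hspan_representation:
  "hspan l \<psi> \<Longrightarrow> \<exists>F a. finite F \<and> F \<subseteq> multi_index \<and> \<psi> = (\<lambda>x. \<Sum>k\<in>F. a k * hermite l k x)"
proof (induction rule: hspan.induct)
  case (hermite k)
  then show ?case by (intro exI[of _ "{k}"] exI[of _ "\<lambda>_. 1"]) auto
next
  case (add \<psi> \<xi>)
  then obtain F G a b where F: "finite F" "F \<subseteq> multi_index" "\<psi> = (\<lambda>x. \<Sum>k\<in>F. a k * hermite l k x)"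
    and G: "finite G" "G \<subseteq> multi_index" "\<xi> = (\<lambda>x. \<Sum>k\<in>G. b k * hermite l k x)"
    by blast
  have "(\<Sum>k\<in>F. a k * hermite l k x) = (\<Sum>k\<in>F \<union> G. (if k \<in> F then a k else 0) * hermite l k x)" for x
    using F G by (intro sum.mono_neutral_cong_left) auto
  moreover have "(\<Sum>k\<in>G. b k * hermite l k x) = (\<Sum>k\<in>F \<union> G. (if k \<in> G then b k else 0) * hermite l k x)" for x
    using F G by (intro sum.mono_neutral_cong_left) auto
  ultimately have "(\<lambda>x. \<psi> x + \<xi> x) = (\<lambda>x. \<Sum>k\<in>F \<union> G. ((if k \<in> F then a k else 0) + (if k \<in> G then b k else 0)) * hermite l k x)"
    unfolding F(3) G(3) by (simp only: sum.distrib[symmetric] distrib_right[symmetric])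
  with F G show ?case by (meson Un_least finite_UnI)
next
  case (scale \<psi> c)
  then obtain F a where F: "finite F" "F \<subseteq> multi_index" "\<psi> = (\<lambda>x. \<Sum>k\<in>F. a k * hermite l k x)"
    by blast
  then have "(\<lambda>x. c * \<psi> x) = (\<lambda>x. \<Sum>k\<in>F. (c * a k) * hermite l k x)"
    by (simp add: sum_distrib_left mult.assoc)
  with F show ?case by (meson F)
qed

lemma hspan_mult_coordinate:
  assumes l: "l > 0" and b: "b \<in> Basis"
  shows "hspan l \<psi> \<Longrightarrow> hspan l (\<lambda>x. (x \<bullet> b) * \<psi> x)"
proof (induction rule: hspan.induct)
  case (hermite k)
  have "(x \<bullet> b) * hermite l k x = (1 / l) * (hcoef (Suc (k b)) * hermite l (up k b) x + hcoef (k b) * hermite l (down k b) x)" for x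
    unfolding hermite_mult[OF b, symmetric] using l by simp
  moreover have "up k b \<in> multi_index" "down k b \<in> multi_index"
    using hermite b by (auto simp: multi_index_def)
  ultimately show ?case
    by (simp only:) (intro hspan.intros)
next
  case (add \<psi> \<xi>)
  then show ?case using hspan.add[OF add.IH] by (simp add: distrib_left)
next
  case (scale \<psi> c)
  then show ?case using hspan.scale[OF scale.IH, of c] by (simp add: mult_ac)
qed

text \<open>Coordinates act by shifting indices, so the span is stable under them and hence under
  all polynomials. Applied to the ground state, this puts every polynomial times the Gaussian of
  exponent l^2/2 into the span.\<close>

lemma hspan_mult_polynomial:
  assumes l: "l > 0" and "real_polynomial_function p" "hspan l \<psi>"
  shows "hspan l (\<lambda>x. p x * \<psi> x)"
  using assms(2,3)
proof (induction arbitrary: \<psi>)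
  case (linear f)
  note lin = bounded_linear.linear[OF linear(1)]
  have "f x * \<psi> x = (\<Sum>b\<in>Basis. f b * ((x \<bullet> b) * \<psi> x))" for x
  proof -
    have "f x = f (\<Sum>b\<in>Basis. (x \<bullet> b) *\<^sub>R b)"
      by (simp only: euclidean_representation)
    also have "\<dots> = (\<Sum>b\<in>Basis. (x \<bullet> b) * f b)"
      by (simp add: linear_sum[OF lin] linear_scale[OF lin])
    finally have "f x * \<psi> x = (\<Sum>b\<in>Basis. (x \<bullet> b) * f b) * \<psi> x" by (rule arg_cong)
    also have "\<dots> = (\<Sum>b\<in>Basis. (x \<bullet> b) * f b * \<psi> x)" by (rule sum_distrib_right)
    also have "\<dots> = (\<Sum>b\<in>Basis. f b * ((x \<bullet> b) * \<psi> x))" by (simp only: mult_ac)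
    finally show ?thesis .
  qed
  then show ?case
    using linear(2) by (simp only:) (intro hspan_sum hspan.scale hspan_mult_coordinate l)
next
  case (const c)
  then show ?case by (rule hspan.scale)
next
  case (add f g)
  then show ?case using hspan.add[OF add.IH(1)[OF add.prems] add.IH(2)[OF add.prems]]
    by (simp add: distrib_right)
next
  case (mult f g)
  then show ?case using mult.IH(1)[OF mult.IH(2)[OF mult.prems]] by (simp add: mult.assoc)
qed

section \<open>The closure of the Hermite span in L2\<close>

lemma square_integrable_hspan:
  assumes "l > 0" shows "hspan l \<psi> \<Longrightarrow> square_integrable \<psi>"
  by (induction rule: hspan.induct)
    (auto intro: square_integrable_hermite assms square_integrable_add square_integrable_scale)

text \<open>Membership in the L2 closure of the span, expressed by squared distances.\<close>

definition approximable :: "real \<Rightarrow> ('a::euclidean_space \<Rightarrow> real) \<Rightarrow> bool" where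
  "approximable l f \<longleftrightarrow> square_integrable f \<and>
     (\<forall>\<epsilon>>0. \<exists>\<psi>. hspan l \<psi> \<and> (\<integral>x. (f x - \<psi> x)\<^sup>2 \<partial>lebesgue) < \<epsilon>)"

lemma integral_add_square_le:
  fixes f g :: "'a::euclidean_space \<Rightarrow> real"
  assumes f: "square_integrable f" and g: "square_integrable g"
  shows "(\<integral>x. (f x + g x)\<^sup>2 \<partial>lebesgue) \<le> 2 * (\<integral>x. (f x)\<^sup>2 \<partial>lebesgue) + 2 * (\<integral>x. (g x)\<^sup>2 \<partial>lebesgue)"
proof -
  have I: "integrable lebesgue (\<lambda>x. (f x)\<^sup>2)" "integrable lebesgue (\<lambda>x. (g x)\<^sup>2)"
    "integrable lebesgue (\<lambda>x. (f x + g x)\<^sup>2)"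
    using f g square_integrable_add[OF f g] by (auto simp: square_integrable_real_iff)
  have "(\<integral>x. (f x + g x)\<^sup>2 \<partial>lebesgue) \<le> (\<integral>x. 2 * (f x)\<^sup>2 + 2 * (g x)\<^sup>2 \<partial>lebesgue)"
  proof (rule integral_mono)
    show "(f x + g x)\<^sup>2 \<le> 2 * (f x)\<^sup>2 + 2 * (g x)\<^sup>2" for x
      using sum_squares_bound[of "f x" "g x"] by (simp add: power2_sum)
  qed (use I in auto)
  also have "\<dots> = 2 * (\<integral>x. (f x)\<^sup>2 \<partial>lebesgue) + 2 * (\<integral>x. (g x)\<^sup>2 \<partial>lebesgue)"
    by (rule integral_linear_combination[OF I(1,2)])
  finally show ?thesis .
qed

lemma approximable_hspan: "l > 0 \<Longrightarrow> hspan l \<psi> \<Longrightarrow> approximable l \<psi>"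
  unfolding approximable_def using square_integrable_hspan by (auto intro!: exI[of _ \<psi>])

lemma approximable_add:
  assumes l: "l > 0" and f: "approximable l f" and g: "approximable l g"
  shows "approximable l (\<lambda>x. f x + g x)"
  unfolding approximable_def
proof (intro conjI allI impI)
  show "square_integrable (\<lambda>x. f x + g x)"
    using f g by (auto simp: approximable_def intro: square_integrable_add)
  fix \<epsilon> :: real assume "\<epsilon> > 0"
  then have "\<epsilon> / 4 > 0" by simp
  then obtain \<psi> \<xi> where h: "hspan l \<psi>" "hspan l \<xi>"
    and lt: "(\<integral>x. (f x - \<psi> x)\<^sup>2 \<partial>lebesgue) < \<epsilon> / 4" "(\<integral>x. (g x - \<xi> x)\<^sup>2 \<partial>lebesgue) < \<epsilon> / 4"
    using f g unfolding approximable_def by blast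
  have "square_integrable f" "square_integrable g"
    using f g by (auto simp: approximable_def)
  then have "square_integrable (\<lambda>x. f x - \<psi> x)" "square_integrable (\<lambda>x. g x - \<xi> x)"
    using h by (simp_all add: square_integrable_diff square_integrable_hspan[OF l])
  from integral_add_square_le[OF this] lt
  have "(\<integral>x. (f x + g x - (\<psi> x + \<xi> x))\<^sup>2 \<partial>lebesgue) < \<epsilon>"
    by (simp add: algebra_simps)
  with h show "\<exists>\<psi>. hspan l \<psi> \<and> (\<integral>x. (f x + g x - \<psi> x)\<^sup>2 \<partial>lebesgue) < \<epsilon>"
    by (intro exI[of _ "\<lambda>x. \<psi> x + \<xi> x"] conjI hspan.add)
qed

lemma approximable_scale:
  assumes f: "approximable l f"
  shows "approximable l (\<lambda>x. c * f x)"
  unfolding approximable_def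
proof (intro conjI allI impI)
  show "square_integrable (\<lambda>x. c * f x)"
    using f by (auto simp: approximable_def intro: square_integrable_scale)
  fix \<epsilon> :: real assume \<epsilon>: "\<epsilon> > 0"
  have c: "c\<^sup>2 + 1 > 0" by (simp add: add_nonneg_pos)
  then have "\<epsilon> / (c\<^sup>2 + 1) > 0" using \<epsilon> by simp
  then obtain \<psi> where h: "hspan l \<psi>" and lt: "(\<integral>x. (f x - \<psi> x)\<^sup>2 \<partial>lebesgue) < \<epsilon> / (c\<^sup>2 + 1)"
    using f unfolding approximable_def by blast
  have "(\<integral>x. (c * f x - c * \<psi> x)\<^sup>2 \<partial>lebesgue) = c\<^sup>2 * (\<integral>x. (f x - \<psi> x)\<^sup>2 \<partial>lebesgue)"
    by (simp add: right_diff_distrib[symmetric] power_mult_distrib)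
  also have "\<dots> \<le> (c\<^sup>2 + 1) * (\<integral>x. (f x - \<psi> x)\<^sup>2 \<partial>lebesgue)"
    by (intro mult_right_mono) auto
  also have "\<dots> < \<epsilon>"
    using lt c by (simp add: pos_less_divide_eq mult.commute)
  finally show "\<exists>\<psi>. hspan l \<psi> \<and> (\<integral>x. (c * f x - \<psi> x)\<^sup>2 \<partial>lebesgue) < \<epsilon>"
    using h by (intro exI[of _ "\<lambda>x. c * \<psi> x"] conjI hspan.scale)
qed

text \<open>Dominated convergence with a square-integrable majorant \<open>w\<close> gives L2
  convergence, the squared difference being at most \<open>4 * (w x)\<^sup>2\<close>; a closure
  contains its limits.\<close>

lemma approximable_limit:
  fixes f :: "'a::euclidean_space \<Rightarrow> real"
  assumes l: "l > 0" and F: "\<And>n::nat. approximable l (F n)" and w: "square_integrable w"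
    and bound: "\<And>n. AE x in lebesgue. \<bar>F n x\<bar> \<le> w x"
    and lim: "AE x in lebesgue. (\<lambda>n. F n x) \<longlonglongrightarrow> f x"
    and f: "f \<in> borel_measurable lebesgue"
  shows "approximable l f"
proof -
  have bound': "AE x in lebesgue. \<forall>n. \<bar>F n x\<bar> \<le> w x"
    using bound by (simp add: AE_all_countable)
  have fw: "AE x in lebesgue. \<bar>f x\<bar> \<le> w x"
    using bound' lim
  proof eventually_elim
    case (elim x)
    show ?case by (rule LIMSEQ_le_const2[OF tendsto_rabs[OF elim(2)]]) (use elim in auto)
  qed
  have f2: "square_integrable f"
    by (rule square_integrable_bound[OF f w]) (use fw in \<open>eventually_elim, linarith\<close>)
  have F2: "square_integrable (F n)" for n
    using F by (simp add: approximable_def)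
  have Fm: "F n \<in> borel_measurable lebesgue" for n
    using F2 by (simp add: square_integrable_real_iff)
  have "(\<lambda>n. \<integral>x. (f x - F n x)\<^sup>2 \<partial>lebesgue) \<longlonglongrightarrow> (\<integral>x. 0 \<partial>(lebesgue :: 'a measure))"
  proof (rule integral_dominated_convergence)
    show "integrable lebesgue (\<lambda>x. 4 * (w x)\<^sup>2)"
      using w by (simp add: square_integrable_real_iff)
    show "AE x in lebesgue. (\<lambda>n. (f x - F n x)\<^sup>2) \<longlonglongrightarrow> 0"
      using lim
    proof eventually_elim
      case (elim x)
      have "(\<lambda>n. (f x - F n x)\<^sup>2) \<longlonglongrightarrow> (f x - f x)\<^sup>2"
        by (intro tendsto_intros elim)
      then show ?case by simp
    qed
    show "AE x in lebesgue. norm ((f x - F n x)\<^sup>2) \<le> 4 * (w x)\<^sup>2" for n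
      using fw bound[of n]
    proof eventually_elim
      case (elim x)
      then have "\<bar>f x - F n x\<bar> \<le> 2 * w x" by linarith
      then have "\<bar>f x - F n x\<bar>\<^sup>2 \<le> (2 * w x)\<^sup>2" by (intro power_mono) auto
      then show ?case by (simp add: power_mult_distrib)
    qed
  qed (use f Fm in auto)
  then have conv: "(\<lambda>n. \<integral>x. (f x - F n x)\<^sup>2 \<partial>lebesgue) \<longlonglongrightarrow> 0" by simp
  show ?thesis
    unfolding approximable_def
  proof (intro conjI allI impI f2)
    fix \<epsilon> :: real assume "\<epsilon> > 0"
    then have \<epsilon>: "\<epsilon> / 4 > 0" by simp
    obtain n where n: "(\<integral>x. (f x - F n x)\<^sup>2 \<partial>lebesgue) < \<epsilon> / 4"
      using order_tendstoD(2)[OF conv \<epsilon>] by (auto simp: eventually_sequentially)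
    obtain \<psi> where h: "hspan l \<psi>" and lt: "(\<integral>x. (F n x - \<psi> x)\<^sup>2 \<partial>lebesgue) < \<epsilon> / 4"
      using F[of n] \<epsilon> unfolding approximable_def by blast
    have "square_integrable (\<lambda>x. f x - F n x)" "square_integrable (\<lambda>x. F n x - \<psi> x)"
      by (intro square_integrable_diff square_integrable_hspan[OF l] h f2 F2)+
    from integral_add_square_le[OF this] n lt
    have "(\<integral>x. (f x - \<psi> x)\<^sup>2 \<partial>lebesgue) < \<epsilon>" by simp
    with h show "\<exists>\<psi>. hspan l \<psi> \<and> (\<integral>x. (f x - \<psi> x)\<^sup>2 \<partial>lebesgue) < \<epsilon>" by blast
  qed
qed

lemma polynomial_exp_bound:
  fixes p :: "'a::euclidean_space \<Rightarrow> real"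
  assumes "real_polynomial_function p" "\<epsilon> > 0"
  shows "\<exists>C. \<forall>x. \<bar>p x\<bar> \<le> C * exp (\<epsilon> * (norm x)\<^sup>2)"
  using assms
proof (induction arbitrary: \<epsilon>)
  case (linear f)
  obtain K where K: "K > 0" "\<And>x. \<bar>f x\<bar> \<le> norm x * K"
    using bounded_linear.pos_bounded[OF linear(1)] by auto
  obtain C where C: "\<And>t. \<bar>t\<bar> * exp (- 0 * t\<^sup>2) \<le> C * exp (- (- \<epsilon>) * t\<^sup>2)"
    using abs_mult_exp_le[of "- \<epsilon>" 0] linear(2) by auto
  have "\<bar>f x\<bar> \<le> (K * C) * exp (\<epsilon> * (norm x)\<^sup>2)" for x
  proof -
    have "\<bar>f x\<bar> \<le> K * norm x" using K(2)[of x] by (simp add: mult.commute)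
    also have "\<dots> \<le> K * (C * exp (\<epsilon> * (norm x)\<^sup>2))"
      using C[of "norm x"] K(1) by (intro mult_left_mono) auto
    finally show ?thesis by (simp add: mult.assoc)
  qed
  then show ?case by blast
next
  case (const c)
  have "\<bar>c\<bar> \<le> \<bar>c\<bar> * exp (\<epsilon> * (norm x)\<^sup>2)" for x :: 'a
    using mult_left_mono[of 1 "exp (\<epsilon> * (norm x)\<^sup>2)" "\<bar>c\<bar>"] const by simp
  then show ?case by blast
next
  case (add f g)
  obtain C D where C: "\<And>x. \<bar>f x\<bar> \<le> C * exp (\<epsilon> * (norm x)\<^sup>2)" and D: "\<And>x. \<bar>g x\<bar> \<le> D * exp (\<epsilon> * (norm x)\<^sup>2)"
    using add by metis
  have "\<bar>f x + g x\<bar> \<le> (C + D) * exp (\<epsilon> * (norm x)\<^sup>2)" for x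
    using abs_triangle_ineq[of "f x" "g x"] C[of x] D[of x] unfolding distrib_right by linarith
  then show ?case by blast
next
  case (mult f g)
  then have "\<epsilon> / 2 > 0" by simp
  then obtain C D where C: "\<And>x. \<bar>f x\<bar> \<le> C * exp (\<epsilon> / 2 * (norm x)\<^sup>2)" and D: "\<And>x. \<bar>g x\<bar> \<le> D * exp (\<epsilon> / 2 * (norm x)\<^sup>2)"
    using mult.IH by metis
  have "\<bar>f x * g x\<bar> \<le> (C * D) * exp (\<epsilon> * (norm x)\<^sup>2)" for x
  proof -
    have "\<bar>f x * g x\<bar> \<le> (C * exp (\<epsilon> / 2 * (norm x)\<^sup>2)) * (D * exp (\<epsilon> / 2 * (norm x)\<^sup>2))"
      unfolding abs_mult by (intro mult_mono C D order_trans[OF abs_ge_zero C]) auto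
    also have "\<dots> = (C * D) * (exp (\<epsilon> / 2 * (norm x)\<^sup>2) * exp (\<epsilon> / 2 * (norm x)\<^sup>2))"
      by (simp only: mult_ac)
    also have "exp (\<epsilon> / 2 * (norm x)\<^sup>2) * exp (\<epsilon> / 2 * (norm x)\<^sup>2) = exp (\<epsilon> * (norm x)\<^sup>2)"
      by (simp add: mult_exp_exp)
    finally show ?thesis .
  qed
  then show ?case by blast
qed

lemma exp_partial_sum_bound: "\<bar>\<Sum>i<n. q ^ i / fact i\<bar> \<le> exp \<bar>q :: real\<bar>"
proof -
  have "\<bar>\<Sum>i<n. q ^ i / fact i\<bar> \<le> (\<Sum>i<n. \<bar>q\<bar> ^ i /\<^sub>R fact i)"
    by (rule order_trans[OF sum_abs]) (simp add: power_abs abs_mult divide_inverse mult.commute)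
  also have "\<dots> \<le> exp \<bar>q\<bar>"
    unfolding exp_def by (intro sum_le_suminf summable_exp_generic) auto
  finally show ?thesis .
qed

lemma exp_partial_sum_tendsto: "(\<lambda>n. \<Sum>i<n. q ^ i / fact i) \<longlonglongrightarrow> exp (q :: real)"
  using exp_converges[of q] by (simp add: sums_def divide_inverse mult.commute)

lemma real_polynomial_norm_square: "real_polynomial_function (\<lambda>x::'a::euclidean_space. (norm x)\<^sup>2)"
  unfolding norm_square_sum
  by (intro real_polynomial_function_sum real_polynomial_function_power real_polynomial_function.intros(1)
      bounded_linear_inner_left) auto

text \<open>The factor \<open>exp (-t |x|\<^sup>2 + x \<bullet> v)\<close> is expanded into a power series, which converges dominatedly
  only for \<open>|t| < s\<close>; iterating the step then reaches every positive exponent.\<close>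

lemma approximable_exp_step:
  fixes p :: "'a::euclidean_space \<Rightarrow> real" and v :: 'a
  assumes l: "l > 0" and s: "s > 0" and t: "\<bar>t\<bar> < s" and p: "real_polynomial_function p"
    and ap: "\<And>p :: 'a \<Rightarrow> real. real_polynomial_function p \<Longrightarrow> approximable l (\<lambda>x. p x * exp (- s * (norm x)\<^sup>2))"
  shows "approximable l (\<lambda>x. p x * exp (- (s + t) * (norm x)\<^sup>2 + x \<bullet> v))"
proof -
  define q where "q x = - t * (norm x)\<^sup>2 + x \<bullet> v" for x
  have q: "real_polynomial_function q"
    unfolding q_def
    by (intro real_polynomial_function.intros(3) real_polynomial_function.intros(4) real_polynomial_function.intros(2)
        real_polynomial_norm_square real_polynomial_function.intros(1) bounded_linear_inner_left)
  define F where "F n x = (p x * (\<Sum>i<n. q x ^ i / fact i)) * exp (- s * (norm x)\<^sup>2)" for n x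
  \<comment> \<open>The slack \<open>s - |t|\<close> is cut into four: one part absorbs the growth
    of \<open>p\<close>, one the linear term \<open>x \<bullet> v\<close>, and two remain as
    Gaussian decay.\<close>
  define \<delta> where "\<delta> = (s - \<bar>t\<bar>) / 4"
  have \<delta>: "\<delta> > 0" using t by (simp add: \<delta>_def)
  obtain C where C: "\<And>x. \<bar>p x\<bar> \<le> C * exp (\<delta> * (norm x)\<^sup>2)"
    using polynomial_exp_bound[OF p \<delta>] by blast
  \<comment> \<open>The constant left over on completing the square in |x| |v| against
    \<open>\<delta> * (norm x)\<^sup>2\<close>.\<close>
  define M where "M = (norm v)\<^sup>2 / (4 * \<delta>)"
  have q_le: "\<bar>q x\<bar> \<le> (\<bar>t\<bar> + \<delta>) * (norm x)\<^sup>2 + M" for x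
  proof -
    have "\<bar>q x\<bar> \<le> \<bar>t\<bar> * (norm x)\<^sup>2 + norm x * norm v"
      unfolding q_def using Cauchy_Schwarz_ineq2[of x v] abs_triangle_ineq[of "- t * (norm x)\<^sup>2" "x \<bullet> v"]
      by (simp add: abs_mult)
    also have "norm x * norm v \<le> \<delta> * (norm x)\<^sup>2 + M"
    proof -
      have "0 \<le> (2 * \<delta> * norm x - norm v)\<^sup>2" by simp
      then have "4 * \<delta> * (norm x * norm v) \<le> 4 * \<delta> * (\<delta> * (norm x)\<^sup>2 + M)"
        using \<delta> by (simp add: M_def power2_eq_square algebra_simps)
      then show ?thesis using \<delta> by simp
    qed
    finally show ?thesis by (simp add: algebra_simps)
  qed
  have bound: "\<bar>F n x\<bar> \<le> (C * exp M) * exp (- (2 * \<delta>) * (norm x)\<^sup>2)" for n x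
  proof -
    have "\<bar>\<Sum>i<n. q x ^ i / fact i\<bar> \<le> exp ((\<bar>t\<bar> + \<delta>) * (norm x)\<^sup>2 + M)"
      using exp_partial_sum_bound[of "q x" n] q_le[of x] by (meson exp_le_cancel_iff order_trans)
    then have "\<bar>F n x\<bar> \<le> (C * exp (\<delta> * (norm x)\<^sup>2)) * exp ((\<bar>t\<bar> + \<delta>) * (norm x)\<^sup>2 + M) * exp (- s * (norm x)\<^sup>2)"
      unfolding F_def abs_mult abs_exp_cancel
      by (intro mult_right_mono mult_mono C order_trans[OF abs_ge_zero C]) auto
    also have "\<dots> = C * exp (\<delta> * (norm x)\<^sup>2 + ((\<bar>t\<bar> + \<delta>) * (norm x)\<^sup>2 + M) + - s * (norm x)\<^sup>2)"
      by (simp only: exp_add mult.assoc)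
    also have "\<delta> * (norm x)\<^sup>2 + ((\<bar>t\<bar> + \<delta>) * (norm x)\<^sup>2 + M) + - s * (norm x)\<^sup>2 = M + - (2 * \<delta>) * (norm x)\<^sup>2"
    proof -
      have "s = \<bar>t\<bar> + 4 * \<delta>" by (simp add: \<delta>_def field_simps)
      then show ?thesis by (simp add: algebra_simps)
    qed
    finally show ?thesis by (simp only: exp_add mult.assoc)
  qed
  show ?thesis
  proof (rule approximable_limit[OF l])
    show "approximable l (F n)" for n
      unfolding F_def
      by (intro ap real_polynomial_function.intros(4) p real_polynomial_function_sum
          real_polynomial_function_divide real_polynomial_function_power q) auto
    show "square_integrable (\<lambda>x::'a. (C * exp M) * exp (- (2 * \<delta>) * (norm x)\<^sup>2))"
      using gaussian_bound_square_integrable[of "\<lambda>x::'a. exp (- (2 * \<delta>) * (norm x)\<^sup>2)" "2 * \<delta>" 1] \<delta>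
      by (intro square_integrable_scale) auto
    show "AE x in lebesgue. \<bar>F n x\<bar> \<le> (C * exp M) * exp (- (2 * \<delta>) * (norm x)\<^sup>2)" for n
      by (intro AE_I2 bound)
    show "AE x in lebesgue. (\<lambda>n. F n x) \<longlonglongrightarrow> p x * exp (- (s + t) * (norm x)\<^sup>2 + x \<bullet> v)"
    proof (rule AE_I2)
      fix x
      have "(\<lambda>n. F n x) \<longlonglongrightarrow> (p x * exp (q x)) * exp (- s * (norm x)\<^sup>2)"
        unfolding F_def by (intro tendsto_intros exp_partial_sum_tendsto)
      moreover have "(p x * exp (q x)) * exp (- s * (norm x)\<^sup>2) = p x * exp (q x + - s * (norm x)\<^sup>2)"
        by (simp only: exp_add mult.assoc)
      moreover have "q x + - s * (norm x)\<^sup>2 = - (s + t) * (norm x)\<^sup>2 + x \<bullet> v"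
        by (simp add: q_def algebra_simps)
      ultimately show "(\<lambda>n. F n x) \<longlonglongrightarrow> p x * exp (- (s + t) * (norm x)\<^sup>2 + x \<bullet> v)" by (simp only:)
    qed
    have "continuous_on UNIV p"
      using p by (simp add: continuous_on_polymonial_function real_polynomial_function_eq)
    then have "(\<lambda>x. p x * exp (- (s + t) * (norm x)\<^sup>2 + x \<bullet> v)) \<in> borel_measurable borel"
      by (intro borel_measurable_continuous_onI continuous_intros)
    then show "(\<lambda>x. p x * exp (- (s + t) * (norm x)\<^sup>2 + x \<bullet> v)) \<in> borel_measurable lebesgue"
      by (intro measurable_completion) simp
  qed
qed

text \<open>The span itself supplies only the exponent l^2/2; \<open>approximable_exp_step\<close>
  gives from an exponent \<open>s\<close> all those strictly between 0 and 2 s.\<close>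

lemma approximable_polynomial_gaussian:
  fixes p :: "'a::euclidean_space \<Rightarrow> real"
  assumes l: "l > 0" and s: "s > 0" and p: "real_polynomial_function p"
  shows "approximable l (\<lambda>x. p x * exp (- s * (norm x)\<^sup>2))"
proof -
  define P where "P s \<longleftrightarrow> (\<forall>p :: 'a \<Rightarrow> real. real_polynomial_function p \<longrightarrow> approximable l (\<lambda>x. p x * exp (- s * (norm x)\<^sup>2)))" for s
  define c where "c = l\<^sup>2 / 2"
  have c: "c > 0" using l by (simp add: c_def)
  have base: "P c"
    unfolding P_def
  proof (intro allI impI)
    fix p :: "'a \<Rightarrow> real" assume p: "real_polynomial_function p"
    let ?Z = "L2_norm (gaussian 1 (l\<^sup>2 / 2) :: 'a \<Rightarrow> real)"
    have Z: "?Z > 0" using c by (intro L2_norm_gaussian_pos) (simp add: c_def)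
    have "hspan l (\<lambda>x. p x * (?Z * hermite l (\<lambda>_. 0) x))"
      by (intro hspan_mult_polynomial l p hspan.scale hspan.hermite) (simp add: multi_index_def)
    moreover have "?Z * hermite l (\<lambda>_. 0) x = exp (- c * (norm x)\<^sup>2)" for x :: 'a
      using Z by (simp add: hermite_0 gaussian_def c_def)
    ultimately show "approximable l (\<lambda>x. p x * exp (- c * (norm x)\<^sup>2))"
      using approximable_hspan[OF l] by simp
  qed
  have step: "P s'" if "P s" "0 < s'" "s' < 2 * s" for s s'
    unfolding P_def
  proof (intro allI impI)
    fix p :: "'a \<Rightarrow> real" assume p: "real_polynomial_function p"
    have "approximable l (\<lambda>x. p x * exp (- (s + (s' - s)) * (norm x)\<^sup>2 + x \<bullet> 0))"
      using that by (intro approximable_exp_step l p) (auto simp: P_def)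
    then show "approximable l (\<lambda>x. p x * exp (- s' * (norm x)\<^sup>2))" by simp
  qed
  \<comment> \<open>Any ratio strictly between 1 and 2 would do. The exponents grow until they
    overshoot \<open>s\<close>, and a single step then comes down to \<open>s\<close>.\<close>
  have pow: "P (c * (3 / 2) ^ n)" for n
  proof (induction n)
    case (Suc n)
    then show ?case by (rule step) (use c in auto)
  qed (simp add: base)
  obtain n where "s / c < (3 / 2) ^ n"
    using real_arch_pow[of "3 / 2" "s / c"] by auto
  then have "s < c * (3 / 2) ^ n" using c by (simp add: divide_less_eq mult.commute)
  then have "P s" using s by (intro step[OF pow[of n]]) auto
  then show ?thesis using p by (simp add: P_def)
qed

lemma approximable_gaussian:
  fixes v :: "'a::euclidean_space"
  assumes l: "l > 0" and s: "s > 0"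
  shows "approximable l (\<lambda>x. exp (- s * (norm x)\<^sup>2 + x \<bullet> v))"
proof -
  have "approximable l (\<lambda>x. 1 * exp (- (s + 0) * (norm x)\<^sup>2 + x \<bullet> v))"
    using l s by (intro approximable_exp_step approximable_polynomial_gaussian real_polynomial_function.intros(2)) auto
  then show ?thesis by simp
qed

text \<open>Gaussians centred at \<open>a\<close> play the role of the multiplier \<open>m\<close>,
  their superlevel sets being balls. Multiplication by one changes the weight parameters (s, v) into
  (s + 1, v + 2 a) up to a constant, so \<open>K\<close> has to demand approximability for all these
  weights at once.\<close>

lemma approximable_indicator:
  fixes A :: "'a::euclidean_space set"
  assumes l: "l > 0" and A: "A \<in> sets borel"
  shows "approximable l (\<lambda>x. indicator A x * exp (- (norm x)\<^sup>2))"
proof -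
  define K :: "('a \<Rightarrow> real) set" where "K = {\<psi> \<in> borel_measurable borel. (\<exists>C. \<forall>x. \<bar>\<psi> x\<bar> \<le> C) \<and>
      (\<forall>s>0. \<forall>v. approximable l (\<lambda>x. \<psi> x * exp (- s * (norm x)\<^sup>2 + x \<bullet> v)))}"
  have one: "(\<lambda>x. 1) \<in> K"
    using approximable_gaussian[OF l] by (auto simp: K_def)
  have "(\<lambda>x. indicator A x * 1) \<in> K"
  proof (rule functional_monotone_class[OF _ _ _ _ _ A one])
    show "(\<lambda>x. f x + g x) \<in> K" if "f \<in> K" "g \<in> K" for f g
    proof -
      obtain C1 where "\<And>x. \<bar>f x\<bar> \<le> C1" using \<open>f \<in> K\<close> by (auto simp: K_def)
      moreover obtain C2 where "\<And>x. \<bar>g x\<bar> \<le> C2" using \<open>g \<in> K\<close> by (auto simp: K_def)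
      ultimately have "\<bar>f x + g x\<bar> \<le> C1 + C2" for x
        by (meson abs_triangle_ineq add_mono order_trans)
      then show ?thesis
        using that by (auto simp: K_def distrib_right intro!: approximable_add[OF l])
    qed
    show "(\<lambda>x. c * f x) \<in> K" if "f \<in> K" for c f
    proof -
      obtain C where "\<And>x. \<bar>f x\<bar> \<le> C"
        using \<open>f \<in> K\<close> by (auto simp: K_def)
      then have "\<bar>c * f x\<bar> \<le> \<bar>c\<bar> * C" for x
        by (simp add: abs_mult mult_left_mono)
      then show ?thesis
        using that by (auto simp: K_def mult.assoc intro!: approximable_scale)
    qed
    show "f \<in> K" if Fn: "\<And>n::nat. G n \<in> K" and C: "\<And>n x. \<bar>G n x\<bar> \<le> C"
      and lim: "\<And>x. (\<lambda>n. G n x) \<longlonglongrightarrow> f x" for G f C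
    proof -
      have [measurable]: "G n \<in> borel_measurable borel" for n using Fn by (simp add: K_def)
      have f [measurable]: "f \<in> borel_measurable borel"
        by (rule borel_measurable_LIMSEQ_real[OF lim]) simp
      have fC: "\<bar>f x\<bar> \<le> C" for x
        by (rule LIMSEQ_le_const2[OF tendsto_rabs[OF lim]]) (use C in auto)
      have "approximable l (\<lambda>x. f x * exp (- s * (norm x)\<^sup>2 + x \<bullet> v))" if s: "s > 0" for s v
      proof (rule approximable_limit[OF l])
        show "approximable l (\<lambda>x. G n x * exp (- s * (norm x)\<^sup>2 + x \<bullet> v))" for n
          using Fn s by (simp add: K_def)
        show "square_integrable (\<lambda>x. C * exp (- s * (norm x)\<^sup>2 + x \<bullet> v))"
          using approximable_gaussian[OF l s, of v] by (intro square_integrable_scale) (simp add: approximable_def)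
        show "AE x in lebesgue. \<bar>G n x * exp (- s * (norm x)\<^sup>2 + x \<bullet> v)\<bar> \<le> C * exp (- s * (norm x)\<^sup>2 + x \<bullet> v)" for n
          using C by (intro AE_I2) (simp add: abs_mult)
        show "AE x in lebesgue. (\<lambda>n. G n x * exp (- s * (norm x)\<^sup>2 + x \<bullet> v)) \<longlonglongrightarrow> f x * exp (- s * (norm x)\<^sup>2 + x \<bullet> v)"
          by (intro AE_I2 tendsto_intros lim)
        show "(\<lambda>x. f x * exp (- s * (norm x)\<^sup>2 + x \<bullet> v)) \<in> borel_measurable lebesgue"
          by (intro borel_times_lebesgue_measurable f measurable_completion) simp
      qed
      then show ?thesis using fC f by (auto simp: K_def)
    qed
    show "\<exists>C. \<forall>x. \<bar>f x\<bar> \<le> C" if "f \<in> K" for f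
      using that by (simp add: K_def)
    show "\<exists>m c. (\<forall>x. 0 \<le> m x \<and> m x \<le> 1) \<and> {x. c < m x} = ball a r \<and> (\<forall>f\<in>K. (\<lambda>x. m x * f x) \<in> K)"
      if r: "r > 0" for a :: 'a and r :: real
    proof (intro exI conjI allI ballI)
      let ?m = "\<lambda>x. exp (- (norm (x - a))\<^sup>2)"
      show "0 \<le> ?m x" "?m x \<le> 1" for x
        by simp_all
      show "{x. exp (- r\<^sup>2) < ?m x} = ball a r"
      proof (rule set_eqI)
        fix x
        have "(norm (x - a))\<^sup>2 < r\<^sup>2 \<longleftrightarrow> norm (x - a) < r"
          using r abs_square_le_1 power2_less_imp_less[of "norm (x - a)" r] power_strict_mono[of "norm (x - a)" r 2] by auto
        then show "x \<in> {x. exp (- r\<^sup>2) < ?m x} \<longleftrightarrow> x \<in> ball a r"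
          by (simp add: dist_norm norm_minus_commute)
      qed
      fix f assume f: "f \<in> K"
      then obtain C where C: "\<And>x. \<bar>f x\<bar> \<le> C" by (auto simp: K_def)
      have "\<bar>?m x * f x\<bar> \<le> 1 * C" for x
        unfolding abs_mult by (intro mult_mono) (use C in auto)
      moreover have "approximable l (\<lambda>x. ?m x * f x * exp (- s * (norm x)\<^sup>2 + x \<bullet> v))" if s: "s > 0" for s v
      proof -
        have "approximable l (\<lambda>x. exp (- (norm a)\<^sup>2) * (f x * exp (- (s + 1) * (norm x)\<^sup>2 + x \<bullet> (v + 2 *\<^sub>R a))))"
        proof (rule approximable_scale)
          have "\<forall>s>0. \<forall>v. approximable l (\<lambda>x. f x * exp (- s * (norm x)\<^sup>2 + x \<bullet> v))"
            using f unfolding K_def mem_Collect_eq by (elim conjE)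
          then show "approximable l (\<lambda>x. f x * exp (- (s + 1) * (norm x)\<^sup>2 + x \<bullet> (v + 2 *\<^sub>R a)))"
            using s by (metis add_pos_pos zero_less_one)
        qed
        moreover have "exp (- (norm a)\<^sup>2) * (f x * exp (- (s + 1) * (norm x)\<^sup>2 + x \<bullet> (v + 2 *\<^sub>R a))) =
            ?m x * f x * exp (- s * (norm x)\<^sup>2 + x \<bullet> v)" for x
        proof -
          have "- (norm a)\<^sup>2 + (- (s + 1) * (norm x)\<^sup>2 + x \<bullet> (v + 2 *\<^sub>R a)) =
              - (norm (x - a))\<^sup>2 + (- s * (norm x)\<^sup>2 + x \<bullet> v)"
            by (simp add: power2_norm_eq_inner inner_diff_left inner_diff_right inner_add_right inner_commute algebra_simps)
          then have "exp (- (norm a)\<^sup>2) * exp (- (s + 1) * (norm x)\<^sup>2 + x \<bullet> (v + 2 *\<^sub>R a)) =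
              ?m x * exp (- s * (norm x)\<^sup>2 + x \<bullet> v)"
            by (simp only: exp_add[symmetric])
          then show ?thesis by (simp only: mult_ac)
        qed
        ultimately show ?thesis by (simp only:)
      qed
      ultimately show "(\<lambda>x. ?m x * f x) \<in> K"
        using f by (auto simp: K_def)
    qed
  qed
  then have "approximable l (\<lambda>x. indicator A x * 1 * exp (- 1 * (norm x)\<^sup>2 + x \<bullet> 0))"
    by (simp only: K_def mem_Collect_eq zero_less_one)
  then show ?thesis by simp
qed

text \<open>Completeness of the Hermite functions. A Borel version of \<open>f\<close> is divided by
  the weight exp(-|x|^2) and the quotient approximated by simple functions; multiplying the weight
  back gives finite combinations of weighted indicators, dominated by 2 |f|.\<close>

lemma square_integrable_approximable:
  fixes f :: "'a::euclidean_space \<Rightarrow> real"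
  assumes l: "l > 0" and f: "square_integrable f"
  shows "approximable l f"
proof -
  have fm: "f \<in> borel_measurable lebesgue" using f by (simp add: square_integrable_real_iff)
  obtain g where g: "g \<in> borel_measurable lborel" and "AE x in lborel. f x = g x"
    using completion_ex_borel_measurable_real[OF fm] by blast
  then have fg: "AE x in lebesgue. f x = g x" by (intro AE_completion)
  define w where "w x = g x * exp ((norm x)\<^sup>2)" for x
  have "w \<in> borel_measurable borel" using g unfolding w_def by simp
  from borel_measurable_implies_sequence_metric[OF this, of 0]
  obtain S where S: "\<And>i. simple_function borel (S i)" and S_lim: "\<And>x. (\<lambda>i. S i x) \<longlonglongrightarrow> w x"
    and S_le: "\<And>i x. \<bar>S i x\<bar> \<le> 2 * \<bar>w x\<bar>"
    by (auto simp: dist_real_def)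
  have cancel: "w x * exp (- (norm x)\<^sup>2) = g x" for x
    by (simp add: w_def exp_minus field_simps)
  show ?thesis
  proof (rule approximable_limit[OF l])
    show "approximable l (\<lambda>x. S i x * exp (- (norm x)\<^sup>2))" for i
    proof -
      have fin: "finite (range (S i))"
        using simple_functionD(1)[OF S[of i]] by simp
      have sets: "S i -` {y} \<in> sets borel" for y
        using simple_functionD(2)[OF S[of i], of "{y}"] by simp
      have "approximable l (\<lambda>x. \<Sum>y\<in>T. y * (indicator (S i -` {y}) x * exp (- (norm x)\<^sup>2)))" if "finite T" for T
        using that
      proof induction
        case empty
        have "approximable l (\<lambda>x. 0 * (indicator {} x * exp (- (norm x)\<^sup>2)))"
          by (intro approximable_scale approximable_indicator l) simp
        then show ?case by simp
      next
        case (insert y T)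
        show ?case
          by (simp only: sum.insert[OF insert.hyps])
            (intro approximable_add approximable_scale approximable_indicator l sets insert.IH)
      qed
      from this[OF fin] show ?thesis
      proof (rule back_subst[where P="approximable l"], intro ext)
        fix x
        have "(\<Sum>y\<in>range (S i). indicator (S i -` {y}) x *\<^sub>R y) = S i x"
          using simple_function_indicator_representation_banach[OF S[of i], of x, symmetric]
          by (simp only: space_borel Int_UNIV_right UNIV_I simp_thms)
        then have "(\<Sum>y\<in>range (S i). indicator (S i -` {y}) x *\<^sub>R y) * exp (- (norm x)\<^sup>2) = S i x * exp (- (norm x)\<^sup>2)"
          by (rule arg_cong)
        moreover have "(\<Sum>y\<in>range (S i). y * (indicator (S i -` {y}) x * exp (- (norm x)\<^sup>2))) =
            (\<Sum>y\<in>range (S i). indicator (S i -` {y}) x *\<^sub>R y) * exp (- (norm x)\<^sup>2)"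
          unfolding sum_distrib_right by (rule sum.cong) (simp_all add: mult_ac)
        ultimately show "(\<Sum>y\<in>range (S i). y * (indicator (S i -` {y}) x * exp (- (norm x)\<^sup>2))) = S i x * exp (- (norm x)\<^sup>2)"
          by (rule trans[rotated])
      qed
    qed
    show "square_integrable (\<lambda>x. 2 * \<bar>f x\<bar>)"
      by (intro square_integrable_scale square_integrable_bound[OF borel_measurable_abs[OF fm] f]) simp
    show "AE x in lebesgue. \<bar>S i x * exp (- (norm x)\<^sup>2)\<bar> \<le> 2 * \<bar>f x\<bar>" for i
      using fg
    proof eventually_elim
      case (elim x)
      have "\<bar>S i x * exp (- (norm x)\<^sup>2)\<bar> \<le> 2 * \<bar>w x\<bar> * exp (- (norm x)\<^sup>2)"
        using S_le[of i x] by (simp add: abs_mult)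
      also have "\<dots> = 2 * \<bar>w x * exp (- (norm x)\<^sup>2)\<bar>" by (simp add: abs_mult)
      finally show ?case unfolding cancel using elim by simp
    qed
    show "AE x in lebesgue. (\<lambda>i. S i x * exp (- (norm x)\<^sup>2)) \<longlonglongrightarrow> f x"
      using fg
    proof eventually_elim
      case (elim x)
      have "(\<lambda>i. S i x * exp (- (norm x)\<^sup>2)) \<longlonglongrightarrow> w x * exp (- (norm x)\<^sup>2)"
        by (intro tendsto_intros S_lim)
      then show ?case unfolding cancel using elim by simp
    qed
    show "f \<in> borel_measurable lebesgue" by (rule fm)
  qed
qed

section \<open>The stability inequalities\<close>

text \<open>The common source of Bessel's inequality, of Parseval up to an error, of the distance to
  multiples of the ground state, and, with \<open>u = 0\<close>, of Pythagoras.\<close>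

lemma integral_square_diff_hermite_sum:
  assumes l: "l > 0" and u: "square_integrable u" and F: "finite F" "F \<subseteq> multi_index"
  shows "(\<integral>x. (u x - (\<Sum>k\<in>F. a k * hermite l k x))\<^sup>2 \<partial>lebesgue) =
    (\<integral>x. (u x)\<^sup>2 \<partial>lebesgue) - 2 * (\<Sum>k\<in>F. a k * coeff l u k) + (\<Sum>k\<in>F. (a k)\<^sup>2)"
proof -
  note h = square_integrable_hermite[OF l]
  have I1: "integrable lebesgue (\<lambda>x. (u x)\<^sup>2)" using u by (simp add: square_integrable_real_iff)
  have I2: "integrable lebesgue (\<lambda>x. \<Sum>k\<in>F. a k * (u x * hermite l k x))"
    by (intro Bochner_Integration.integrable_sum integrable_mult_right square_integrable_mult u h)
  have I3: "integrable lebesgue (\<lambda>x. \<Sum>k\<in>F. \<Sum>j\<in>F. (a k * a j) * (hermite l k x * hermite l j x))"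
    by (intro Bochner_Integration.integrable_sum integrable_mult_right square_integrable_mult h)
  have eq: "(u x - (\<Sum>k\<in>F. a k * hermite l k x))\<^sup>2 = (u x)\<^sup>2 - 2 * (\<Sum>k\<in>F. a k * (u x * hermite l k x))
      + (\<Sum>k\<in>F. \<Sum>j\<in>F. (a k * a j) * (hermite l k x * hermite l j x))" for x
  proof -
    have "u x * (\<Sum>k\<in>F. a k * hermite l k x) = (\<Sum>k\<in>F. a k * (u x * hermite l k x))"
      unfolding sum_distrib_left by (simp only: mult_ac)
    moreover have "(\<Sum>k\<in>F. a k * hermite l k x)\<^sup>2 = (\<Sum>k\<in>F. \<Sum>j\<in>F. (a k * a j) * (hermite l k x * hermite l j x))"
      unfolding power2_eq_square sum_product by (simp only: mult_ac)
    ultimately show ?thesis by (simp add: power2_diff)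
  qed
  have "(\<integral>x. (u x - (\<Sum>k\<in>F. a k * hermite l k x))\<^sup>2 \<partial>lebesgue) =
      (\<integral>x. (u x)\<^sup>2 \<partial>lebesgue) - 2 * (\<integral>x. (\<Sum>k\<in>F. a k * (u x * hermite l k x)) \<partial>lebesgue)
      + (\<integral>x. (\<Sum>k\<in>F. \<Sum>j\<in>F. (a k * a j) * (hermite l k x * hermite l j x)) \<partial>lebesgue)"
    unfolding eq using I1 I2 I3 by simp
  also have "(\<integral>x. (\<Sum>k\<in>F. a k * (u x * hermite l k x)) \<partial>lebesgue) = (\<Sum>k\<in>F. a k * coeff l u k)"
    by (subst Bochner_Integration.integral_sum)
      (auto simp: coeff_def intro!: integrable_mult_right square_integrable_mult u h)
  also have "(\<integral>x. (\<Sum>k\<in>F. \<Sum>j\<in>F. (a k * a j) * (hermite l k x * hermite l j x)) \<partial>lebesgue) =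
      (\<Sum>k\<in>F. \<Sum>j\<in>F. (a k * a j) * coeff l (hermite l k) j)"
    by (subst Bochner_Integration.integral_sum, intro Bochner_Integration.integrable_sum integrable_mult_right square_integrable_mult h,
        subst Bochner_Integration.integral_sum, intro integrable_mult_right square_integrable_mult h)
      (simp add: coeff_def)
  also have "\<dots> = (\<Sum>k\<in>F. (a k)\<^sup>2)"
  proof (rule sum.cong[OF refl])
    fix k assume k: "k \<in> F"
    have "(\<Sum>j\<in>F. (a k * a j) * coeff l (hermite l k) j) = (\<Sum>j\<in>F. if k = j then (a k)\<^sup>2 else 0)"
      using F k by (intro sum.cong refl) (auto simp: hermite_orthonormal[OF l] power2_eq_square subset_iff)
    also have "\<dots> = (a k)\<^sup>2" using F k by simp
    finally show "(\<Sum>j\<in>F. (a k * a j) * coeff l (hermite l k) j) = (a k)\<^sup>2" .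
  qed
  finally show ?thesis .
qed

lemma bessel:
  assumes l: "l > 0" and u: "square_integrable u" and F: "finite F" "F \<subseteq> multi_index"
  shows "(\<Sum>k\<in>F. (coeff l u k)\<^sup>2) \<le> (\<integral>x. (u x)\<^sup>2 \<partial>lebesgue)"
proof -
  have "0 \<le> (\<integral>x. (u x - (\<Sum>k\<in>F. coeff l u k * hermite l k x))\<^sup>2 \<partial>lebesgue)" by simp
  then show ?thesis
    unfolding integral_square_diff_hermite_sum[OF l u F] by (simp add: power2_eq_square)
qed

text \<open>Among all combinations over a fixed \<open>F\<close>, the coefficients of
  \<open>u\<close> give the least distance, so an approximant with arbitrary coefficients already
  bounds the mass missed by \<open>F\<close>.\<close>

lemma parseval_approximation:
  assumes l: "l > 0" and u: "square_integrable u" and \<epsilon>: "\<epsilon> > 0"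
  obtains F where "finite F" "F \<subseteq> multi_index" "(\<integral>x. (u x)\<^sup>2 \<partial>lebesgue) - \<epsilon> \<le> (\<Sum>k\<in>F. (coeff l u k)\<^sup>2)"
proof -
  obtain \<psi> where \<psi>: "hspan l \<psi>" "(\<integral>x. (u x - \<psi> x)\<^sup>2 \<partial>lebesgue) < \<epsilon>"
    using square_integrable_approximable[OF l u] \<epsilon> unfolding approximable_def by blast
  obtain F a where F: "finite F" "F \<subseteq> multi_index" and eq: "\<psi> = (\<lambda>x. \<Sum>k\<in>F. a k * hermite l k x)"
    using hspan_representation[OF \<psi>(1)] by blast
  have "0 \<le> (\<Sum>k\<in>F. (a k - coeff l u k)\<^sup>2)" by (intro sum_nonneg) simp
  also have "\<dots> = (\<Sum>k\<in>F. (a k)\<^sup>2) - 2 * (\<Sum>k\<in>F. a k * coeff l u k) + (\<Sum>k\<in>F. (coeff l u k)\<^sup>2)"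
    unfolding power2_diff sum.distrib sum_subtractf sum_distrib_left by (simp add: mult.assoc)
  finally have "(\<integral>x. (u x)\<^sup>2 \<partial>lebesgue) - \<epsilon> \<le> (\<Sum>k\<in>F. (coeff l u k)\<^sup>2)"
    using \<psi>(2) unfolding eq integral_square_diff_hermite_sum[OF l u F] by linarith
  with F show thesis by (rule that)
qed

text \<open>Boxes are finite and exhaust the multi-indices, and a unit shift in one coordinate leads
  from box \<open>M\<close> into box \<open>Suc M\<close>. The form of the definition fits
  \<open>finite_set_of_finite_funs\<close>.\<close>

definition index_box :: "nat \<Rightarrow> ('a::euclidean_space \<Rightarrow> nat) set" where
  "index_box M = {k. \<forall>b. (b \<in> Basis \<longrightarrow> k b \<in> {..M}) \<and> (b \<notin> Basis \<longrightarrow> k b = 0)}"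

lemma finite_index_box: "finite (index_box M)"
  unfolding index_box_def by (rule finite_set_of_finite_funs) auto

lemma index_box_subset: "index_box M \<subseteq> multi_index"
  by (auto simp: index_box_def multi_index_def)

lemma subset_index_box:
  fixes F :: "('a::euclidean_space \<Rightarrow> nat) set"
  assumes "finite F" "F \<subseteq> multi_index"
  obtains M where "F \<subseteq> index_box M"
proof
  show "F \<subseteq> index_box (\<Sum>k\<in>F. \<Sum>b\<in>Basis. k b)"
  proof
    fix k assume k: "k \<in> F"
    have "k b \<le> (\<Sum>k\<in>F. \<Sum>b\<in>Basis. k b)" if "b \<in> Basis" for b
    proof -
      have "k b \<le> (\<Sum>b\<in>Basis. k b)" using that by (intro member_le_sum) auto
      also have "\<dots> \<le> (\<Sum>k\<in>F. \<Sum>b\<in>Basis. k b)"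
        using k assms(1) by (intro member_le_sum[of k F "\<lambda>k. \<Sum>b\<in>Basis. k b"]) auto
      finally show ?thesis .
    qed
    then show "k \<in> index_box (\<Sum>k\<in>F. \<Sum>b\<in>Basis. k b)"
      using k assms(2) by (auto simp: index_box_def multi_index_def)
  qed
qed

text \<open>In the sum of the two Bessel sums the cross terms cancel and leave
  \<open>Suc (k b)\<close> times the squared coefficient at \<open>up k b\<close> plus
  \<open>k b\<close> times that at \<open>down k b\<close>. Reindexing both to the central index
  collects the weights m and m + 1 with \<open>m = k b\<close>, hence 2 m + 1.\<close>

lemma coordinate_energy_lower_bound:
  assumes l: "l > 0" and b: "b \<in> Basis" and u: "square_integrable u"
    and xu: "square_integrable (\<lambda>x. (x \<bullet> b) * u x)"
    and g: "has_weak_gradient u g" "square_integrable g"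
  shows "(\<Sum>k\<in>index_box M. (2 * real (k b) + 1) * (coeff l u k)\<^sup>2) \<le>
    (\<integral>x. (g x \<bullet> b)\<^sup>2 \<partial>lebesgue) / l\<^sup>2 + l\<^sup>2 * (\<integral>x. ((x \<bullet> b) * u x)\<^sup>2 \<partial>lebesgue)"
proof -
  define c where "c k = (coeff l u k)\<^sup>2" for k
  have c0: "c k \<ge> 0" for k by (simp add: c_def)
  \<comment> \<open>One size larger, so that it contains the images of \<open>index_box M\<close>
    under both shifts.\<close>
  let ?B = "index_box (Suc M)"
  have G: "(\<Sum>k\<in>?B. (hcoef (Suc (k b)) * coeff l u (up k b) - hcoef (k b) * coeff l u (down k b))\<^sup>2) \<le>
      (\<integral>x. (g x \<bullet> b)\<^sup>2 \<partial>lebesgue) / l\<^sup>2"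
  proof -
    have "(\<Sum>k\<in>?B. (coeff l (\<lambda>x. g x \<bullet> b) k)\<^sup>2) \<le> (\<integral>x. (g x \<bullet> b)\<^sup>2 \<partial>lebesgue)"
      by (rule bessel[OF l square_integrable_inner[OF g(2) b] finite_index_box index_box_subset])
    then show ?thesis
      unfolding coeff_gradient[OF l b u g] power_mult_distrib[of l] sum_distrib_left[symmetric]
      using l by (simp add: le_divide_eq mult.commute)
  qed
  have X: "(\<Sum>k\<in>?B. (hcoef (Suc (k b)) * coeff l u (up k b) + hcoef (k b) * coeff l u (down k b))\<^sup>2) \<le>
      l\<^sup>2 * (\<integral>x. ((x \<bullet> b) * u x)\<^sup>2 \<partial>lebesgue)"
  proof -
    have "(\<Sum>k\<in>?B. (coeff l (\<lambda>x. (x \<bullet> b) * u x) k)\<^sup>2) \<le> (\<integral>x. ((x \<bullet> b) * u x)\<^sup>2 \<partial>lebesgue)"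
      by (rule bessel[OF l xu finite_index_box index_box_subset])
    from mult_left_mono[OF this, of "l\<^sup>2"]
    show ?thesis
      unfolding coeff_mult[OF l b u xu, symmetric] power_mult_distrib[of l] sum_distrib_left[symmetric] by simp
  qed
  have U: "(\<Sum>k\<in>index_box M. real (k b) * c k) \<le> (\<Sum>k\<in>?B. real (Suc (k b)) * c (up k b))"
  proof -
    \<comment> \<open>Indices with \<open>k b = 0\<close> have weight 0 and are exactly those at
      which \<open>up\<close> does not undo \<open>down\<close>.\<close>
    let ?S = "{k \<in> index_box M. k b \<noteq> 0}"
    have "(\<Sum>k\<in>index_box M. real (k b) * c k) = (\<Sum>k\<in>?S. real (k b) * c k)"
      using finite_index_box by (intro sum.mono_neutral_right) auto
    also have "\<dots> = (\<Sum>k\<in>(\<lambda>k. down k b) ` ?S. real (Suc (k b)) * c (up k b))"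
    proof (subst sum.reindex)
      show "inj_on (\<lambda>k. down k b) ?S"
      proof (rule inj_on_inverseI[where g="\<lambda>k. up k b"])
        show "up (down k b) b = k" if "k \<in> ?S" for k using that by auto
      qed
      show "(\<Sum>k\<in>?S. real (k b) * c k) = sum ((\<lambda>k. real (Suc (k b)) * c (up k b)) \<circ> (\<lambda>k. down k b)) ?S"
      proof (rule sum.cong[OF refl])
        fix k assume k: "k \<in> ?S"
        then have "up (down k b) b = k" "Suc (down k b b) = k b" by auto
        then show "real (k b) * c k = ((\<lambda>k. real (Suc (k b)) * c (up k b)) \<circ> (\<lambda>k. down k b)) k"
          by simp
      qed
    qed
    also have "\<dots> \<le> (\<Sum>k\<in>?B. real (Suc (k b)) * c (up k b))"
    proof (rule sum_mono2[OF finite_index_box])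
      show "(\<lambda>k. down k b) ` ?S \<subseteq> ?B"
      proof
        fix j assume "j \<in> (\<lambda>k. down k b) ` ?S"
        then obtain k where k: "k \<in> index_box M" and j: "j = down k b" by auto
        have "j c \<le> Suc M" if "c \<in> Basis" for c
        proof -
          have "k c \<le> M" "k b \<le> M" using k that b by (simp_all add: index_box_def)
          then show ?thesis by (cases "c = b") (simp_all add: j)
        qed
        moreover have "j c = 0" if "c \<notin> Basis" for c
          using k that b by (auto simp: index_box_def j)
        ultimately show "j \<in> ?B" by (simp add: index_box_def)
      qed
    qed (simp add: c0)
    finally show ?thesis .
  qed
  have D: "(\<Sum>k\<in>index_box M. real (Suc (k b)) * c k) \<le> (\<Sum>k\<in>?B. real (k b) * c (down k b))"
  proof -
    have "(\<Sum>k\<in>index_box M. real (Suc (k b)) * c k) = (\<Sum>k\<in>(\<lambda>k. up k b) ` index_box M. real (k b) * c (down k b))"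
    proof (subst sum.reindex)
      show "inj_on (\<lambda>k. up k b) (index_box M)"
        by (rule inj_on_inverseI[where g="\<lambda>k. down k b"]) simp
    qed (simp add: comp_def)
    also have "\<dots> \<le> (\<Sum>k\<in>?B. real (k b) * c (down k b))"
    proof (rule sum_mono2[OF finite_index_box])
      show "(\<lambda>k. up k b) ` index_box M \<subseteq> ?B"
        using b by (auto simp: index_box_def le_SucI)
    qed (simp add: c0)
    finally show ?thesis .
  qed
  have "(\<Sum>k\<in>index_box M. (2 * real (k b) + 1) * c k) =
      (\<Sum>k\<in>index_box M. real (k b) * c k) + (\<Sum>k\<in>index_box M. real (Suc (k b)) * c k)"
    unfolding sum.distrib[symmetric] by (simp add: algebra_simps)
  also have "\<dots> \<le> (\<Sum>k\<in>?B. real (Suc (k b)) * c (up k b)) + (\<Sum>k\<in>?B. real (k b) * c (down k b))"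
    using U D by linarith
  also have "\<dots> = (\<Sum>k\<in>?B. (hcoef (Suc (k b)) * coeff l u (up k b) - hcoef (k b) * coeff l u (down k b))\<^sup>2) +
      (\<Sum>k\<in>?B. (hcoef (Suc (k b)) * coeff l u (up k b) + hcoef (k b) * coeff l u (down k b))\<^sup>2)"
    unfolding sum.distrib[symmetric]
  proof (rule sum.cong[OF refl])
    fix k :: "'a \<Rightarrow> nat"
    have "(x - y)\<^sup>2 + (x + y)\<^sup>2 = 2 * x\<^sup>2 + 2 * y\<^sup>2" for x y :: real
      by (simp add: power2_sum power2_diff)
    then show "real (Suc (k b)) * c (up k b) + real (k b) * c (down k b) =
        (hcoef (Suc (k b)) * coeff l u (up k b) - hcoef (k b) * coeff l u (down k b))\<^sup>2 +
        (hcoef (Suc (k b)) * coeff l u (up k b) + hcoef (k b) * coeff l u (down k b))\<^sup>2"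
      by (simp add: c_def power_mult_distrib power2_eq_square[of "hcoef _"] hcoef_square)
  qed
  also have "\<dots> \<le> (\<integral>x. (g x \<bullet> b)\<^sup>2 \<partial>lebesgue) / l\<^sup>2 + l\<^sup>2 * (\<integral>x. ((x \<bullet> b) * u x)\<^sup>2 \<partial>lebesgue)"
    using G X by linarith
  finally show ?thesis unfolding c_def .
qed

lemma square_integrable_coordinate:
  fixes u :: "'a::euclidean_space \<Rightarrow> real"
  assumes "square_integrable (\<lambda>x. u x *\<^sub>R x)" "b \<in> Basis"
  shows "square_integrable (\<lambda>x. (x \<bullet> b) * u x)"
  using square_integrable_inner[OF assms] by (simp add: mult.commute)

lemma integral_weighted:
  fixes u :: "'a::euclidean_space \<Rightarrow> real"
  assumes "square_integrable (\<lambda>x. u x *\<^sub>R x)"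
  shows "(\<integral>x. (norm x)\<^sup>2 * (u x)\<^sup>2 \<partial>lebesgue) = (\<Sum>b\<in>Basis. \<integral>x. ((x \<bullet> b) * u x)\<^sup>2 \<partial>lebesgue)"
  using integral_norm_square[OF assms] by (simp add: power_mult_distrib mult.commute)

text \<open>Summation over the coordinates produces the weights 2 |k| + N. Away from the ground
  state they are at least N + 2; at the ground state the weight is N, and the subtracted term is
  that difference of 2.\<close>

lemma energy_lower_bound:
  fixes u :: "'a::euclidean_space \<Rightarrow> real"
  assumes l: "l > 0" and u: "square_integrable u" and xu: "square_integrable (\<lambda>x. u x *\<^sub>R x)"
    and g: "has_weak_gradient u g" "square_integrable g"
  shows "(real DIM('a) + 2) * (\<integral>x. (u x)\<^sup>2 \<partial>lebesgue) - 2 * (coeff l u (\<lambda>_. 0))\<^sup>2 \<le>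
    (\<integral>x. (norm (g x))\<^sup>2 \<partial>lebesgue) / l\<^sup>2 + l\<^sup>2 * (\<integral>x. (norm x)\<^sup>2 * (u x)\<^sup>2 \<partial>lebesgue)"
    (is "?L \<le> ?R")
proof -
  let ?N = "real DIM('a)"
  have box: "(?N + 2) * (\<Sum>k\<in>index_box M. (coeff l u k)\<^sup>2) - 2 * (coeff l u (\<lambda>_. 0))\<^sup>2 \<le> ?R" for M
  proof -
    have zero: "(\<lambda>_. 0) \<in> (index_box M :: ('a \<Rightarrow> nat) set)" by (simp add: index_box_def)
    have "(\<Sum>k\<in>index_box M. if k = (\<lambda>_. 0) then 2 * (coeff l u k)\<^sup>2 else 0) = 2 * (coeff l u (\<lambda>_. 0))\<^sup>2"
      by (subst sum.delta[OF finite_index_box]) (simp add: zero)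
    then have "(?N + 2) * (\<Sum>k\<in>index_box M. (coeff l u k)\<^sup>2) - 2 * (coeff l u (\<lambda>_. 0))\<^sup>2 =
        (\<Sum>k\<in>index_box M. (?N + 2) * (coeff l u k)\<^sup>2 - (if k = (\<lambda>_. 0) then 2 * (coeff l u k)\<^sup>2 else 0))"
      by (simp only: sum_subtractf sum_distrib_left)
    also have "\<dots> \<le> (\<Sum>k\<in>index_box M. (\<Sum>b\<in>Basis. 2 * real (k b) + 1) * (coeff l u k)\<^sup>2)"
    proof (rule sum_mono)
      fix k :: "'a \<Rightarrow> nat" assume k: "k \<in> index_box M"
      have S: "(\<Sum>b\<in>Basis. 2 * real (k b) + 1) = 2 * real (\<Sum>b\<in>Basis. k b) + ?N"
        by (simp add: sum.distrib sum_distrib_left)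
      show "(?N + 2) * (coeff l u k)\<^sup>2 - (if k = (\<lambda>_. 0) then 2 * (coeff l u k)\<^sup>2 else 0) \<le>
          (\<Sum>b\<in>Basis. 2 * real (k b) + 1) * (coeff l u k)\<^sup>2"
      proof (cases "k = (\<lambda>_. 0)")
        case True
        then show ?thesis unfolding S by (simp add: algebra_simps)
      next
        case False
        then obtain b where b: "k b \<noteq> 0" by auto
        with k have "b \<in> Basis" by (cases "b \<in> Basis") (auto simp: index_box_def)
        with b have "(\<Sum>b\<in>Basis. k b) \<noteq> 0" by auto
        then have "1 \<le> real (\<Sum>b\<in>Basis. k b)" by (simp only: real_of_nat_ge_one_iff)
        then have "?N + 2 \<le> (\<Sum>b\<in>Basis. 2 * real (k b) + 1)" unfolding S by linarith
        from mult_right_mono[OF this, of "(coeff l u k)\<^sup>2"] False show ?thesis by simp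
      qed
    qed
    also have "\<dots> = (\<Sum>b\<in>Basis. \<Sum>k\<in>index_box M. (2 * real (k b) + 1) * (coeff l u k)\<^sup>2)"
      unfolding sum_distrib_right by (rule sum.swap)
    also have "\<dots> \<le> (\<Sum>b\<in>Basis. (\<integral>x. (g x \<bullet> b)\<^sup>2 \<partial>lebesgue) / l\<^sup>2 + l\<^sup>2 * (\<integral>x. ((x \<bullet> b) * u x)\<^sup>2 \<partial>lebesgue))"
      by (intro sum_mono coordinate_energy_lower_bound l u g square_integrable_coordinate xu)
    also have "\<dots> = ?R"
      unfolding integral_norm_square[OF g(2)] integral_weighted[OF xu]
      by (simp add: sum.distrib sum_divide_distrib sum_distrib_left)
    finally show ?thesis .
  qed
  show ?thesis
  proof (rule field_le_epsilon)
    fix e :: real assume e: "e > 0"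
    \<comment> \<open>The missed mass enters multiplied by N + 2, hence this tolerance.\<close>
    then have "e / (?N + 2) > 0" by (simp add: add_nonneg_pos)
    then obtain F where F: "finite F" "F \<subseteq> multi_index"
      and le: "(\<integral>x. (u x)\<^sup>2 \<partial>lebesgue) - e / (?N + 2) \<le> (\<Sum>k\<in>F. (coeff l u k)\<^sup>2)"
      using parseval_approximation[OF l u] by blast
    obtain M where M: "F \<subseteq> index_box M" using subset_index_box[OF F] by blast
    have "(\<Sum>k\<in>F. (coeff l u k)\<^sup>2) \<le> (\<Sum>k\<in>index_box M. (coeff l u k)\<^sup>2)"
      by (rule sum_mono2[OF finite_index_box M]) simp
    with le have "(\<integral>x. (u x)\<^sup>2 \<partial>lebesgue) - e / (?N + 2) \<le> (\<Sum>k\<in>index_box M. (coeff l u k)\<^sup>2)"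
      by linarith
    from mult_left_mono[OF this, of "?N + 2"]
    have "(?N + 2) * (\<integral>x. (u x)\<^sup>2 \<partial>lebesgue) - e \<le> (?N + 2) * (\<Sum>k\<in>index_box M. (coeff l u k)\<^sup>2)"
      by (simp add: right_diff_distrib add_nonneg_pos)
    with box[of M] show "?L \<le> ?R + e" by linarith
  qed
qed

text \<open>For nonzero energies \<open>l\<close> minimises G / l^2 + l^2 X: both terms then equal
  sqrt G sqrt X, the product in \<open>delta1\<close>. If G or X vanishes there is no such
  \<open>l\<close>, and the case is settled by showing that \<open>u\<close> has norm 0.\<close>

lemma delta1_lower_bound:
  fixes u :: "'a::euclidean_space \<Rightarrow> real"
  assumes "u \<in> W12_weighted"
  obtains l where "l > 0" "(\<integral>x. (u x)\<^sup>2 \<partial>lebesgue) - (coeff l u (\<lambda>_. 0))\<^sup>2 \<le> delta1 u"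
proof -
  obtain g where u: "square_integrable u" and xu: "square_integrable (\<lambda>x. u x *\<^sub>R x)"
    and g: "has_weak_gradient u g" "square_integrable g"
    using assms by (auto simp: W12_weighted_def W12_def)
  define G where "G = (\<integral>x. (norm (g x))\<^sup>2 \<partial>lebesgue)"
  define X where "X = (\<integral>x. (norm x)\<^sup>2 * (u x)\<^sup>2 \<partial>lebesgue)"
  define U where "U = (\<integral>x. (u x)\<^sup>2 \<partial>lebesgue)"
  let ?N = "real DIM('a)"
  have nonneg: "G \<ge> 0" "X \<ge> 0" "U \<ge> 0" by (simp_all add: G_def X_def U_def)
  have delta: "delta1 u = sqrt G * sqrt X - ?N / 2 * U"
    unfolding delta1_def integral_weak_gradient[OF g] G_def X_def U_def ..
  have key: "(?N + 2) * U - 2 * (coeff l u (\<lambda>_. 0))\<^sup>2 \<le> G / l\<^sup>2 + l\<^sup>2 * X" if "l > 0" for l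
    using energy_lower_bound[OF that u xu g] by (simp add: G_def X_def U_def)
  have N: "?N > 0" by simp
  show thesis
  proof (cases "G > 0 \<and> X > 0")
    case True
    define l where "l = sqrt (sqrt G / sqrt X)"
    have l: "l > 0" and l2: "l\<^sup>2 = sqrt G / sqrt X"
      using True by (simp_all add: l_def)
    have "G / l\<^sup>2 = sqrt G * sqrt X" "l\<^sup>2 * X = sqrt G * sqrt X"
      unfolding l2 using True by (simp_all add: field_simps)
    with key[OF l] have "(?N + 2) * U - 2 * (coeff l u (\<lambda>_. 0))\<^sup>2 \<le> 2 * (sqrt G * sqrt X)"
      by linarith
    then have "U - (coeff l u (\<lambda>_. 0))\<^sup>2 \<le> delta1 u"
      unfolding delta by (simp add: algebra_simps)
    with l show thesis using that by (simp add: U_def)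
  next
    case False
    \<comment> \<open>The uncertainty principle before optimisation in \<open>l\<close>. With one
      energy equal to 0, an extreme \<open>l\<close> makes the other term as small as
      desired.\<close>
    have weak: "?N * U \<le> G / l\<^sup>2 + l\<^sup>2 * X" if "l > 0" for l
    proof -
      have "(coeff l u (\<lambda>_. 0))\<^sup>2 \<le> U"
        using bessel[OF that u, of "{\<lambda>_. 0}"] by (simp add: U_def multi_index_def)
      with key[OF that] show ?thesis by (simp add: algebra_simps)
    qed
    have "U = 0"
    proof (rule ccontr)
      assume "U \<noteq> 0"
      with nonneg N have NU: "?N * U > 0" by simp
      consider "G = 0" | "X = 0" using False nonneg by linarith
      then show False
      proof cases
        case 1
        \<comment> \<open>Serves as l^2, small enough that \<open>t * X\<close> stays strictly below
          \<open>?N * U\<close>.\<close>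
        define t where "t = ?N * U / (X + 1)"
        have t: "t > 0" using NU nonneg by (simp add: t_def)
        have "?N * U \<le> t * X" using weak[of "sqrt t"] 1 t by simp
        also have "t * X < t * (X + 1)" using t by simp
        also have "\<dots> = ?N * U" using nonneg by (simp add: t_def)
        finally show False by simp
      next
        case 2
        \<comment> \<open>Here 1/t serves as l^2, so that the surviving term is
          \<open>t * G\<close>.\<close>
        define t where "t = ?N * U / (G + 1)"
        have t: "t > 0" using NU nonneg by (simp add: t_def)
        have "?N * U \<le> t * G" using weak[of "sqrt (1 / t)"] 2 t by (simp add: field_simps)
        also have "t * G < t * (G + 1)" using t by simp
        also have "\<dots> = ?N * U" using nonneg by (simp add: t_def)
        finally show False by simp
      qed
    qed
    then have "delta1 u = sqrt G * sqrt X" unfolding delta by simp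
    moreover have "0 \<le> sqrt G * sqrt X" using nonneg by simp
    ultimately have "U - (coeff 1 u (\<lambda>_. 0))\<^sup>2 \<le> delta1 u"
      using \<open>U = 0\<close> zero_le_power2[of "coeff 1 u (\<lambda>_. 0)"] by linarith
    then show thesis using that[of 1] by (simp add: U_def)
  qed
qed

section \<open>From the deficit bound to the two infima\<close>

lemma hermite_0_gaussian:
  obtains Z where "\<And>a. (\<lambda>x::'a::euclidean_space. a * hermite l (\<lambda>_. 0) x) = gaussian (a * Z) (l\<^sup>2 / 2)"
  by (rule that[of "1 / L2_norm (gaussian 1 (l\<^sup>2 / 2) :: 'a \<Rightarrow> real)"])
    (simp add: hermite_0 gaussian_def fun_eq_iff)

lemma L2_norm_diff_hermite_0:
  assumes "l > 0" "square_integrable u"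
  shows "(L2_norm (\<lambda>x. u x - a * hermite l (\<lambda>_. 0) x))\<^sup>2 =
    (\<integral>x. (u x)\<^sup>2 \<partial>lebesgue) - 2 * (a * coeff l u (\<lambda>_. 0)) + a\<^sup>2"
  using integral_square_diff_hermite_sum[OF assms, of "{\<lambda>_. 0}" "\<lambda>_. a"]
  by (simp add: L2_norm_square multi_index_def)

text \<open>The competitor is the orthogonal projection of \<open>u\<close> onto the ground state, a
  Gaussian at squared distance exactly the left side of \<open>delta1_lower_bound\<close>.\<close>

lemma gaussian_inf_le_delta1:
  fixes u :: "'a::euclidean_space \<Rightarrow> real"
  assumes u: "u \<in> W12_weighted"
  shows "gaussian_inf u \<le> delta1 u"
proof -
  obtain l where l: "l > 0" and le: "(\<integral>x. (u x)\<^sup>2 \<partial>lebesgue) - (coeff l u (\<lambda>_. 0))\<^sup>2 \<le> delta1 u"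
    using delta1_lower_bound[OF u] by blast
  have l2: "l\<^sup>2 / 2 > 0" using l by simp
  have u2: "square_integrable u" using u by (simp add: W12_weighted_def W12_def)
  obtain Z where Z: "\<And>a. (\<lambda>x::'a. a * hermite l (\<lambda>_. 0) x) = gaussian (a * Z) (l\<^sup>2 / 2)"
    using hermite_0_gaussian by blast
  let ?a = "coeff l u (\<lambda>_. 0)"
  have "gaussian_inf u \<le> (L2_norm (\<lambda>x. u x - gaussian (?a * Z) (l\<^sup>2 / 2) x))\<^sup>2"
    unfolding gaussian_inf_def
  proof (rule cInf_lower)
    show "(L2_norm (\<lambda>x. u x - gaussian (?a * Z) (l\<^sup>2 / 2) x))\<^sup>2 \<in>
        {(L2_norm (\<lambda>x. u x - gaussian c \<alpha> x))\<^sup>2 |c \<alpha>. \<alpha> > 0}"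
      by (intro CollectI exI[of _ "?a * Z"] exI[of _ "l\<^sup>2 / 2"] conjI refl l2)
  qed (auto intro: bdd_belowI[of _ 0])
  also have "\<dots> = (L2_norm (\<lambda>x. u x - ?a * hermite l (\<lambda>_. 0) x))\<^sup>2"
    unfolding Z[symmetric] ..
  also have "\<dots> = (\<integral>x. (u x)\<^sup>2 \<partial>lebesgue) - ?a\<^sup>2"
    unfolding L2_norm_diff_hermite_0[OF l u2] by (simp add: power2_eq_square)
  finally show ?thesis using le by linarith
qed

lemma gaussian_inf_same_norm_le_delta1:
  fixes u :: "'a::euclidean_space \<Rightarrow> real"
  assumes u: "u \<in> W12_weighted"
  shows "1 / 2 * gaussian_inf_same_norm u \<le> delta1 u"
proof -
  define U where "U = (\<integral>x. (u x)\<^sup>2 \<partial>lebesgue)"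
  obtain l where l: "l > 0" and le: "U - (coeff l u (\<lambda>_. 0))\<^sup>2 \<le> delta1 u"
    using delta1_lower_bound[OF u] unfolding U_def by blast
  have l2: "l\<^sup>2 / 2 > 0" using l by simp
  have u2: "square_integrable u" using u by (simp add: W12_weighted_def W12_def)
  obtain Z where Z: "\<And>a. (\<lambda>x::'a. a * hermite l (\<lambda>_. 0) x) = gaussian (a * Z) (l\<^sup>2 / 2)"
    using hermite_0_gaussian by blast
  define p where "p = coeff l u (\<lambda>_. 0)"
  \<comment> \<open>Of the two multiples of the ground state with the norm of \<open>u\<close>, the
    sign of \<open>p\<close> selects the nearer one.\<close>
  define a where "a = (if p \<ge> 0 then sqrt U else - sqrt U)"
  have U0: "U \<ge> 0" by (simp add: U_def)
  have a2: "a\<^sup>2 = U" and ap: "a * p = sqrt U * \<bar>p\<bar>" using U0 by (auto simp: a_def)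
  have pU: "p\<^sup>2 \<le> U"
    using bessel[OF l u2, of "{\<lambda>_. 0}"] by (simp add: U_def p_def multi_index_def)
  have same: "L2_norm u = L2_norm (gaussian (a * Z) (l\<^sup>2 / 2) :: 'a \<Rightarrow> real)"
  proof -
    have "(\<integral>x. (a * hermite l (\<lambda>_. 0) x)\<^sup>2 \<partial>(lebesgue :: 'a measure)) = a\<^sup>2 * coeff l (hermite l (\<lambda>_ :: 'a. 0)) (\<lambda>_. 0)"
      by (simp add: coeff_def power_mult_distrib flip: power2_eq_square)
    also have "\<dots> = U"
      using hermite_orthonormal[OF l, of "\<lambda>_ :: 'a. 0" "\<lambda>_. 0"] by (simp add: a2 multi_index_def)
    finally show ?thesis unfolding Z[symmetric] by (simp add: L2_norm_def U_def)
  qed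
  have "gaussian_inf_same_norm u \<le> (L2_norm (\<lambda>x. u x - gaussian (a * Z) (l\<^sup>2 / 2) x))\<^sup>2"
    unfolding gaussian_inf_same_norm_def
  proof (rule cInf_lower)
    show "(L2_norm (\<lambda>x. u x - gaussian (a * Z) (l\<^sup>2 / 2) x))\<^sup>2 \<in>
        {(L2_norm (\<lambda>x. u x - gaussian c \<alpha> x))\<^sup>2 |c \<alpha>.
            \<alpha> > 0 \<and> L2_norm u = L2_norm (gaussian c \<alpha> :: 'a \<Rightarrow> real)}"
      by (intro CollectI exI[of _ "a * Z"] exI[of _ "l\<^sup>2 / 2"] conjI refl same l2)
  qed (auto intro: bdd_belowI[of _ 0])
  also have "\<dots> = (L2_norm (\<lambda>x. u x - a * hermite l (\<lambda>_. 0) x))\<^sup>2"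
    unfolding Z[symmetric] ..
  also have "\<dots> = 2 * U - 2 * (sqrt U * \<bar>p\<bar>)"
    unfolding L2_norm_diff_hermite_0[OF l u2] by (simp add: p_def[symmetric] U_def[symmetric] a2 ap)
  \<comment> \<open>The only loss compared with the first inequality: |p| is at most sqrt U, so one
    factor sqrt U may be lowered to |p|.\<close>
  also have "\<dots> \<le> 2 * (U - p\<^sup>2)"
  proof -
    have "\<bar>p\<bar> \<le> sqrt U" using real_sqrt_le_mono[OF pU] by simp
    from mult_right_mono[OF this, of "\<bar>p\<bar>"] have "p\<^sup>2 \<le> sqrt U * \<bar>p\<bar>"
      by (simp add: power2_eq_square abs_mult_self_eq)
    then show ?thesis by (simp add: right_diff_distrib)
  qed
  also have "\<dots> \<le> 2 * delta1 u"
    using mult_left_mono[OF le, of 2] by (simp add: p_def)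
  finally show ?thesis by simp
qed

section \<open>Energies of Hermite functions and the equality case\<close>

lemma integral_square_hermite_combination:
  assumes l: "l > 0" and k: "k \<in> multi_index" and j: "j \<in> multi_index" and kj: "k \<noteq> j"
  shows "(\<integral>x. (\<alpha> * hermite l k x + \<beta> * hermite l j x)\<^sup>2 \<partial>lebesgue) = \<alpha>\<^sup>2 + \<beta>\<^sup>2"
  \<comment> \<open>Expanding the distance from the zero function to the combination; the minus
    signs make the square that of the given sum.\<close>
  using integral_square_diff_hermite_sum[OF l square_integrable_zero, of "{k, j}" "\<lambda>i. if i = k then - \<alpha> else - \<beta>"] assms
  by (simp add: coeff_def add.commute)

text \<open>Gradient and position terms differ only in a sign between two orthogonal functions, so
  the two energies coincide. At frequency 1 this is the equality case of the balancing in
  \<open>l\<close>.\<close>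

lemma hermite_energy:
  assumes k: "k \<in> multi_index" and b: "b \<in> Basis"
  shows "(\<integral>x. (partial (hermite 1 k) b x)\<^sup>2 \<partial>lebesgue) = real (k b) + 1 / 2" (is "?G = _")
    and "(\<integral>x. ((x \<bullet> b) * hermite 1 k x)\<^sup>2 \<partial>lebesgue) = real (k b) + 1 / 2" (is "?X = _")
proof -
  have idx: "up k b \<in> multi_index" "down k b \<in> multi_index" "up k b \<noteq> down k b"
    using k b by (auto simp: multi_index_def fun_eq_iff)
  have val: "(hcoef (Suc (k b)))\<^sup>2 + (hcoef (k b))\<^sup>2 = real (k b) + 1 / 2"
    by (simp add: power2_eq_square hcoef_square field_simps)
  have "?G = (\<integral>x. ((- hcoef (Suc (k b))) * hermite 1 (up k b) x + hcoef (k b) * hermite 1 (down k b) x)\<^sup>2 \<partial>lebesgue)"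
    unfolding partial_hermite[OF b] by (simp add: algebra_simps)
  then show "?G = real (k b) + 1 / 2"
    using integral_square_hermite_combination[OF zero_less_one idx, of "- hcoef (Suc (k b))" "hcoef (k b)"] val by simp
  have "(x \<bullet> b) * hermite 1 k x = hcoef (Suc (k b)) * hermite 1 (up k b) x + hcoef (k b) * hermite 1 (down k b) x" for x
    using hermite_mult[OF b, of 1 x k] by simp
  then show "?X = real (k b) + 1 / 2"
    using integral_square_hermite_combination[OF zero_less_one idx, of "hcoef (Suc (k b))" "hcoef (k b)"] val by simp
qed

lemma square_integrable_weighted_hermite:
  assumes "l > 0"
  shows "square_integrable (\<lambda>x. hermite l k x *\<^sub>R x)"
proof -
  have "(\<Sum>b\<in>Basis. ((x \<bullet> b) * hermite l k x) *\<^sub>R b) = hermite l k x *\<^sub>R x" for x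
  proof -
    have "hermite l k x *\<^sub>R x = hermite l k x *\<^sub>R (\<Sum>b\<in>Basis. (x \<bullet> b) *\<^sub>R b)"
      by (simp only: euclidean_representation)
    then show ?thesis by (simp add: scaleR_sum_right mult.commute)
  qed
  moreover have "square_integrable (\<lambda>x. \<Sum>b\<in>Basis. ((x \<bullet> b) * hermite l k x) *\<^sub>R b)"
    by (intro square_integrable_vector square_integrable_mult_hermite assms)
  ultimately show ?thesis by simp
qed

lemma hermite_W12_weighted: "l > 0 \<Longrightarrow> hermite l k \<in> W12_weighted"
  unfolding W12_weighted_def W12_def
  using square_integrable_hermite square_integrable_weighted_hermite
    smooth_has_weak_gradient[OF smooth_hermite] square_integrable_grad_hermite by blast

text \<open>Since both energies equal |k| + N/2, so does the product of their square roots, and the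
  term N/2 cancels against the subtracted mass.\<close>

lemma delta1_hermite:
  fixes k :: "'a::euclidean_space \<Rightarrow> nat"
  assumes k: "k \<in> multi_index"
  shows "delta1 (hermite 1 k) = real (\<Sum>b\<in>Basis. k b)"
proof -
  define E where "E = (\<Sum>b\<in>(Basis :: 'a set). real (k b) + 1 / 2)"
  note g = smooth_has_weak_gradient[OF smooth_hermite[of 1 k]] square_integrable_grad_hermite[OF zero_less_one, of k]
  have inn: "grad_hermite 1 k x \<bullet> b = partial (hermite 1 k) b x" if "b \<in> Basis" for b x
    using that by (simp only: inner_sum_left_Basis)
  have G: "(\<integral>x. (norm (weak_gradient (hermite 1 k) x))\<^sup>2 \<partial>lebesgue) = E"
    unfolding integral_weak_gradient[OF g] integral_norm_square[OF g(2)] E_def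
    by (rule sum.cong[OF refl]) (simp only: inn hermite_energy[OF k])
  have X: "(\<integral>x. (norm x)\<^sup>2 * (hermite 1 k x)\<^sup>2 \<partial>lebesgue) = E"
    unfolding integral_weighted[OF square_integrable_weighted_hermite[OF zero_less_one]] E_def
    by (rule sum.cong[OF refl]) (simp only: hermite_energy[OF k])
  have U: "(\<integral>x. (hermite 1 k x)\<^sup>2 \<partial>lebesgue) = 1"
    using hermite_orthonormal[OF zero_less_one k k] by (simp add: coeff_def power2_eq_square)
  have "E \<ge> 0" unfolding E_def by (intro sum_nonneg) simp
  then have "delta1 (hermite 1 k) = E - real DIM('a) / 2"
    unfolding delta1_def G X U by simp
  also have "\<dots> = real (\<Sum>b\<in>Basis. k b)"
    by (simp add: E_def sum.distrib)
  finally show ?thesis .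
qed

lemma lebesgue_integral_odd:
  fixes f :: "'a::euclidean_space \<Rightarrow> real"
  assumes f [measurable]: "f \<in> borel_measurable borel" and odd: "\<And>x. f (- x) = - f x"
  shows "(\<integral>x. f x \<partial>lebesgue) = 0"
proof -
  have refl: "distr lborel borel uminus = (lborel :: 'a measure)"
    by (subst lborel_affine[of "-1" 0]) (auto simp: density_1 one_ennreal_def[symmetric])
  have "(\<integral>x. f x \<partial>lborel) = (\<integral>x. f x \<partial>distr lborel borel uminus)"
    by (simp only: refl)
  also have "\<dots> = (\<integral>x. f (- x) \<partial>lborel)"
    by (rule integral_distr) auto
  finally have "(\<integral>x. f x \<partial>lborel) = 0" by (simp add: odd)
  then show ?thesis by (simp add: integral_lebesgue_borel)
qed

text \<open>The first excited state is odd, hence orthogonal to every centred Gaussian.\<close>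

lemma extremal_function:
  obtains u :: "'a::euclidean_space \<Rightarrow> real" where "u \<in> W12_weighted" "delta1 u = 1"
    "gaussian_inf u = 1" "gaussian_inf_same_norm u = 2"
proof -
  obtain b :: 'a where b: "b \<in> Basis" using nonempty_Basis by blast
  define k :: "'a \<Rightarrow> nat" where "k = up (\<lambda>_. 0) b"
  define u where "u = hermite 1 k"
  have k: "k \<in> multi_index" using b by (auto simp: k_def multi_index_def)
  have u2: "square_integrable u" unfolding u_def by (rule square_integrable_hermite) simp
  have um [measurable]: "u \<in> borel_measurable borel" unfolding u_def by simp
  have "(\<Sum>c\<in>Basis. k c) = 1"
    using b by (simp add: k_def if_distrib cong: if_cong)
  then have delta: "delta1 u = 1" using delta1_hermite[OF k] by (simp add: u_def)
  have U: "(\<integral>x. (u x)\<^sup>2 \<partial>lebesgue) = 1"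
    using hermite_orthonormal[OF zero_less_one k k] by (simp add: u_def coeff_def power2_eq_square)
  \<comment> \<open>\<open>u\<close> is a multiple of \<open>x \<bullet> b\<close> times the even
    ground state.\<close>
  have odd: "u (- x) = - u x" for x
  proof -
    have u: "(y \<bullet> b) * hermite 1 (\<lambda>_. 0) y = hcoef (Suc 0) * u y" for y
      using hermite_mult[OF b, of 1 y "\<lambda>_. 0"] by (simp add: hcoef_0 u_def k_def)
    have "hermite 1 (\<lambda>_. 0) (- x) = hermite 1 (\<lambda>_. 0) x" by (simp add: hermite_0 gaussian_def)
    then have "hcoef (Suc 0) * u (- x) = hcoef (Suc 0) * (- u x)"
      using u[of x] u[of "- x"] by simp
    then show ?thesis using hcoef_Suc_pos[of 0] by (metis less_irrefl mult_left_cancel)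
  qed
  \<comment> \<open>Orthogonality removes the cross term, so the distance depends only on the norm
    of the Gaussian: it is least at \<open>c = 0\<close>, and constantly 2 once that norm is
    required to be 1.\<close>
  have dist: "(L2_norm (\<lambda>x. u x - gaussian c \<alpha> x))\<^sup>2 = 1 + (L2_norm (gaussian c \<alpha> :: 'a \<Rightarrow> real))\<^sup>2"
    if \<alpha>: "\<alpha> > 0" for c \<alpha>
  proof -
    let ?g = "gaussian c \<alpha> :: 'a \<Rightarrow> real"
    have g2: "square_integrable ?g" by (rule square_integrable_gaussian[OF \<alpha>])
    have gm: "?g \<in> borel_measurable borel" unfolding gaussian_def[abs_def] by simp
    have "(\<integral>x. u x * ?g x \<partial>lebesgue) = 0"
      by (rule lebesgue_integral_odd) (use um gm odd in \<open>auto simp: gaussian_def\<close>)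
    moreover have "(\<integral>x. (u x - ?g x)\<^sup>2 \<partial>lebesgue) =
        (\<integral>x. (u x)\<^sup>2 \<partial>lebesgue) + (\<integral>x. (?g x)\<^sup>2 \<partial>lebesgue) - 2 * (\<integral>x. u x * ?g x \<partial>lebesgue)"
      unfolding power2_diff mult.assoc
      using u2 g2 square_integrable_mult[OF u2 g2] by (simp add: square_integrable_real_iff)
    ultimately show ?thesis by (simp add: L2_norm_square U)
  qed
  have norm_scale: "L2_norm (gaussian c \<alpha> :: 'a \<Rightarrow> real) = \<bar>c\<bar> * L2_norm (gaussian 1 \<alpha> :: 'a \<Rightarrow> real)" for c \<alpha>
    by (simp add: L2_norm_def gaussian_def abs_mult power_mult_distrib real_sqrt_mult)
  have inf: "gaussian_inf u = 1"
    unfolding gaussian_inf_def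
  proof (rule cInf_eq_minimum)
    \<comment> \<open>Witness: the zero multiple of a Gaussian, of arbitrary width.\<close>
    show "1 \<in> {(L2_norm (\<lambda>x. u x - gaussian c \<alpha> x))\<^sup>2 |c \<alpha>. 0 < \<alpha>}"
      using dist[of 1 0] norm_scale[of 0 1] by (intro CollectI exI[of _ 0] exI[of _ 1]) simp
  qed (use dist in auto)
  have u_norm: "L2_norm u = 1" by (simp add: L2_norm_def U)
  have inf_same: "gaussian_inf_same_norm u = 2"
    unfolding gaussian_inf_same_norm_def
  proof (rule cInf_eq_minimum)
    let ?c = "1 / L2_norm (gaussian 1 1 :: 'a \<Rightarrow> real)"
    have "L2_norm (gaussian ?c 1 :: 'a \<Rightarrow> real) = 1"
      using L2_norm_gaussian_pos[of 1, where 'a='a] norm_scale[of ?c 1] by simp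
    then show "2 \<in> {(L2_norm (\<lambda>x. u x - gaussian c \<alpha> x))\<^sup>2 |c \<alpha>.
        0 < \<alpha> \<and> L2_norm u = L2_norm (gaussian c \<alpha> :: 'a \<Rightarrow> real)}"
      using dist[of 1 ?c] u_norm by (intro CollectI exI[of _ ?c] exI[of _ 1]) simp
  next
    fix x assume "x \<in> {(L2_norm (\<lambda>x. u x - gaussian c \<alpha> x))\<^sup>2 |c \<alpha>.
        0 < \<alpha> \<and> L2_norm u = L2_norm (gaussian c \<alpha> :: 'a \<Rightarrow> real)}"
    then show "2 \<le> x" using dist u_norm by auto
  qed
  have "u \<in> W12_weighted" unfolding u_def by (rule hermite_W12_weighted) simp
  then show thesis using delta inf inf_same by (rule that)
qed

theorem theorem1p2:
  shows "(\<forall>u\<in>(W12_weighted :: (real ^ 'n \<Rightarrow> real) set). delta1 u \<ge> gaussian_inf u) \<and>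
         (\<forall>u\<in>(W12_weighted :: (real ^ 'n \<Rightarrow> real) set). delta1 u \<ge> 1/2 * gaussian_inf_same_norm u) \<and>
         (\<forall>C>1. \<not> (\<forall>u\<in>(W12_weighted :: (real ^ 'n \<Rightarrow> real) set). delta1 u \<ge> C * gaussian_inf u)) \<and>
         (\<forall>C>1/2. \<not> (\<forall>u\<in>(W12_weighted :: (real ^ 'n \<Rightarrow> real) set). delta1 u \<ge> C * gaussian_inf_same_norm u)) \<and>
         (\<exists>u\<in>(W12_weighted :: (real ^ 'n \<Rightarrow> real) set). delta1 u = gaussian_inf u \<and>
                \<not> (delta1 u = 0 \<and> gaussian_inf u = 0)) \<and>
         (\<exists>u\<in>(W12_weighted :: (real ^ 'n \<Rightarrow> real) set). delta1 u = 1/2 * gaussian_inf_same_norm u \<and>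
                \<not> (delta1 u = 0 \<and> 1/2 * gaussian_inf_same_norm u = 0))"
proof -
  obtain u :: "real ^ 'n \<Rightarrow> real" where u: "u \<in> W12_weighted" "delta1 u = 1"
    "gaussian_inf u = 1" "gaussian_inf_same_norm u = 2"
    by (rule extremal_function)
  show ?thesis
  proof (intro conjI ballI allI impI notI)
    show "delta1 v \<ge> gaussian_inf v" if "v \<in> W12_weighted" for v :: "real ^ 'n \<Rightarrow> real"
      using that by (rule gaussian_inf_le_delta1)
    show "delta1 v \<ge> 1 / 2 * gaussian_inf_same_norm v" if "v \<in> W12_weighted" for v :: "real ^ 'n \<Rightarrow> real"
      using that by (rule gaussian_inf_same_norm_le_delta1)
    \<comment> \<open>Equality at \<open>u\<close> with a positive infimum rules out every larger
      constant.\<close>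
    show False if "C > 1" "\<forall>v\<in>(W12_weighted :: (real ^ 'n \<Rightarrow> real) set). delta1 v \<ge> C * gaussian_inf v" for C
      using bspec[OF that(2) u(1)] that(1) u by simp
    show False if "C > 1/2" "\<forall>v\<in>(W12_weighted :: (real ^ 'n \<Rightarrow> real) set). delta1 v \<ge> C * gaussian_inf_same_norm v" for C
      using bspec[OF that(2) u(1)] that(1) u by simp
    show "\<exists>u\<in>(W12_weighted :: (real ^ 'n \<Rightarrow> real) set). delta1 u = gaussian_inf u \<and>
        \<not> (delta1 u = 0 \<and> gaussian_inf u = 0)"
      using u by (intro bexI[of _ u]) auto
    show "\<exists>u\<in>(W12_weighted :: (real ^ 'n \<Rightarrow> real) set). delta1 u = 1/2 * gaussian_inf_same_norm u \<and>
        \<not> (delta1 u = 0 \<and> 1/2 * gaussian_inf_same_norm u = 0)"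
      using u by (intro bexI[of _ u]) auto
  qed
qed

end
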